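(* Let $n\ge 3$ and let $\mathcal A$ be the braid arrangement in $\mathbf C^n$. Let $c\in\mathfrak S_{n-1}\subset\mathfrak S_n$ be any $(n-1)$-cycle. As a representation of $\mathfrak S_{n-1}$, $S_{\mathcal A^\perp,-2}(\mathrm{top})$ is isomorphic to $\mathrm{Ind}_{\langle c\rangle}^{\mathfrak S_{n-1}}(\zeta)$, where $\zeta$ is the character of $\langle c\rangle$ with $\zeta(c)=e^{2\pi i/(n-1)}$. As a representation of $\mathfrak S_{n-2}\subset\mathfrak S_{n-1}$, $S_{\mathcal A^\perp,-2}(\mathrm{top})$ is isomorphic to the regular representation.
   Context: The braid arrangement $\mathcal A\subset\mathbf C^n$ consists of the hyperplanes $x_i=x_j$, $1\le i<j\le n$. Let $\mathbf C^{\mathcal A}$ have basis $h_{ij}$ ($1\le i<j\le n$), with the convention $h_{ji}=-h_{ij}$, and let $\varphi:\mathbf C^{\mathcal A}\to\mathbf C^n$, $h_{ij}\mapsto e_i-e_j$. Let $K=\ker\varphi$ (of dimension $\binom{n-1}{2}$) and let $\mathcal A^\perp$ be the arrangement in $K$ of hyperplanes $\ker(h_{ij}^*|_K)$, $h_{ij}^*$ the coordinate functionals. $\mathfrak S_n$ acts on $\mathbf C^{\mathcal A}$ by $\pi h_{ij}=h_{\pi(i)\pi(j)}$, making $\varphi$ equivariant (with $\mathfrak S_n$ permuting coordinates of $\mathbf C^n$); hence $\mathfrak S_n$ acts on $K$ and on $S_{\mathcal A^\perp,-2}$. $\mathfrak S_{n-1}\subset\mathfrak S_n$ is the stabilizer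 of $n$, and $\mathfrak S_{n-2}\subset\mathfrak S_{n-1}$ the stabilizer of $n-1$ and $n$. Internal zonotopal algebra: for a finite set $\mathcal B$ of linear hyperplanes in a finite-dimensional complex vector space $U$ and $u\in U$, $\rho_{\mathcal B}(u)$ is the number of hyperplanes of $\mathcal B$ not containing $u$; $I_{\mathcal B,-2}\subset\mathrm{Sym}(U)$ is generated by $u^{\max\{\rho_{\mathcal B}(u)-1,0\}}$, $u\in U$; $S_{\mathcal B,-2}=\mathrm{Sym}(U)/I_{\mathcal B,-2}$; $S_{\mathcal B,-2}(\mathrm{top})$ is its nonzero graded component of largest degree.
   Formalization: Hyperplanes of the dual arrangement are counted with multiplicity (this matters only for n = 3, where as a set they coincide and S would be 0), and the ideal's generators range over nonzero u only, since u = 0 would contribute 0^0 = 1. *)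

theory Defs
  imports "HOL-Algebra.Algebra" "HOL-Algebra.Algebraic_Closure_Type" "HOL-Library.Poly_Mapping"
begin

section \<open>Complex representations\<close>

text \<open>Complex vector spaces are modules over the ring \<^term>\<open>complex_ring\<close>; the fields
  \<open>mult\<close> and \<open>one\<close> of a module record play no role.\<close>

abbreviation complex_ring :: "complex ring" where
  "complex_ring \<equiv> ring_of_type_algebra"

definition linear_maps ::
    "(complex, 'v, 'x) module_scheme \<Rightarrow> (complex, 'w, 'y) module_scheme \<Rightarrow> ('v \<Rightarrow> 'w) set" where
  "linear_maps V W = {f \<in> carrier V \<rightarrow> carrier W.
     (\<forall>x\<in>carrier V. \<forall>y\<in>carrier V. f (x \<oplus>\<^bsub>V\<^esub> y) = f x \<oplus>\<^bsub>W\<^esub> f y) \<and>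
     (\<forall>a. \<forall>x\<in>carrier V. f (a \<odot>\<^bsub>V\<^esub> x) = a \<odot>\<^bsub>W\<^esub> f x)}"

definition representation ::
    "('g, 'z) monoid_scheme \<Rightarrow> (complex, 'v, 'x) module_scheme \<Rightarrow> ('g \<Rightarrow> 'v \<Rightarrow> 'v) \<Rightarrow> bool" where
  "representation G V \<rho> \<longleftrightarrow> group G \<and> module complex_ring V \<and>
     (\<forall>g\<in>carrier G. \<rho> g \<in> linear_maps V V) \<and>
     (\<forall>v\<in>carrier V. \<rho> \<one>\<^bsub>G\<^esub> v = v) \<and>
     (\<forall>g\<in>carrier G. \<forall>h\<in>carrier G. \<forall>v\<in>carrier V. \<rho> (g \<otimes>\<^bsub>G\<^esub> h) v = \<rho> g (\<rho> h v))"

definition rep_isomorphic ::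
    "('g, 'z) monoid_scheme \<Rightarrow> (complex, 'v, 'x) module_scheme \<Rightarrow> ('g \<Rightarrow> 'v \<Rightarrow> 'v)
      \<Rightarrow> (complex, 'w, 'y) module_scheme \<Rightarrow> ('g \<Rightarrow> 'w \<Rightarrow> 'w) \<Rightarrow> bool" where
  "rep_isomorphic G V \<rho> W \<sigma> \<longleftrightarrow> representation G V \<rho> \<and> representation G W \<sigma> \<and>
     (\<exists>f\<in>linear_maps V W. bij_betw f (carrier V) (carrier W) \<and>
        (\<forall>g\<in>carrier G. \<forall>v\<in>carrier V. f (\<rho> g v) = \<sigma> g (f v)))"

definition complex_line :: "(complex, complex) module" where
  "complex_line =
     \<lparr>carrier = UNIV, monoid.mult = (*), one = 1, ring.zero = 0, add = (+), module.smult = (*)\<rparr>"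

definition function_module ::
    "'g set \<Rightarrow> (complex, 'w, 'y) module_scheme \<Rightarrow> (complex, 'g \<Rightarrow> 'w) module" where
  "function_module A W =
     \<lparr>carrier = A \<rightarrow>\<^sub>E carrier W,
      monoid.mult = (\<lambda>f g. \<lambda>x\<in>A. f x \<otimes>\<^bsub>W\<^esub> g x),
      one = (\<lambda>x\<in>A. \<one>\<^bsub>W\<^esub>),
      ring.zero = (\<lambda>x\<in>A. \<zero>\<^bsub>W\<^esub>),
      add = (\<lambda>f g. \<lambda>x\<in>A. f x \<oplus>\<^bsub>W\<^esub> g x),
      module.smult = (\<lambda>a f. \<lambda>x\<in>A. a \<odot>\<^bsub>W\<^esub> f x)\<rparr>"

text \<open>The regular representation on functions \<open>G \<rightarrow> \<complex>\<close>: as \<open>(g f)(x) = f (g\<inverse> x)\<close>, the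
  indicator function of \<open>x\<close> is sent to that of \<open>g x\<close>.\<close>

definition regular_module :: "('g, 'z) monoid_scheme \<Rightarrow> (complex, 'g \<Rightarrow> complex) module" where
  "regular_module G = function_module (carrier G) complex_line"

definition regular_action ::
    "('g, 'z) monoid_scheme \<Rightarrow> 'g \<Rightarrow> ('g \<Rightarrow> complex) \<Rightarrow> ('g \<Rightarrow> complex)" where
  "regular_action G g f = (\<lambda>x\<in>carrier G. f (inv\<^bsub>G\<^esub> g \<otimes>\<^bsub>G\<^esub> x))"

text \<open>The representation of a finite group \<open>G\<close> induced from a representation \<open>(W, \<sigma>)\<close> of a
  subgroup \<open>H\<close>, realised as the \<open>H\<close>-equivariant functions \<open>G \<rightarrow> W\<close> with \<open>G\<close> acting by right
  translation.\<close>

definition induced_module ::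
    "('g, 'z) monoid_scheme \<Rightarrow> 'g set \<Rightarrow> (complex, 'w, 'y) module_scheme
      \<Rightarrow> ('g \<Rightarrow> 'w \<Rightarrow> 'w) \<Rightarrow> (complex, 'g \<Rightarrow> 'w) module" where
  "induced_module G H W \<sigma> = (function_module (carrier G) W)
     \<lparr>carrier := {f \<in> carrier G \<rightarrow>\<^sub>E carrier W.
        \<forall>h\<in>H. \<forall>x\<in>carrier G. f (h \<otimes>\<^bsub>G\<^esub> x) = \<sigma> h (f x)}\<rparr>"

definition induced_action ::
    "('g, 'z) monoid_scheme \<Rightarrow> 'g \<Rightarrow> ('g \<Rightarrow> 'w) \<Rightarrow> ('g \<Rightarrow> 'w)" where
  "induced_action G g f = (\<lambda>x\<in>carrier G. f (x \<otimes>\<^bsub>G\<^esub> g))"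

section \<open>Symmetric algebras\<close>

text \<open>The vector space with basis \<open>'e\<close> is \<^typ>\<open>'e \<Rightarrow>\<^sub>0 complex\<close>. Its symmetric algebra is the
  polynomial ring with one variable for each element of \<open>'e\<close>. For a subspace \<open>U\<close>, the canonical
  map from \<open>Sym(U)\<close> to this polynomial ring is injective, so that \<open>Sym(U)\<close> is the
  subalgebra generated by the linear forms \<open>u \<in> U\<close>.\<close>

type_synonym 'e cpoly = "('e \<Rightarrow>\<^sub>0 nat) \<Rightarrow>\<^sub>0 complex"

definition const_poly :: "complex \<Rightarrow> 'e cpoly" where
  "const_poly a = Poly_Mapping.single 0 a"

definition linear_form :: "('e \<Rightarrow>\<^sub>0 complex) \<Rightarrow> 'e cpoly" where
  "linear_form u = (\<Sum>e\<in>Poly_Mapping.keys u.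
     Poly_Mapping.single (Poly_Mapping.single e 1) (Poly_Mapping.lookup u e))"

definition Sym :: "('e \<Rightarrow>\<^sub>0 complex) set \<Rightarrow> 'e cpoly ring" where
  "Sym U = ring_of_type_algebra
     \<lparr>carrier := generate_ring ring_of_type_algebra (range const_poly \<union> linear_form ` U)\<rparr>"

definition homogeneous :: "nat \<Rightarrow> 'e cpoly \<Rightarrow> bool" where
  "homogeneous d p \<longleftrightarrow> (\<forall>m\<in>Poly_Mapping.keys p.
     (\<Sum>e\<in>Poly_Mapping.keys m. Poly_Mapping.lookup m e) = d)"

definition subst_poly :: "('e \<Rightarrow> 'e cpoly) \<Rightarrow> 'e cpoly \<Rightarrow> 'e cpoly" where
  "subst_poly s p = (\<Sum>m\<in>Poly_Mapping.keys p. const_poly (Poly_Mapping.lookup p m) *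
     (\<Prod>e\<in>Poly_Mapping.keys m. s e ^ Poly_Mapping.lookup m e))"

section \<open>Internal zonotopal algebra\<close>

text \<open>An arrangement is a finite family \<open>(B i)\<^sub>i\<^sub>\<in>\<^sub>I\<close> of hyperplanes, so that hyperplanes are counted
  with multiplicity. This matters for the dual of the braid arrangement with \<open>n = 3\<close>, whose three
  hyperplanes all coincide.\<close>

definition rho :: "'i set \<Rightarrow> ('i \<Rightarrow> 'u set) \<Rightarrow> 'u \<Rightarrow> nat" where
  "rho I B u = card {i \<in> I. u \<notin> B i}"

text \<open>Truncated subtraction yields the exponent \<open>max {\<rho> u - 1, 0}\<close>. The vector \<open>u = 0\<close> is excluded,
  as the exponent would be \<open>0\<close> and the convention \<open>0\<^sup>0 = 1\<close> would make the ideal improper.\<close>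

definition internal_ideal ::
    "('e \<Rightarrow>\<^sub>0 complex) set \<Rightarrow> 'i set \<Rightarrow> ('i \<Rightarrow> ('e \<Rightarrow>\<^sub>0 complex) set) \<Rightarrow> 'e cpoly set" where
  "internal_ideal U I B = Idl\<^bsub>Sym U\<^esub> {linear_form u ^ (rho I B u - 1) |u. u \<in> U \<and> u \<noteq> 0}"

definition internal_algebra ::
    "('e \<Rightarrow>\<^sub>0 complex) set \<Rightarrow> 'i set \<Rightarrow> ('i \<Rightarrow> ('e \<Rightarrow>\<^sub>0 complex) set) \<Rightarrow> 'e cpoly set ring" where
  "internal_algebra U I B = Sym U Quot internal_ideal U I B"

definition internal_component ::
    "('e \<Rightarrow>\<^sub>0 complex) set \<Rightarrow> 'i set \<Rightarrow> ('i \<Rightarrow> ('e \<Rightarrow>\<^sub>0 complex) set) \<Rightarrow> nat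
      \<Rightarrow> (complex, 'e cpoly set) module" where
  "internal_component U I B d = (let J = internal_ideal U I B; S = internal_algebra U I B in
     \<lparr>carrier = {J +>\<^bsub>Sym U\<^esub> p |p. p \<in> carrier (Sym U) \<and> homogeneous d p},
      monoid.mult = monoid.mult S, one = one S, ring.zero = ring.zero S, add = add S,
      module.smult = (\<lambda>a x. (J +>\<^bsub>Sym U\<^esub> const_poly a) \<otimes>\<^bsub>S\<^esub> x)\<rparr>)"

definition internal_top ::
    "('e \<Rightarrow>\<^sub>0 complex) set \<Rightarrow> 'i set \<Rightarrow> ('i \<Rightarrow> ('e \<Rightarrow>\<^sub>0 complex) set)
      \<Rightarrow> (complex, 'e cpoly set) module" where
  "internal_top U I B = internal_component U I B
     (GREATEST d. carrier (internal_component U I B d) \<noteq> {\<zero>\<^bsub>internal_algebra U I B\<^esub>})"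

section \<open>The dual of the braid arrangement\<close>

definition braid_pairs :: "nat \<Rightarrow> (nat \<times> nat) set" where
  "braid_pairs n = {(i, j). 1 \<le> i \<and> i < j \<and> j \<le> n}"

definition hvec :: "nat \<Rightarrow> nat \<Rightarrow> (nat \<times> nat) \<Rightarrow>\<^sub>0 complex" where
  "hvec i j = (if i < j then Poly_Mapping.single (i, j) 1
               else if j < i then - Poly_Mapping.single (j, i) 1 else 0)"

text \<open>The map \<open>\<phi>\<close>, with \<open>\<complex>\<^sup>n\<close> inside \<^typ>\<open>nat \<Rightarrow>\<^sub>0 complex\<close>.\<close>

definition braid_map :: "((nat \<times> nat) \<Rightarrow>\<^sub>0 complex) \<Rightarrow> (nat \<Rightarrow>\<^sub>0 complex)" where
  "braid_map u = (\<Sum>(i, j)\<in>Poly_Mapping.keys u.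
     Poly_Mapping.single i (Poly_Mapping.lookup u (i, j))
     - Poly_Mapping.single j (Poly_Mapping.lookup u (i, j)))"

definition braid_kernel :: "nat \<Rightarrow> ((nat \<times> nat) \<Rightarrow>\<^sub>0 complex) set" where
  "braid_kernel n = {u. Poly_Mapping.keys u \<subseteq> braid_pairs n \<and> braid_map u = 0}"

definition dual_hyperplane :: "nat \<Rightarrow> nat \<times> nat \<Rightarrow> ((nat \<times> nat) \<Rightarrow>\<^sub>0 complex) set" where
  "dual_hyperplane n e = {u \<in> braid_kernel n. Poly_Mapping.lookup u e = 0}"

definition dual_braid_top :: "nat \<Rightarrow> (complex, (nat \<times> nat) cpoly set) module" where
  "dual_braid_top n = internal_top (braid_kernel n) (braid_pairs n) (dual_hyperplane n)"

text \<open>A permutation \<open>\<pi>\<close> acts on polynomials by the algebra homomorphism extending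
  \<open>h\<^sub>i\<^sub>j \<mapsto> h\<^sub>\<pi>\<^sub>(\<^sub>i\<^sub>)\<^sub>\<pi>\<^sub>(\<^sub>j\<^sub>)\<close>, and on a residue class in the quotient elementwise.\<close>

definition poly_action :: "(nat \<Rightarrow> nat) \<Rightarrow> (nat \<times> nat) cpoly \<Rightarrow> (nat \<times> nat) cpoly" where
  "poly_action \<pi> = subst_poly (\<lambda>(i, j). linear_form (hvec (\<pi> i) (\<pi> j)))"

definition class_action ::
    "(nat \<Rightarrow> nat) \<Rightarrow> (nat \<times> nat) cpoly set \<Rightarrow> (nat \<times> nat) cpoly set" where
  "class_action \<pi> A = poly_action \<pi> ` A"

text \<open>The group \<^term>\<open>sym_group (n - 1)\<close> consists of permutations of \<^typ>\<open>nat\<close> fixing everything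
  outside \<open>{1..n - 1}\<close>, so it is literally the stabilizer of \<open>n\<close> in \<^term>\<open>sym_group n\<close>.\<close>

lemma sym_group_stabilizer:
  assumes "1 \<le> n"
  shows "carrier (sym_group (n - 1)) = {\<pi> \<in> carrier (sym_group n). \<pi> n = n}"
proof -
  have "\<pi> permutes {1..n - 1} \<longleftrightarrow> \<pi> permutes {1..n} \<and> \<pi> n = n" for \<pi> :: "nat \<Rightarrow> nat"
  proof
    assume *: "\<pi> permutes {1..n - 1}"
    have "\<pi> permutes {1..n}" by (rule permutes_subset[OF *]) auto
    moreover have "\<pi> n = n" by (rule permutes_not_in[OF *]) (use assms in auto)
    ultimately show "\<pi> permutes {1..n} \<and> \<pi> n = n" ..
  next
    assume *: "\<pi> permutes {1..n} \<and> \<pi> n = n"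
    show "\<pi> permutes {1..n - 1}"
    proof (rule permutes_superset[of \<pi> "{1..n}"])
      show "\<pi> permutes {1..n}" using * by blast
      fix x assume "x \<in> {1..n} - {1..n - 1}"
      then have "x = n" by auto
      then show "\<pi> x = x" using * by simp
    qed
  qed
  then show ?thesis by (simp add: sym_group_def)
qed

end

theory Submission
  imports Defs "HOL-Library.Sublist"
begin

text \<open>Write \<open>m = n - 1\<close> and let \<open>y\<^sub>i\<^sub>j\<close> be the cycle \<open>h\<^sub>i\<^sub>j + h\<^sub>j\<^sub>n + h\<^sub>n\<^sub>i\<close>, for \<open>i, j \<le> m\<close>. These elements span the
  kernel, and as \<open>\<rho> = 3\<close> on triangles they satisfy \<open>y\<^sub>i\<^sub>j\<^sup>2 = 0\<close> and the (commutative) Arnold relation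
  modulo the ideal. Hence products of more than \<open>m - 1\<close> of them vanish, and those of degree
  \<open>m - 1\<close> are spanned by the chains \<open>y\<^sub>m\<^sub>a y\<^sub>a\<^sub>b \<dots>\<close>, which the stabilizer of \<open>m\<close> permutes simply
  transitively. They are independent: order the vertices with \<open>n\<close> last and send an edge to a
  variable attached to its higher end. The highest vertex of the support of a cycle \<open>u\<close> shows that
  the image of \<open>u\<close> involves at most \<open>\<rho>(u) - 2\<close> variables, so \<open>u\<close> to the power \<open>\<rho>(u) - 1\<close> has no
  squarefree monomial, while exactly one chain has one. This gives the regular representation.

  For the induced representation, send a function \<open>b\<close> on the group to the sum of the \<open>b(g)\<close> times
  the chain along \<open>g\<inverse>\<close> of the long cycle. Sums of chains over shuffles vanish, so Klyachko's element,
  the sum of all \<open>g\<close> weighted by \<open>q\<close> to the major index, acts on a chain by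
  \<open>(1 - q) \<dots> (1 - q\<^sup>m\<^sup>-\<^sup>1)\<close>; for \<open>q = \<zeta>(c)\<inverse>\<close> its coefficients lie in the induced representation and this
  scalar is nonzero. So the map is surjective, and it is bijective since both dimensions are
  \<open>(m - 1)!\<close>.\<close>

section \<open>Polynomials\<close>

text \<open>The commutative, antisymmetric generators with vanishing squares and the Arnold relation
  present the cohomology ring of the configuration space of n - 1 points in three-space, whose top
  degree is dual to the multilinear Lie elements. This is why sums over shuffles vanish and why
  Klyachko's element is the tool for the cyclic group. The two bounds use the ideal very
  differently. Triangles alone give the spanning chains, whereas independence has to survive the
  powers of all cycles and so requires a functional that annihilates the whole ideal. The functional
  built here detects a single chain; invariance of the ideal under permutations carries it to every
  other chain. For the induced representation injectivity is not shown directly: an equivariant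
  function is determined on the stabilizer of n - 1, which meets every coset of the cyclic group,
  and this bounds the dimension of the source. The root of unity enters inverted because the word of
  g is a rotation of the word of c g, and this rotation multiplies the weight by q.\<close>

lemma const_poly_simps [simp]:
  "const_poly 0 = 0" "const_poly 1 = 1"
  by (simp_all add: const_poly_def)

lemma const_poly_add: "const_poly (a + b) = const_poly a + const_poly b"
  by (simp add: const_poly_def single_add)

lemma const_poly_uminus: "const_poly (- a) = - const_poly a"
  by (simp add: const_poly_def single_uminus)

lemma const_poly_mult: "const_poly (a * b) = const_poly a * const_poly b"
  by (simp add: const_poly_def mult_single)

lemma const_poly_sum: "const_poly (sum f A) = (\<Sum>x\<in>A. const_poly (f x))"
  by (induction A rule: infinite_finite_induct) (auto simp: const_poly_add)

lemma lookup_const_poly_times: "Poly_Mapping.lookup (const_poly a * p) m = a * Poly_Mapping.lookup p m"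
proof -
  have "const_poly a * p = Poly_Mapping.map ((*) a) p"
    by (simp add: const_poly_def mult_map_scale_conv_mult)
  then show ?thesis by (simp add: Poly_Mapping.map.rep_eq when_def)
qed

lemma poly_mapping_sum_single:
  fixes p :: "'k \<Rightarrow>\<^sub>0 'a::comm_monoid_add"
  assumes "finite M" "Poly_Mapping.keys p \<subseteq> M"
  shows "p = (\<Sum>m\<in>M. Poly_Mapping.single m (Poly_Mapping.lookup p m))"
proof (rule poly_mapping_eqI)
  fix k
  have "Poly_Mapping.lookup (\<Sum>m\<in>M. Poly_Mapping.single m (Poly_Mapping.lookup p m)) k
      = (\<Sum>m\<in>M. if m = k then Poly_Mapping.lookup p k else 0)"
    by (auto simp: lookup_sum lookup_single when_def intro!: sum.cong)
  also have "\<dots> = Poly_Mapping.lookup p k" using assms by (auto simp: in_keys_iff)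
  finally show "Poly_Mapping.lookup p k = Poly_Mapping.lookup (\<Sum>m\<in>M. Poly_Mapping.single m (Poly_Mapping.lookup p m)) k" by simp
qed

section \<open>Substitution homomorphisms and linear forms\<close>

definition monom_subst :: "('e \<Rightarrow> 'e cpoly) \<Rightarrow> ('e \<Rightarrow>\<^sub>0 nat) \<Rightarrow> 'e cpoly" where
  "monom_subst s m = (\<Prod>e\<in>Poly_Mapping.keys m. s e ^ Poly_Mapping.lookup m e)"

lemma monom_subst_superset:
  assumes "finite E" "Poly_Mapping.keys m \<subseteq> E"
  shows "monom_subst s m = (\<Prod>e\<in>E. s e ^ Poly_Mapping.lookup m e)"
  unfolding monom_subst_def
  by (rule prod.mono_neutral_left) (use assms in \<open>auto simp: in_keys_iff\<close>)

lemma monom_subst_add: "monom_subst s (m + m') = monom_subst s m * monom_subst s m'"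
proof -
  let ?E = "Poly_Mapping.keys m \<union> Poly_Mapping.keys m'"
  have "Poly_Mapping.keys (m + m') \<subseteq> ?E" by (rule keys_add)
  then show ?thesis
    by (simp add: monom_subst_superset[of ?E] lookup_add power_add prod.distrib)
qed

lemma subst_poly_superset:
  assumes "finite M" "Poly_Mapping.keys p \<subseteq> M"
  shows "subst_poly s p = (\<Sum>m\<in>M. const_poly (Poly_Mapping.lookup p m) * monom_subst s m)"
  unfolding subst_poly_def monom_subst_def[symmetric]
  by (rule sum.mono_neutral_left) (use assms in \<open>auto simp: in_keys_iff\<close>)

lemma subst_poly_add: "subst_poly s (p + q) = subst_poly s p + subst_poly s q"
proof -
  let ?M = "Poly_Mapping.keys p \<union> Poly_Mapping.keys q"
  have "Poly_Mapping.keys (p + q) \<subseteq> ?M" by (rule keys_add)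
  then show ?thesis
    by (simp add: subst_poly_superset[of ?M] lookup_add const_poly_add distrib_right sum.distrib)
qed

lemma subst_poly_zero [simp]: "subst_poly s 0 = 0"
  by (simp add: subst_poly_def)

lemma subst_poly_sum: "subst_poly s (sum f A) = (\<Sum>x\<in>A. subst_poly s (f x))"
  by (induction A rule: infinite_finite_induct) (auto simp: subst_poly_add)

lemma subst_poly_single:
  "subst_poly s (Poly_Mapping.single m a) = const_poly a * monom_subst s m"
  by (simp add: subst_poly_superset[of "{m}"])

text \<open>Substitution is given by a sum over monomials, so multiplicativity has to come from
  expanding both factors; for single monomials it is additivity of exponents.\<close>

lemma subst_poly_mult: "subst_poly s (p * q) = subst_poly s p * subst_poly s q"
proof -
  have p: "p = (\<Sum>m\<in>Poly_Mapping.keys p. Poly_Mapping.single m (Poly_Mapping.lookup p m))"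
    by (rule poly_mapping_sum_single) auto
  have q: "q = (\<Sum>m\<in>Poly_Mapping.keys q. Poly_Mapping.single m (Poly_Mapping.lookup q m))"
    by (rule poly_mapping_sum_single) auto
  have "subst_poly s (p * q)
      = subst_poly s (\<Sum>m\<in>Poly_Mapping.keys p. \<Sum>m'\<in>Poly_Mapping.keys q.
          Poly_Mapping.single m (Poly_Mapping.lookup p m) * Poly_Mapping.single m' (Poly_Mapping.lookup q m'))"
    by (subst p, subst q) (simp add: sum_product)
  also have "\<dots> = (\<Sum>m\<in>Poly_Mapping.keys p. \<Sum>m'\<in>Poly_Mapping.keys q.
       (const_poly (Poly_Mapping.lookup p m) * monom_subst s m) * (const_poly (Poly_Mapping.lookup q m') * monom_subst s m'))"
    by (simp add: subst_poly_sum mult_single subst_poly_single const_poly_mult monom_subst_add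
        algebra_simps)
  also have "\<dots> = subst_poly s p * subst_poly s q"
    by (simp add: sum_product subst_poly_def monom_subst_def)
  finally show ?thesis .
qed

lemma subst_poly_const [simp]: "subst_poly s (const_poly a) = const_poly a"
  by (simp add: const_poly_def subst_poly_single monom_subst_def)

lemma subst_poly_one [simp]: "subst_poly s 1 = 1"
  using subst_poly_const[of s 1] by (simp del: subst_poly_const)

lemma subst_poly_uminus: "subst_poly s (- p) = - subst_poly s p"
  using subst_poly_add[of s p "- p"] by (simp add: eq_neg_iff_add_eq_0 add.commute)

lemma subst_poly_diff: "subst_poly s (p - q) = subst_poly s p - subst_poly s q"
  using subst_poly_add[of s p "- q"] by (simp add: subst_poly_uminus)

lemma subst_poly_power: "subst_poly s (p ^ k) = subst_poly s p ^ k"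
  by (induction k) (auto simp: subst_poly_mult)

lemmas subst_poly_simps = subst_poly_add subst_poly_mult subst_poly_uminus subst_poly_diff
  subst_poly_power subst_poly_sum

definition var_poly :: "'e \<Rightarrow> 'e cpoly" where
  "var_poly e = Poly_Mapping.single (Poly_Mapping.single e 1) 1"

lemma subst_poly_var [simp]: "subst_poly s (var_poly e) = s e"
  by (simp add: var_poly_def subst_poly_single monom_subst_def)

lemma linear_form_superset:
  assumes "finite E" "Poly_Mapping.keys u \<subseteq> E"
  shows "linear_form u = (\<Sum>e\<in>E. const_poly (Poly_Mapping.lookup u e) * var_poly e)"
proof -
  have "linear_form u = (\<Sum>e\<in>E. Poly_Mapping.single (Poly_Mapping.single e 1) (Poly_Mapping.lookup u e))"
    unfolding linear_form_def
    by (rule sum.mono_neutral_left) (use assms in \<open>auto simp: in_keys_iff\<close>)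
  then show ?thesis by (simp add: var_poly_def const_poly_def mult_single)
qed

lemma linear_form_zero [simp]: "linear_form 0 = 0"
  by (simp add: linear_form_def)

lemma linear_form_add: "linear_form (u + v) = linear_form u + linear_form v"
proof -
  let ?E = "Poly_Mapping.keys u \<union> Poly_Mapping.keys v"
  have "Poly_Mapping.keys (u + v) \<subseteq> ?E" by (rule keys_add)
  then show ?thesis
    by (simp add: linear_form_superset[of ?E] lookup_add const_poly_add distrib_right sum.distrib)
qed

lemma linear_form_uminus: "linear_form (- u) = - linear_form u"
  using linear_form_add[of u "- u"] by (simp add: eq_neg_iff_add_eq_0 add.commute)

lemma linear_form_single: "linear_form (Poly_Mapping.single e a) = const_poly a * var_poly e"
  by (simp add: linear_form_superset[of "{e}"])

section \<open>Degrees and homogeneous components\<close>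

definition mdegree :: "('e \<Rightarrow>\<^sub>0 nat) \<Rightarrow> nat" where
  "mdegree m = (\<Sum>e\<in>Poly_Mapping.keys m. Poly_Mapping.lookup m e)"

lemma mdegree_superset:
  assumes "finite E" "Poly_Mapping.keys m \<subseteq> E"
  shows "mdegree m = (\<Sum>e\<in>E. Poly_Mapping.lookup m e)"
  unfolding mdegree_def
  by (rule sum.mono_neutral_left) (use assms in \<open>auto simp: in_keys_iff\<close>)

lemma mdegree_add: "mdegree (m + m') = mdegree m + mdegree m'"
proof -
  let ?E = "Poly_Mapping.keys m \<union> Poly_Mapping.keys m'"
  have "Poly_Mapping.keys (m + m') \<subseteq> ?E" by (rule keys_add)
  then show ?thesis by (simp add: mdegree_superset[of ?E] lookup_add sum.distrib)
qed

lemma homogeneous_iff: "homogeneous d p \<longleftrightarrow> (\<forall>m. Poly_Mapping.lookup p m \<noteq> 0 \<longrightarrow> mdegree m = d)"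
  by (auto simp: homogeneous_def mdegree_def in_keys_iff)

lemma homogeneous_zero [simp]: "homogeneous d 0"
  by (simp add: homogeneous_def)

lemma homogeneous_add: "homogeneous d p \<Longrightarrow> homogeneous d q \<Longrightarrow> homogeneous d (p + q)"
  unfolding homogeneous_iff lookup_add by (metis add_0)

lemma homogeneous_sum: "(\<And>x. x \<in> A \<Longrightarrow> homogeneous d (f x)) \<Longrightarrow> homogeneous d (sum f A)"
  by (induction A rule: infinite_finite_induct) (auto intro: homogeneous_add)

lemma homogeneous_const_poly_times: "homogeneous d p \<Longrightarrow> homogeneous d (const_poly a * p)"
  by (auto simp: homogeneous_iff lookup_const_poly_times)

lemma homogeneous_mult: "homogeneous d p \<Longrightarrow> homogeneous d' q \<Longrightarrow> homogeneous (d + d') (p * q)"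
  using keys_mult[of p q] unfolding homogeneous_def mdegree_def[symmetric]
  by (fastforce simp: mdegree_add)

lemma homogeneous_one: "homogeneous 0 1"
  by (auto simp: homogeneous_def)

lemma homogeneous_var_poly: "homogeneous 1 (var_poly e)"
  by (auto simp: homogeneous_def var_poly_def)

lemma homogeneous_linear_form: "homogeneous 1 (linear_form u)"
  by (subst linear_form_superset[of "Poly_Mapping.keys u"])
     (rule finite_keys subset_refl homogeneous_sum homogeneous_const_poly_times homogeneous_var_poly)+

text \<open>Serves to discard, in a linear combination of homogeneous elements, the terms of other
  degrees.\<close>

definition hom_component :: "nat \<Rightarrow> 'e cpoly \<Rightarrow> 'e cpoly" where
  "hom_component d p = (\<Sum>m\<in>{m \<in> Poly_Mapping.keys p. mdegree m = d}. Poly_Mapping.single m (Poly_Mapping.lookup p m))"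

lemma lookup_hom_component: "Poly_Mapping.lookup (hom_component d p) m = (if mdegree m = d then Poly_Mapping.lookup p m else 0)"
proof -
  have "Poly_Mapping.lookup (hom_component d p) m
      = (\<Sum>k\<in>{m \<in> Poly_Mapping.keys p. mdegree m = d}. if k = m then Poly_Mapping.lookup p m else 0)"
    by (auto simp: hom_component_def lookup_sum lookup_single when_def intro!: sum.cong)
  also have "\<dots> = (if mdegree m = d then Poly_Mapping.lookup p m else 0)"
    by (auto simp: in_keys_iff)
  finally show ?thesis .
qed

lemma hom_component_add: "hom_component d (p + q) = hom_component d p + hom_component d q"
  by (rule poly_mapping_eqI) (auto simp: lookup_hom_component lookup_add)

lemma hom_component_zero [simp]: "hom_component d 0 = 0"
  by (rule poly_mapping_eqI) (auto simp: lookup_hom_component)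

lemma hom_component_const_poly_times:
  "hom_component d (const_poly a * p) = const_poly a * hom_component d p"
  by (rule poly_mapping_eqI) (auto simp: lookup_hom_component lookup_const_poly_times)

lemma hom_component_homogeneous:
  "homogeneous d' p \<Longrightarrow> hom_component d p = (if d = d' then p else 0)"
  by (rule poly_mapping_eqI) (auto simp: lookup_hom_component homogeneous_iff)

text \<open>Given by closure rules, so that arguments by linearity become rule inductions without
  explicit sums and coefficients.\<close>

inductive_set lspan :: "'e cpoly set \<Rightarrow> 'e cpoly set" for B where
  zero: "0 \<in> lspan B"
| base: "b \<in> B \<Longrightarrow> b \<in> lspan B"
| add: "p \<in> lspan B \<Longrightarrow> q \<in> lspan B \<Longrightarrow> p + q \<in> lspan B"
| scale: "p \<in> lspan B \<Longrightarrow> const_poly a * p \<in> lspan B"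

lemma lspan_sum: "(\<And>x. x \<in> A \<Longrightarrow> f x \<in> lspan B) \<Longrightarrow> sum f A \<in> lspan B"
  by (induction A rule: infinite_finite_induct) (auto intro: lspan.intros)

lemma lspan_uminus: "p \<in> lspan B \<Longrightarrow> - p \<in> lspan B"
  using lspan.scale[of p B "-1"] by (simp add: const_poly_uminus)

lemma lspan_diff: "p \<in> lspan B \<Longrightarrow> q \<in> lspan B \<Longrightarrow> p - q \<in> lspan B"
  using lspan.add[of p B "- q"] by (simp add: lspan_uminus)

lemma lspan_subset_lspan: "B \<subseteq> lspan C \<Longrightarrow> lspan B \<subseteq> lspan C"
proof
  fix p assume "B \<subseteq> lspan C" "p \<in> lspan B"
  then show "p \<in> lspan C"
    by (induction rule: lspan.induct[OF \<open>p \<in> lspan B\<close>]) (auto intro: lspan.intros)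
qed

lemma lspan_mono: "B \<subseteq> C \<Longrightarrow> lspan B \<subseteq> lspan C"
  by (rule lspan_subset_lspan) (auto intro: lspan.base)

lemma lspan_mult_left:
  assumes "p \<in> lspan B" "\<And>b. b \<in> B \<Longrightarrow> r * b \<in> lspan C"
  shows "r * p \<in> lspan C"
  using assms(1)
proof induction
  case (scale p a)
  then show ?case using lspan.scale[of "r * p" C a] by (simp add: mult.left_commute)
qed (auto simp: distrib_left assms(2) intro: lspan.intros)

lemma lspan_mult:
  assumes p: "p \<in> lspan B" and q: "q \<in> lspan C" and "\<And>b c. b \<in> B \<Longrightarrow> c \<in> C \<Longrightarrow> b * c \<in> lspan D"
  shows "p * q \<in> lspan D"
proof (rule lspan_mult_left[OF q])
  fix c assume "c \<in> C"
  then have "c * p \<in> lspan D"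
    by (intro lspan_mult_left[OF p]) (simp add: assms(3) mult.commute)
  then show "p * c \<in> lspan D" by (simp add: mult.commute)
qed

section \<open>Products modulo the Arnold relations\<close>

text \<open>The monomial of a path. A one-vertex list gives the empty product, so k vertices mean
  degree k - 1.\<close>

fun chain :: "(nat \<Rightarrow> nat \<Rightarrow> 'a::comm_ring_1) \<Rightarrow> nat list \<Rightarrow> 'a" where
  "chain y (i # j # ws) = y i j * chain y (j # ws)"
| "chain y ws = 1"

text \<open>Loops and repeated pairs are allowed, which makes these sets multiply with degrees
  adding; the vanishing of degenerate products is left to the relations.\<close>

definition edge_products :: "(nat \<Rightarrow> nat \<Rightarrow> 'a::comm_ring_1) \<Rightarrow> nat set \<Rightarrow> nat \<Rightarrow> 'a set" where
  "edge_products y W d = {prod_list (map (case_prod y) ps) |ps. set ps \<subseteq> W \<times> W \<and> length ps = d}"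

lemma edge_products_0 [simp]: "edge_products y W 0 = {1}"
  by (auto simp: edge_products_def)

lemma edge_products_SucI:
  "i \<in> W \<Longrightarrow> j \<in> W \<Longrightarrow> p \<in> edge_products y W d \<Longrightarrow> y i j * p \<in> edge_products y W (Suc d)"
  unfolding edge_products_def by (force intro: exI[of _ "(i, j) # _"])

lemma edge_products_SucE:
  assumes "p \<in> edge_products y W (Suc d)"
  obtains i j q where "i \<in> W" "j \<in> W" "q \<in> edge_products y W d" "p = y i j * q"
proof -
  from assms obtain ps where ps: "p = prod_list (map (case_prod y) ps)" "set ps \<subseteq> W \<times> W"
    "length ps = Suc d" by (auto simp: edge_products_def)
  then obtain i j qs where "ps = (i, j) # qs" by (cases ps) auto
  with ps show ?thesis by (intro that[of i j "prod_list (map (case_prod y) qs)"])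
      (auto simp: edge_products_def)
qed

lemma edge_products_mult:
  assumes "p \<in> edge_products y W d" "q \<in> edge_products y W d'"
  shows "p * q \<in> edge_products y W (d + d')"
proof -
  from assms obtain ps qs where "p = prod_list (map (case_prod y) ps)" "set ps \<subseteq> W \<times> W"
    "length ps = d" "q = prod_list (map (case_prod y) qs)" "set qs \<subseteq> W \<times> W" "length qs = d'"
    by (auto simp: edge_products_def)
  then show ?thesis unfolding edge_products_def by (auto intro!: exI[of _ "ps @ qs"])
qed

lemma chain_in_edge_products: "set (r # ws) \<subseteq> W \<Longrightarrow> chain y (r # ws) \<in> edge_products y W (length ws)"
proof (induction ws arbitrary: r)
  case (Cons a ws)
  then show ?case using edge_products_SucI[of r W a "chain y (a # ws)" y "length ws"] by simp
qed simp

text \<open>\<open>J\<close> is assumed to be an ideal of the subring \<open>S\<close>, not of the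
  whole polynomial ring, hence the membership obligations in \<open>S\<close>. Squares are covered
  by \<open>arnold\<close> with k = i: as \<open>y i i = 0\<close>, it then reads
  \<open>- (y i j)^2\<close>.\<close>

locale arnold_ideal =
  fixes S J :: "'e cpoly set" and y :: "nat \<Rightarrow> nat \<Rightarrow> 'e cpoly" and V :: "nat set"
  assumes S_const: "const_poly a \<in> S"
    and S_add: "p \<in> S \<Longrightarrow> q \<in> S \<Longrightarrow> p + q \<in> S"
    and S_mult: "p \<in> S \<Longrightarrow> q \<in> S \<Longrightarrow> p * q \<in> S"
    and J_subset: "J \<subseteq> S"
    and J_zero: "0 \<in> J"
    and J_add: "p \<in> J \<Longrightarrow> q \<in> J \<Longrightarrow> p + q \<in> J"
    and J_mult: "s \<in> S \<Longrightarrow> p \<in> J \<Longrightarrow> s * p \<in> J"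
    and y_S: "i \<in> V \<Longrightarrow> j \<in> V \<Longrightarrow> y i j \<in> S"
    and y_refl: "y i i = 0"
    and y_antisym: "y i j = - y j i"
    and arnold: "i \<in> V \<Longrightarrow> j \<in> V \<Longrightarrow> k \<in> V \<Longrightarrow> y i j * y j k + y j k * y k i + y k i * y i j \<in> J"
begin

lemma J_mult_right: "p \<in> J \<Longrightarrow> s \<in> S \<Longrightarrow> p * s \<in> J"
  using J_mult[of s p] by (simp add: mult.commute)

lemma J_uminus: "p \<in> J \<Longrightarrow> - p \<in> J"
  using J_mult[OF S_const[of "-1"], of p] by (simp add: const_poly_uminus)

lemma J_diff: "p \<in> J \<Longrightarrow> q \<in> J \<Longrightarrow> p - q \<in> J"
  using J_add[of p "- q"] by (simp add: J_uminus)

lemma J_sum: "(\<And>x. x \<in> A \<Longrightarrow> f x \<in> J) \<Longrightarrow> sum f A \<in> J"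
  by (induction A rule: infinite_finite_induct) (auto intro: J_zero J_add)

lemma S_zero: "0 \<in> S" and S_one: "1 \<in> S"
  using S_const[of 0] S_const[of 1] by simp_all

lemma S_sum: "(\<And>x. x \<in> A \<Longrightarrow> f x \<in> S) \<Longrightarrow> sum f A \<in> S"
  by (induction A rule: infinite_finite_induct) (auto intro: S_zero S_add)

lemma lspan_J: "p \<in> lspan J \<Longrightarrow> p \<in> J"
  by (induction rule: lspan.induct) (auto intro: J_zero J_add J_mult S_const)

lemma edge_products_S: "W \<subseteq> V \<Longrightarrow> p \<in> edge_products y W d \<Longrightarrow> p \<in> S"
proof (induction d arbitrary: p)
  case (Suc d)
  then show ?case by (elim edge_products_SucE) (auto intro!: S_mult y_S)
qed (auto simp: S_one)

lemma chain_S: "set ws \<subseteq> V \<Longrightarrow> chain y ws \<in> S"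
  using edge_products_S[OF _ chain_in_edge_products[of "hd ws" "tl ws" V y]]
  by (cases ws) (auto simp: S_one)

text \<open>Two edges at \<open>r\<close> can be traded for one: modulo \<open>J\<close> the Arnold
  relation gives \<open>y r z * y r a = (y r z - y r a) * y z a\<close>. Repeating this leaves at
  most one factor at the root, while all other factors stay inside \<open>W\<close>.\<close>

lemma edge_products_pull_out:
  assumes "insert r W \<subseteq> V" "p \<in> edge_products y (insert r W) d"
  shows "p \<in> lspan (J \<union> edge_products y W d
           \<union> {y r a * p' |a p' d'. d = Suc d' \<and> a \<in> W \<and> p' \<in> edge_products y W d'})"
    (is "p \<in> lspan (?N d)")
  using assms(2)
proof (induction d arbitrary: p)
  case 0
  then show ?case by (auto intro: lspan.base)
next
  case (Suc d)
  from Suc.prems obtain i j q where ij: "i \<in> insert r W" "j \<in> insert r W"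
    and q: "q \<in> edge_products y (insert r W) d" and p: "p = y i j * q"
    by (rule edge_products_SucE)
  have root: "y r z * b \<in> lspan (?N (Suc d))" if z: "z \<in> W" and b: "b \<in> ?N d" for z b
  proof -
    consider "b \<in> J" | "b \<in> edge_products y W d"
      | a p' d' where "b = y r a * p'" "d = Suc d'" "a \<in> W" "p' \<in> edge_products y W d'"
      using b by blast
    then show ?thesis
    proof cases
      case 1
      then have "y r z * b \<in> J" using z assms(1) by (intro J_mult y_S) auto
      then show ?thesis by (auto intro: lspan.base)
    next
      case 2
      then show ?thesis using z by (intro lspan.base) auto
    next
      case (3 a p' d')
      \<comment> \<open>With a = z this is \<open>- (y r z)^2\<close>, so a repeated edge is treated
        together with two different ones.\<close>
      define e where "e = y r z * y z a + y z a * y a r + y a r * y r z"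
      have e: "e \<in> J" unfolding e_def using 3 z assms(1) by (intro arnold) auto
      have p': "p' \<in> S" using 3 assms(1) by (intro edge_products_S[of W p' d']) auto
      have "y z a * p' \<in> edge_products y W d"
        using 3 z edge_products_SucI[of z W a p' y d'] by auto
      then have *: "y r z * (y z a * p') \<in> ?N (Suc d)" "y r a * (y z a * p') \<in> ?N (Suc d)"
        using 3 z by blast+
      have "e * p' \<in> ?N (Suc d)" using J_mult_right[OF e p'] by blast
      with * have "y r z * (y z a * p') - y r a * (y z a * p') - e * p' \<in> lspan (?N (Suc d))"
        by (intro lspan_diff lspan.base)
      also have "y r z * (y z a * p') - y r a * (y z a * p') - e * p' = y r z * b"
        by (simp add: 3 e_def y_antisym[of a r] algebra_simps)
      finally show ?thesis .
    qed
  qed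
  have "y i j * b \<in> lspan (?N (Suc d))" if b: "b \<in> ?N d" for b
  proof -
    consider "i = r" "j = r" | "i = r" "j \<in> W" | "i \<in> W" "j = r" | "i \<in> W" "j \<in> W"
      using ij by blast
    then show ?thesis
    proof cases
      case 1
      then show ?thesis by (simp add: y_refl lspan.zero)
    next
      case 2
      then show ?thesis using root[OF _ b] by simp
    next
      case 3
      then show ?thesis using lspan_uminus[OF root[OF _ b, of i]] by (simp add: y_antisym[of i r])
    next
      case 4
      consider "b \<in> J" | "b \<in> edge_products y W d"
        | a p' d' where "b = y r a * p'" "d = Suc d'" "a \<in> W" "p' \<in> edge_products y W d'"
        using b by blast
      then show ?thesis
      proof cases
        case 1
        then have "y i j * b \<in> J" using 4 assms(1) by (intro J_mult y_S) auto
        then show ?thesis by (auto intro: lspan.base)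
      next
        case 2
        then show ?thesis using 4 by (intro lspan.base) (auto intro: edge_products_SucI)
      next
        case (3 a p' d')
        then have "y i j * p' \<in> edge_products y W d"
          using 4 by (auto intro: edge_products_SucI)
        then have "y r a * (y i j * p') \<in> ?N (Suc d)" using 3 by blast
        then show ?thesis using 3 by (auto simp: mult.left_commute intro: lspan.base)
      qed
    qed
  qed
  then show ?case unfolding p by (rule lspan_mult_left[OF Suc.IH[OF q]])
qed

text \<open>After the single edge at \<open>r\<close> is pulled out, its other end \<open>a\<close>
  becomes the root of a smaller instance on \<open>W - {a}\<close>. The root therefore varies in the
  induction, and a chain from \<open>a\<close> is prolonged to one from \<open>r\<close>. Products
  inside \<open>W\<close> of degree \<open>card W\<close> already lie in \<open>J\<close> and drop
  out.\<close>

lemma edge_products_reduce: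
  assumes "finite W" "r \<notin> W" "insert r W \<subseteq> V"
  shows "(\<forall>d>card W. edge_products y (insert r W) d \<subseteq> J) \<and>
    edge_products y (insert r W) (card W)
      \<subseteq> lspan (J \<union> {chain y (r # ws) |ws. distinct ws \<and> set ws = W})"
  using assms
proof (induction "card W" arbitrary: W r)
  case 0
  then have [simp]: "W = {}" by simp
  have "edge_products y {r} d \<subseteq> J" if "d > 0" for d
  proof -
    from that obtain d' where d: "d = Suc d'" by (cases d) auto
    show ?thesis by (auto simp: d y_refl J_zero elim!: edge_products_SucE)
  qed
  moreover have "chain y [r] \<in> {chain y (r # ws) |ws. distinct ws \<and> set ws = W}"
    by (intro CollectI exI[of _ "[]"]) auto
  ultimately show ?case by (auto intro: lspan.base)
next
  case (Suc k)
  have cardW: "card W = Suc k" using Suc.hyps(2) by simp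
  have card: "card (W - {a}) = k" if "a \<in> W" for a using that cardW by simp
  have ins: "insert a (W - {a}) = W" if "a \<in> W" for a using that by auto
  have IH1: "edge_products y W d \<subseteq> J" if "a \<in> W" "k < d" for a d
    using Suc.hyps(1)[of "W - {a}" a] that card[OF that(1)] Suc.prems ins[OF that(1)] by auto
  have IH2: "edge_products y W k \<subseteq> lspan (J \<union> {chain y (a # ws) |ws. distinct ws \<and> set ws = W - {a}})"
    if "a \<in> W" for a
    using Suc.hyps(1)[of "W - {a}" a] that card[OF that(1)] Suc.prems ins[OF that(1)] by auto
  obtain a0 where a0: "a0 \<in> W" using cardW by fastforce
  let ?C = "J \<union> {chain y (r # ws) |ws. distinct ws \<and> set ws = W}"
  have "edge_products y (insert r W) d \<subseteq> J" if d: "d > card W" for d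
  proof
    fix p assume "p \<in> edge_products y (insert r W) d"
    then have "p \<in> lspan (J \<union> edge_products y W d
         \<union> {y r a * p' |a p' d'. d = Suc d' \<and> a \<in> W \<and> p' \<in> edge_products y W d'})"
      using Suc.prems by (intro edge_products_pull_out) auto
    also have "\<dots> \<subseteq> lspan J"
    proof (rule lspan_mono, safe)
      fix p assume "p \<in> edge_products y W d"
      then show "p \<in> J" using IH1[OF a0, of d] d cardW by auto
    next
      fix a p' d' assume *: "d = Suc d'" "a \<in> W" "p' \<in> edge_products y W d'"
      then have "p' \<in> J" using IH1[OF *(2), of d'] d cardW by auto
      then show "y r a * p' \<in> J" using * Suc.prems by (intro J_mult y_S) auto
    qed
    finally show "p \<in> J" by (rule lspan_J)
  qed
  moreover have "edge_products y (insert r W) (card W) \<subseteq> lspan ?C"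
  proof
    fix p assume "p \<in> edge_products y (insert r W) (card W)"
    then have "p \<in> lspan (J \<union> edge_products y W (card W)
         \<union> {y r a * p' |a p' d'. card W = Suc d' \<and> a \<in> W \<and> p' \<in> edge_products y W d'})"
      using Suc.prems by (intro edge_products_pull_out) auto
    also have "\<dots> \<subseteq> lspan ?C"
    proof (rule lspan_subset_lspan, safe)
      fix p assume "p \<in> J" then show "p \<in> lspan ?C" by (auto intro: lspan.base)
    next
      fix p assume "p \<in> edge_products y W (card W)"
      then have "p \<in> J" using IH1[OF a0, of "card W"] cardW by auto
      then show "p \<in> lspan ?C" by (auto intro: lspan.base)
    next
      fix b p' d' assume *: "card W = Suc d'" "b \<in> W" "p' \<in> edge_products y W d'"
      then have "p' \<in> lspan (J \<union> {chain y (b # ws) |ws. distinct ws \<and> set ws = W - {b}})"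
        using IH2[OF *(2)] cardW by auto
      then show "y r b * p' \<in> lspan ?C"
      proof (rule lspan_mult_left)
        fix c assume "c \<in> J \<union> {chain y (b # ws) |ws. distinct ws \<and> set ws = W - {b}}"
        then show "y r b * c \<in> lspan ?C"
        proof
          assume "c \<in> J"
          then have "y r b * c \<in> J" using * Suc.prems by (intro J_mult y_S) auto
          then show ?thesis by (auto intro: lspan.base)
        next
          assume "c \<in> {chain y (b # ws) |ws. distinct ws \<and> set ws = W - {b}}"
          then obtain ws where ws: "c = chain y (b # ws)" "distinct ws" "set ws = W - {b}" by blast
          then have "y r b * c = chain y (r # b # ws)" "distinct (b # ws)" "set (b # ws) = W"
            using * by auto
          then show ?thesis by (metis (mono_tags, lifting) CollectI UnCI lspan.base)
        qed
      qed
    qed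
    finally show "p \<in> lspan ?C" .
  qed
  ultimately show ?case by blast
qed

section \<open>Shuffle relations between chains\<close>

lemma sum_shuffles_Cons:
  fixes f :: "nat list \<Rightarrow> 'e cpoly"
  assumes "a \<noteq> b"
  shows "sum f (shuffles (a # u) (b # v))
       = (\<Sum>w\<in>shuffles u (b # v). f (a # w)) + (\<Sum>w\<in>shuffles (a # u) v. f (b # w))"
proof -
  have "sum f (shuffles (a # u) (b # v))
      = sum f ((#) a ` shuffles u (b # v)) + sum f ((#) b ` shuffles (a # u) v)"
    unfolding shuffles.simps by (rule sum.union_disjoint) (use assms in auto)
  then show ?thesis by (simp add: sum.reindex)
qed

text \<open>Modulo \<open>J\<close>, \<open>y r a * y r b\<close> equals
  \<open>y r a * y a b + y r b * y b a\<close>, and the two terms are the cases in which a shuffle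
  starts with \<open>a\<close> or with \<open>b\<close>. In each case the chosen letter is the new
  common root.\<close>

lemma chain_mult_shuffles:
  assumes "distinct u" "distinct v" "set u \<inter> set v = {}" "r \<notin> set u \<union> set v"
    and "insert r (set u \<union> set v) \<subseteq> V"
  shows "chain y (r # u) * chain y (r # v) - (\<Sum>w\<in>shuffles u v. chain y (r # w)) \<in> J"
  using assms
proof (induction u v arbitrary: r rule: shuffles.induct)
  case (1 ys)
  then show ?case by (simp add: J_zero)
next
  case (2 x xs)
  then show ?case by (simp add: J_zero)
next
  case (3 a u b v)
  let ?A = "\<Sum>w\<in>shuffles u (b # v). chain y (a # w)" and ?B = "\<Sum>w\<in>shuffles (a # u) v. chain y (b # w)"
  define e where "e = y r a * y a b + y a b * y b r + y b r * y r a"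
  have e: "e \<in> J" unfolding e_def using 3 by (intro arnold) auto
  have 1: "chain y (a # u) * chain y (a # b # v) - ?A \<in> J"
    using "3.prems" by (intro "3.IH"(1)) auto
  have 2: "chain y (b # a # u) * chain y (b # v) - ?B \<in> J"
    using "3.prems" by (intro "3.IH"(2)) auto
  have "y r a * (chain y (a # u) * chain y (a # b # v) - ?A)
      + y r b * (chain y (b # a # u) * chain y (b # v) - ?B)
      - e * (chain y (a # u) * chain y (b # v)) \<in> J"
    using "3.prems" by (intro J_add J_diff J_mult 1 2 y_S J_mult_right e S_mult chain_S) auto
  also have "(\<Sum>w\<in>shuffles (a # u) (b # v). chain y (r # w)) = y r a * ?A + y r b * ?B"
    using "3.prems" by (subst sum_shuffles_Cons) (auto simp: sum_distrib_left)
  then have "y r a * (chain y (a # u) * chain y (a # b # v) - ?A)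
      + y r b * (chain y (b # a # u) * chain y (b # v) - ?B)
      - e * (chain y (a # u) * chain y (b # v))
     = chain y (r # a # u) * chain y (r # b # v)
       - (\<Sum>w\<in>shuffles (a # u) (b # v). chain y (r # w))"
    by (simp add: e_def y_antisym[of b r] y_antisym[of b a] algebra_simps)
  finally show ?case .
qed

text \<open>Sorting the shuffles by first letter leaves two sums, to which the product formula
  applies with root \<open>a\<close> and with root \<open>b\<close>. The resulting products agree in
  all factors except \<open>y a b\<close> and \<open>y b a\<close>, so they cancel.\<close>

lemma sum_chain_shuffles:
  assumes "distinct u" "distinct v" "set u \<inter> set v = {}" "set u \<union> set v \<subseteq> V" "u \<noteq> []" "v \<noteq> []"
  shows "(\<Sum>w\<in>shuffles u v. chain y w) \<in> J"
proof -
  obtain a u' b v' where [simp]: "u = a # u'" "v = b # v'" using assms(5,6) by (meson neq_Nil_conv)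
  let ?A = "\<Sum>w\<in>shuffles u' (b # v'). chain y (a # w)" and ?B = "\<Sum>w\<in>shuffles (a # u') v'. chain y (b # w)"
  have 1: "chain y (a # u') * chain y (a # b # v') - ?A \<in> J"
    using assms by (intro chain_mult_shuffles) auto
  have 2: "chain y (b # a # u') * chain y (b # v') - ?B \<in> J"
    using assms by (intro chain_mult_shuffles) auto
  have "(\<Sum>w\<in>shuffles u v. chain y w) = ?A + ?B"
    using assms by (simp only: \<open>u = _\<close> \<open>v = _\<close>) (subst sum_shuffles_Cons, auto)
  also have "\<dots> = - (chain y (a # u') * chain y (a # b # v') - ?A)
                 - (chain y (b # a # u') * chain y (b # v') - ?B)"
    by (simp add: y_antisym[of b a] algebra_simps)
  finally have eq: "(\<Sum>w\<in>shuffles u v. chain y w) = \<dots>" .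
  show ?thesis unfolding eq by (intro J_diff J_uminus 1 2)
qed

end

section \<open>Klyachko's element\<close>

text \<open>For words on the same distinct letters this is q to the major index of the sequence of
  positions that the letters of \<open>cs\<close> have in \<open>w\<close>: a descent at i means
  that \<open>cs ! i\<close> precedes \<open>cs ! (i - 1)\<close> in \<open>w\<close>. Ascents are
  written as subsequences because these are compatible with filtering.\<close>

definition klyachko_weight :: "complex \<Rightarrow> nat list \<Rightarrow> nat list \<Rightarrow> complex" where
  "klyachko_weight q cs w = (\<Prod>i\<in>{1..<length cs}. if subseq [cs ! (i - 1), cs ! i] w then 1 else q ^ i)"

lemma subseq_pair_iff:
  "subseq [x, z] w \<longleftrightarrow> (\<exists>i j. i < j \<and> j < length w \<and> w ! i = x \<and> w ! j = z)"
proof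
  assume "subseq [x, z] w"
  then obtain us vs where w: "w = us @ x # vs" and "subseq [z] vs"
    by (auto dest!: list_emb_ConsD)
  then have "z \<in> set vs" by (simp add: subseq_singleton_left)
  then obtain j where "j < length vs" "vs ! j = z" by (auto simp: in_set_conv_nth)
  then show "\<exists>i j. i < j \<and> j < length w \<and> w ! i = x \<and> w ! j = z"
    by (intro exI[of _ "length us"] exI[of _ "length us + Suc j"]) (auto simp: w nth_append)
next
  assume "\<exists>i j. i < j \<and> j < length w \<and> w ! i = x \<and> w ! j = z"
  then obtain i j where ij: "i < j" "j < length w" "w ! i = x" "w ! j = z" by blast
  then have w: "w = take i w @ x # drop (Suc i) w" by (metis id_take_nth_drop order_less_trans)
  have "z \<in> set (drop (Suc i) w)"
    using ij by (auto simp: in_set_conv_nth intro!: exI[of _ "j - Suc i"])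
  then have "subseq [x, z] (x # drop (Suc i) w)" by (simp add: subseq_singleton_left)
  then show "subseq [x, z] w" by (subst w) (rule list_emb_append2)
qed

lemma subseq_pair_filter:
  "P x \<Longrightarrow> P z \<Longrightarrow> subseq [x, z] (filter P w) \<longleftrightarrow> subseq [x, z] w"
  using subseq_filter[of "[x, z]" w P] subseq_order.order_trans[OF _ subseq_filter_left] by auto

text \<open>The positions in \<open>w\<close> of the letters of \<open>cs\<close> increase from each
  letter to the next and exhaust \<open>{0..<length cs}\<close>, so the letter with index i sits at
  position i.\<close>

lemma consecutive_subseqs_imp_eq:
  assumes "distinct cs" "distinct w" "set w = set cs"
    and *: "\<And>i. i \<in> {1..<length cs} \<Longrightarrow> subseq [cs ! (i - 1), cs ! i] w"
  shows "w = cs"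
proof -
  have len: "length w = length cs" using assms by (metis distinct_card)
  have "\<forall>x\<in>set cs. \<exists>i. i < length w \<and> w ! i = x"
    by (simp add: assms(3)[symmetric] in_set_conv_nth)
  from bchoice[OF this] obtain f where f: "\<And>x. x \<in> set cs \<Longrightarrow> f x < length w \<and> w ! f x = x"
    by blast
  have inj: "inj_on f (set cs)" by (metis f inj_onI)
  have "f (cs ! i) < f (cs ! Suc i)" if "Suc i < length cs" for i
  proof -
    have "subseq [cs ! i, cs ! Suc i] w" using *[of "Suc i"] that by auto
    then obtain a b where ab: "a < b" "b < length w" "w ! a = cs ! i" "w ! b = cs ! Suc i"
      by (auto simp: subseq_pair_iff)
    then have "f (cs ! i) = a" "f (cs ! Suc i) = b"
      using f[of "cs ! i"] f[of "cs ! Suc i"] that nth_eq_iff_index_eq[OF assms(2), of "f (cs ! i)" a]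
        nth_eq_iff_index_eq[OF assms(2), of "f (cs ! Suc i)" b] by auto
    with ab show ?thesis by simp
  qed
  then have "sorted (map f cs)"
    by (auto simp: sorted_iff_nth_Suc intro: less_imp_le)
  moreover have "distinct (map f cs)" using assms(1) inj by (simp add: distinct_map)
  moreover have "set (map f cs) = {0..<length cs}"
  proof (rule card_subset_eq)
    show "set (map f cs) \<subseteq> {0..<length cs}" using f len by auto
    show "card (set (map f cs)) = card {0..<length cs}"
      using \<open>distinct (map f cs)\<close> by (metis distinct_card length_map card_atLeastLessThan diff_zero)
  qed simp
  ultimately have "map f cs = [0..<length cs]"
    by (intro sorted_distinct_set_unique) auto
  then have "f (cs ! i) = i" if "i < length cs" for i
    using that by (metis nth_map nth_upt add_0)
  then show ?thesis using len f by (intro nth_equalityI) (auto, metis nth_mem)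
qed

text \<open>Only comparisons involving \<open>z\<close> change. If \<open>z = cs ! P\<close>, moving
  \<open>z\<close> from the front to the back turns the descent at P into an ascent and the ascent
  at P + 1 into a descent, for a total factor q.\<close>

lemma klyachko_weight_rotate:
  assumes "distinct cs" "distinct (z # v)" "set (z # v) = set cs" "q ^ length cs = 1"
  shows "klyachko_weight q cs (v @ [z]) = q * klyachko_weight q cs (z # v)"
proof -
  let ?A = "\<lambda>i. if subseq [cs ! (i - 1), cs ! i] (z # v) then 1 else q ^ i"
  let ?B = "\<lambda>i. if subseq [cs ! (i - 1), cs ! i] (v @ [z]) then 1 else q ^ i"
  let ?I = "{1..<length cs}"
  obtain P where P: "P < length cs" "cs ! P = z"
    using assms(3) by (metis in_set_conv_nth list.set_intros(1))
  have q0: "q \<noteq> 0" using assms(4) P by (metis power_eq_0_iff less_nat_zero_code neq0_conv zero_neq_one power_0_left)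
  \<comment> \<open>Cross-multiplied, so that powers of q are cancelled only once, after the
    products have been formed.\<close>
  have *: "?B i * (if i = P then q ^ P else 1) = ?A i * (if i = Suc P then q ^ Suc P else 1)"
    if i: "i \<in> ?I" for i
  proof -
    have iff: "cs ! i = z \<longleftrightarrow> i = P" "cs ! (i - 1) = z \<longleftrightarrow> i = Suc P"
      using i P assms(1) by (auto simp: nth_eq_iff_index_eq)
    have mem: "x \<in> set v" if "x \<in> set cs" "x \<noteq> z" for x
      using that assms(3) by auto
    have in_cs: "cs ! i \<in> set cs" "cs ! (i - 1) \<in> set cs" using i by auto
    consider "i = P" | "i = Suc P" | "i \<noteq> P" "i \<noteq> Suc P" by blast
    then show ?thesis
    proof cases
      case 1
      then have *: "cs ! i = z" "cs ! (i - 1) \<noteq> z" "cs ! (i - 1) \<in> set v"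
        using iff mem in_cs i by auto
      have "subseq ([cs ! (i - 1)] @ [cs ! i]) (v @ [z])"
        using * by (intro list_emb_append_mono) (auto simp: subseq_singleton_left)
      moreover have "\<not> subseq [cs ! (i - 1), cs ! i] (z # v)"
        using * assms(2) by (auto dest!: list_emb_ConsD simp: subseq_singleton_left)
      ultimately show ?thesis using 1 by simp
    next
      case 2
      then have *: "cs ! (i - 1) = z" "cs ! i \<noteq> z" "cs ! i \<in> set v"
        using iff mem in_cs i by auto
      have "subseq [cs ! (i - 1), cs ! i] (z # v)"
        using * by (auto simp: subseq_singleton_left)
      moreover have "\<not> subseq [cs ! (i - 1), cs ! i] (v @ [z])"
      proof
        assume "subseq [cs ! (i - 1), cs ! i] (v @ [z])"
        then obtain a b where ab: "a < b" "b < length (v @ [z])" "(v @ [z]) ! a = z"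
          unfolding subseq_pair_iff by (metis *(1))
        then have "a < length v" by auto
        with ab have "z \<in> set v" by (auto simp: nth_append) 
        then show False using assms(2) by simp
      qed
      ultimately show ?thesis using 2 by simp
    next
      case 3
      then have "cs ! (i - 1) \<noteq> z" "cs ! i \<noteq> z" using iff by auto
      then have "subseq [cs ! (i - 1), cs ! i] (v @ [z]) \<longleftrightarrow> subseq [cs ! (i - 1), cs ! i] (z # v)"
        using subseq_pair_filter[of "\<lambda>x. x \<noteq> z" "cs ! (i - 1)" "cs ! i" "v @ [z]"]
          subseq_pair_filter[of "\<lambda>x. x \<noteq> z" "cs ! (i - 1)" "cs ! i" "z # v"] by simp
      then show ?thesis using 3 by simp
    qed
  qed
  have eq: "(\<Prod>i\<in>?I. ?B i) * (\<Prod>i\<in>?I. if i = P then q ^ P else 1)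
      = (\<Prod>i\<in>?I. ?A i) * (\<Prod>i\<in>?I. if i = Suc P then q ^ Suc P else 1)"
    unfolding prod.distrib[symmetric] by (rule prod.cong[OF refl *])
  have P_eq: "(\<Prod>i\<in>?I. if i = P then q ^ P else 1) = q ^ P"
    using P by (cases "P = 0") (simp_all add: prod.delta)
  \<comment> \<open>If \<open>z\<close> is the last letter of \<open>cs\<close> there is no
    comparison at P + 1; the factor then missing is \<open>q ^ length cs\<close>, which is
    1.\<close>
  have Suc_P_eq: "(\<Prod>i\<in>?I. if i = Suc P then q ^ Suc P else 1) = q ^ Suc P"
  proof (cases "Suc P < length cs")
    case False
    then have "Suc P = length cs" using P by simp
    then have "q ^ Suc P = 1" using assms(4) by simp
    then show ?thesis by (simp add: if_distrib cong: if_cong)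
  qed (simp add: prod.delta)
  have cancel: "b = q * a" if "b * q ^ P = a * q ^ Suc P" for a b :: complex
    using that q0 by simp
  show ?thesis unfolding klyachko_weight_def
    by (rule cancel) (rule eq[unfolded P_eq Suc_P_eq])
qed

section \<open>Klyachko's element applied to chains\<close>

context arnold_ideal
begin

text \<open>Cut \<open>cs\<close> before position \<open>k\<close>. Every condition in
  \<open>U\<close> compares two letters on the same side of the cut, so it depends only on the two
  subwords, and the words with given subwords form a full set of shuffles.\<close>

lemma sum_chain_constrained:
  assumes "distinct cs" "set cs \<subseteq> V" "U \<subseteq> {1..<length cs}" "k \<in> {1..<length cs}" "k \<notin> U"
  shows "(\<Sum>w | distinct w \<and> set w = set cs \<and> (\<forall>i\<in>U. subseq [cs ! (i - 1), cs ! i] w). chain y w) \<in> J"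
    (is "sum _ ?W \<in> J")
proof -
  define P where "P x \<longleftrightarrow> x \<in> set (take k cs)" for x
  \<comment> \<open>The fibres of \<open>g\<close> on \<open>?W\<close> are the sets of shuffles, so
    the sum is taken fibre by fibre.\<close>
  define g where "g w = (filter P w, filter (\<lambda>x. \<not> P x) w)" for w
  have P_nth: "P (cs ! i) \<longleftrightarrow> i < k" if "i < length cs" for i
    unfolding P_def using that assms(1,4) by (auto simp: in_set_conv_nth nth_eq_iff_index_eq)
  have "?W \<subseteq> {w. set w \<subseteq> set cs \<and> length w = length cs}"
    using distinct_card assms(1) by (metis (mono_tags, lifting) mem_Collect_eq subsetI subset_refl)
  then have fin: "finite ?W" by (rule finite_subset) (simp add: finite_lists_length_eq)
  have fiber: "(\<Sum>w\<in>{w \<in> ?W. g w = g w0}. chain y w) \<in> J" if w0: "w0 \<in> ?W" for w0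
  proof -
    let ?u = "filter P w0" and ?v = "filter (\<lambda>x. \<not> P x) w0"
    have dist: "distinct ?u" "distinct ?v" "set ?u \<inter> set ?v = {}" using w0 by auto
    have "w \<in> shuffles ?u ?v" if "w \<in> ?W" "g w = g w0" for w
      using that partition_in_shuffles[of w P] by (simp add: g_def)
    moreover have "w \<in> ?W \<and> g w = g w0" if w: "w \<in> shuffles ?u ?v" for w
    proof -
      have "filter P w \<in> filter P ` shuffles ?u ?v" "filter (\<lambda>x. \<not> P x) w \<in> filter (\<lambda>x. \<not> P x) ` shuffles ?u ?v"
        using w by blast+
      then have gw: "filter P w = ?u" "filter (\<lambda>x. \<not> P x) w = ?v"
        by (simp_all add: filter_shuffles)
      have "subseq [cs ! (i - 1), cs ! i] w" if i: "i \<in> U" for i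
      proof -
        have il: "1 \<le> i" "i < length cs" "i \<noteq> k" using i assms(3,5) by auto
        have "subseq [cs ! (i - 1), cs ! i] w0" using w0 i by auto
        then show ?thesis
        proof (cases "i < k")
          case True
          then have "P (cs ! (i - 1))" "P (cs ! i)" using il P_nth by auto
          then show ?thesis using \<open>subseq _ w0\<close> gw by (metis subseq_pair_filter)
        next
          case False
          then have "\<not> P (cs ! (i - 1))" "\<not> P (cs ! i)" using il P_nth by auto
          then show ?thesis using \<open>subseq _ w0\<close> gw
            by (metis (mono_tags, lifting) subseq_pair_filter)
        qed
      qed
      moreover have "distinct w" using distinct_disjoint_shuffles[OF dist w] .
      moreover have "set w = set cs" using set_shuffles[OF w] w0 by auto
      ultimately show ?thesis using gw by (simp add: g_def)
    qed
    ultimately have eq: "{w \<in> ?W. g w = g w0} = shuffles ?u ?v" by blast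
    \<comment> \<open>The letters at positions 0 and \<open>k\<close> show that neither side of the
      cut is empty.\<close>
    have "0 < length cs" "k < length cs" using assms(4) by auto
    then have "cs ! 0 \<in> set ?u" "cs ! k \<in> set ?v" using w0 assms(4) P_nth[of 0] P_nth[of k]
      nth_mem[of 0 cs] nth_mem[of k cs] by auto
    moreover have "l \<noteq> []" if "x \<in> set l" for x :: nat and l using that by auto
    ultimately have ne: "?u \<noteq> []" "?v \<noteq> []" by blast+
    show ?thesis unfolding eq
      by (rule sum_chain_shuffles[OF dist _ ne]) (use w0 assms(2) in auto)
  qed
  show ?thesis unfolding sum.image_gen[OF fin, of "chain y" g]
  proof (rule J_sum)
    fix b assume "b \<in> g ` ?W"
    then obtain w0 where "w0 \<in> ?W" "b = g w0" by blast
    then show "(\<Sum>w\<in>{w \<in> ?W. g w = b}. chain y w) \<in> J" using fiber by simp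
  qed
qed

text \<open>A factor that is 1 at an ascent and \<open>q ^ i\<close> otherwise equals
  \<open>1 - q ^ i\<close> times the indicator of an ascent, plus \<open>q ^ i\<close>. Expanding
  gives one constrained sum for each set \<open>U\<close> of prescribed ascents; modulo
  \<open>J\<close> all of them vanish except the full one, which singles out
  \<open>cs\<close>.\<close>

lemma sum_klyachko_weight_chain:
  assumes "distinct cs" "set cs \<subseteq> V"
  shows "(\<Sum>w | distinct w \<and> set w = set cs. const_poly (klyachko_weight q cs w) * chain y w)
         - const_poly (\<Prod>i\<in>{1..<length cs}. 1 - q ^ i) * chain y cs \<in> J"
proof -
  let ?I = "{1..<length cs}" and ?W = "{w. distinct w \<and> set w = set cs}"
  let ?P = "\<lambda>i w. subseq [cs ! (i - 1), cs ! i] w"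
  \<comment> \<open>The coefficient with which the sum constrained by \<open>U\<close> occurs;
    \<open>K ?I\<close> is the claimed scalar.\<close>
  define K where "K U = (\<Prod>i\<in>U. 1 - q ^ i) * (\<Prod>i\<in>?I - U. q ^ i)" for U
  have finW: "finite ?W"
  proof (rule finite_subset)
    show "?W \<subseteq> {w. set w \<subseteq> set cs \<and> length w = length cs}"
      using distinct_card assms(1) by (metis (mono_tags, lifting) mem_Collect_eq subsetI subset_refl)
  qed (simp add: finite_lists_length_eq)
  have weight: "klyachko_weight q cs w = (\<Sum>U\<in>Pow ?I. if \<forall>i\<in>U. ?P i w then K U else 0)" for w
  proof -
    have "klyachko_weight q cs w = (\<Prod>i\<in>?I. (if ?P i w then 1 - q ^ i else 0) + q ^ i)"
      unfolding klyachko_weight_def by (rule prod.cong) auto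
    also have "\<dots> = (\<Sum>U\<in>Pow ?I. (\<Prod>i\<in>U. if ?P i w then 1 - q ^ i else 0) * (\<Prod>i\<in>?I - U. q ^ i))"
      by (rule prod_add) simp
    also have "\<dots> = (\<Sum>U\<in>Pow ?I. if \<forall>i\<in>U. ?P i w then K U else 0)"
    proof (rule sum.cong[OF refl])
      fix U assume "U \<in> Pow ?I"
      then have "finite U" by (auto intro: finite_subset)
      then show "(\<Prod>i\<in>U. if ?P i w then 1 - q ^ i else 0) * (\<Prod>i\<in>?I - U. q ^ i)
          = (if \<forall>i\<in>U. ?P i w then K U else 0)"
        by (auto simp: K_def prod_zero_iff intro!: prod.cong)
    qed
    finally show ?thesis .
  qed
  have "(\<Sum>w\<in>?W. const_poly (klyachko_weight q cs w) * chain y w)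
      = (\<Sum>U\<in>Pow ?I. \<Sum>w\<in>?W. if \<forall>i\<in>U. ?P i w then const_poly (K U) * chain y w else 0)"
    unfolding weight const_poly_sum sum_distrib_right
    by (subst sum.swap) (intro sum.cong refl, auto)
  also have "\<dots> = (\<Sum>U\<in>Pow ?I. const_poly (K U) *
      (\<Sum>w | distinct w \<and> set w = set cs \<and> (\<forall>i\<in>U. ?P i w). chain y w))"
    (is "_ = (\<Sum>U\<in>_. const_poly (K U) * ?S U)")
    using finW by (simp add: sum.inter_filter[symmetric] sum_distrib_left conj_assoc)
  also have "\<dots> = const_poly (K ?I) * ?S ?I + (\<Sum>U\<in>Pow ?I - {?I}. const_poly (K U) * ?S U)"
    by (rule sum.remove) auto
  also have "{w. distinct w \<and> set w = set cs \<and> (\<forall>i\<in>?I. ?P i w)} = {cs}"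
  proof -
    have "?P i cs" if "i \<in> ?I" for i
      unfolding subseq_pair_iff by (rule exI[of _ "i - 1"], rule exI[of _ i]) (use that in auto)
    then show ?thesis using consecutive_subseqs_imp_eq[OF assms(1)] assms(1) by blast
  qed
  finally have "(\<Sum>w\<in>?W. const_poly (klyachko_weight q cs w) * chain y w) - const_poly (K ?I) * chain y cs
      = (\<Sum>U\<in>Pow ?I - {?I}. const_poly (K U) * ?S U)" by simp
  also have "\<dots> \<in> J"
  proof (rule J_sum, rule J_mult[OF S_const])
    fix U assume U: "U \<in> Pow ?I - {?I}"
    then obtain k where "k \<in> ?I" "k \<notin> U" by blast
    with U show "?S U \<in> J" by (intro sum_chain_constrained[OF assms]) auto
  qed
  finally show ?thesis by (simp add: K_def)
qed

end

section \<open>A dimension count\<close>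

text \<open>Gaussian elimination: an equation with a nonzero entry at \<open>b0\<close> is solved
  for that unknown and substituted into the others. This replaces a theory of dimension in the count
  that yields injectivity.\<close>

lemma homogeneous_linear_system:
  fixes M :: "'a \<Rightarrow> 'b \<Rightarrow> complex"
  assumes "finite A" "finite B" "card A < card B"
  shows "\<exists>c. (\<exists>b\<in>B. c b \<noteq> 0) \<and> (\<forall>a\<in>A. (\<Sum>b\<in>B. c b * M a b) = 0)"
  using assms
proof (induction A arbitrary: B M rule: finite_induct)
  case empty
  then have "B \<noteq> {}" by auto
  then show ?case by (intro exI[of _ "\<lambda>_. 1"]) auto
next
  case (insert a A)
  show ?case
  proof (cases "\<forall>b\<in>B. M a b = 0")
    case True
    have "\<exists>c. (\<exists>b\<in>B. c b \<noteq> 0) \<and> (\<forall>a\<in>A. (\<Sum>b\<in>B. c b * M a b) = 0)"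
      using insert by auto
    then show ?thesis using True by auto
  next
    case False
    then obtain b0 where b0: "b0 \<in> B" "M a b0 \<noteq> 0" by blast
    let ?B = "B - {b0}"
    have "card A < card ?B" using insert b0 by simp
    then obtain c where c: "\<exists>b\<in>?B. c b \<noteq> 0"
      "\<And>a'. a' \<in> A \<Longrightarrow> (\<Sum>b\<in>?B. c b * (M a' b - M a b / M a b0 * M a' b0)) = 0"
      using insert.IH[of ?B "\<lambda>a' b. M a' b - M a b / M a b0 * M a' b0"] insert.prems by auto
    define c' where "c' b = (if b = b0 then - (\<Sum>b\<in>?B. c b * M a b) / M a b0 else c b)" for b
    have sum_c': "(\<Sum>b\<in>B. c' b * M a' b) = c' b0 * M a' b0 + (\<Sum>b\<in>?B. c b * M a' b)" for a'
      by (subst sum.remove[OF insert.prems(1) b0(1)]) (simp add: c'_def)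
    have "(\<Sum>b\<in>B. c' b * M a' b) = 0" if "a' \<in> A" for a'
    proof -
      have "(\<Sum>b\<in>?B. c b * M a' b) - (\<Sum>b\<in>?B. c b * M a b) / M a b0 * M a' b0 = 0"
        using c(2)[OF that] by (simp add: algebra_simps sum_subtractf sum_distrib_left sum_distrib_right
          sum_divide_distrib)
      then show ?thesis unfolding sum_c' by (simp add: c'_def)
    qed
    moreover have "(\<Sum>b\<in>B. c' b * M a b) = 0" unfolding sum_c' using b0 by (simp add: c'_def)
    moreover have "\<exists>b\<in>B. c' b \<noteq> 0" using c(1) by (auto simp: c'_def)
    ultimately show ?thesis by (intro exI[of _ c']) auto
  qed
qed

section \<open>The internal algebra of the dual braid arrangement\<close>

text \<open>Signed in both orders of the endpoints, so that a permutation acts on the two indices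
  without a case distinction.\<close>

definition hform :: "nat \<Rightarrow> nat \<Rightarrow> (nat \<times> nat) cpoly" where
  "hform i j = linear_form (hvec i j)"

lemma hform_refl [simp]: "hform i i = 0"
  by (simp add: hform_def hvec_def)

lemma hform_antisym: "hform i j = - hform j i"
  by (auto simp: hform_def hvec_def linear_form_uminus)

lemma hform_less: "i < j \<Longrightarrow> hform i j = var_poly (i, j)"
  by (simp add: hform_def hvec_def linear_form_single)

lemma hform_greater: "j < i \<Longrightarrow> hform i j = - var_poly (j, i)"
  using hform_antisym[of i j] by (simp add: hform_less)

text \<open>The linear form of the cycle \<open>h\<^sub>i\<^sub>j + h\<^sub>j\<^sub>n + h\<^sub>n\<^sub>i\<close>.\<close>

definition yform :: "nat \<Rightarrow> nat \<Rightarrow> nat \<Rightarrow> (nat \<times> nat) cpoly" where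
  "yform n i j = hform i j + hform j n - hform i n"

lemma finite_braid_pairs [simp]: "finite (braid_pairs n)"
  by (rule finite_subset[of _ "{1..n} \<times> {1..n}"]) (auto simp: braid_pairs_def)

section \<open>Cycles as elements of the kernel\<close>

lemma braid_map_superset:
  assumes "finite E" "Poly_Mapping.keys u \<subseteq> E"
  shows "braid_map u = (\<Sum>(i, j)\<in>E. Poly_Mapping.single i (Poly_Mapping.lookup u (i, j))
           - Poly_Mapping.single j (Poly_Mapping.lookup u (i, j)))"
  unfolding braid_map_def
  by (rule sum.mono_neutral_left) (use assms in \<open>auto simp: in_keys_iff\<close>)

lemma braid_map_add: "braid_map (u + v) = braid_map u + braid_map v"
proof -
  let ?E = "Poly_Mapping.keys u \<union> Poly_Mapping.keys v"
  have "Poly_Mapping.keys (u + v) \<subseteq> ?E" by (rule keys_add)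
  then show ?thesis
    by (simp add: braid_map_superset[of ?E] lookup_add single_add sum.distrib[symmetric]
        case_prod_beta algebra_simps)
qed

lemma braid_map_zero [simp]: "braid_map 0 = 0"
  by (simp add: braid_map_def)

lemma braid_map_sum: "braid_map (sum f A) = (\<Sum>x\<in>A. braid_map (f x))"
  by (induction A rule: infinite_finite_induct) (auto simp: braid_map_add)

lemma braid_map_single:
  "braid_map (Poly_Mapping.single (i, j) a) = Poly_Mapping.single i a - Poly_Mapping.single j a"
  by (simp add: braid_map_superset[of "{(i, j)}"])

lemma braid_map_uminus: "braid_map (- u) = - braid_map u"
  using braid_map_add[of u "- u"] by (simp add: eq_neg_iff_add_eq_0 add.commute)

lemma braid_map_hvec: "braid_map (hvec i j) = Poly_Mapping.single i 1 - Poly_Mapping.single j 1"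
  by (auto simp: hvec_def braid_map_single braid_map_uminus)

text \<open>Cycles are orthogonal to potential differences. The potentials used later are indicators
  of a vertex, possibly composed with a permutation, and the coefficients of
  \<open>hform i n\<close> at a fixed monomial.\<close>

lemma braid_kernel_sum_eq_0:
  fixes g :: "nat \<Rightarrow> complex"
  assumes u: "u \<in> braid_kernel n" and E: "finite E" "Poly_Mapping.keys u \<subseteq> E"
  shows "(\<Sum>(i, j)\<in>E. Poly_Mapping.lookup u (i, j) * (g i - g j)) = 0"
proof -
  have lookup_0: "(\<Sum>(i, j)\<in>Poly_Mapping.keys u. Poly_Mapping.lookup u (i, j) * (of_bool (i = v) - of_bool (j = v))) = 0" for v
  proof -
    have "0 = Poly_Mapping.lookup (braid_map u) v" using u by (simp add: braid_kernel_def)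
    also have "\<dots> = (\<Sum>(i, j)\<in>Poly_Mapping.keys u. Poly_Mapping.lookup u (i, j) * (of_bool (i = v) - of_bool (j = v)))"
      by (auto simp: braid_map_def lookup_sum lookup_minus lookup_single when_def case_prod_beta
          intro!: sum.cong)
    finally show ?thesis by simp
  qed
  have "0 = (\<Sum>v\<in>{1..n}. g v * (\<Sum>(i, j)\<in>Poly_Mapping.keys u. Poly_Mapping.lookup u (i, j) * (of_bool (i = v) - of_bool (j = v))))"
    by (simp add: lookup_0)
  also have "\<dots> = (\<Sum>(i, j)\<in>Poly_Mapping.keys u. Poly_Mapping.lookup u (i, j) * (\<Sum>v\<in>{1..n}. g v * (of_bool (i = v) - of_bool (j = v))))"
    by (simp add: sum_distrib_left case_prod_beta algebra_simps) (rule sum.swap)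
  also have "\<dots> = (\<Sum>(i, j)\<in>Poly_Mapping.keys u. Poly_Mapping.lookup u (i, j) * (g i - g j))"
  proof (rule sum.cong[OF refl], safe)
    fix i j assume "(i, j) \<in> Poly_Mapping.keys u"
    then have "i \<in> {1..n}" "j \<in> {1..n}" using u by (auto simp: braid_kernel_def braid_pairs_def)
    then have "(\<Sum>v\<in>{1..n}. g v * (of_bool (i = v) - of_bool (j = v))) = g i - g j"
      by (simp add: right_diff_distrib sum_subtractf of_bool_def if_distrib[of "(*) _"] cong: if_cong)
    then show "Poly_Mapping.lookup u (i, j) * (\<Sum>v\<in>{1..n}. g v * (of_bool (i = v) - of_bool (j = v)))
        = Poly_Mapping.lookup u (i, j) * (g i - g j)" by simp
  qed
  also have "\<dots> = (\<Sum>(i, j)\<in>E. Poly_Mapping.lookup u (i, j) * (g i - g j))"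
    by (rule sum.mono_neutral_left) (use E in \<open>auto simp: in_keys_iff\<close>)
  finally show ?thesis by simp
qed

lemma keys_subset_braid_pairs: "u \<in> braid_kernel n \<Longrightarrow> Poly_Mapping.keys u \<subseteq> braid_pairs n"
  by (simp add: braid_kernel_def)

lemma linear_form_hform:
  assumes "Poly_Mapping.keys u \<subseteq> braid_pairs n"
  shows "linear_form u = (\<Sum>(i, j)\<in>Poly_Mapping.keys u. const_poly (Poly_Mapping.lookup u (i, j)) * hform i j)"
proof -
  have "linear_form u = (\<Sum>e\<in>Poly_Mapping.keys u. const_poly (Poly_Mapping.lookup u e) * var_poly e)"
    by (rule linear_form_superset) auto
  also have "\<dots> = (\<Sum>(i, j)\<in>Poly_Mapping.keys u. const_poly (Poly_Mapping.lookup u (i, j)) * hform i j)"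
    by (rule sum.cong[OF refl]) (use assms in \<open>auto simp: braid_pairs_def hform_less\<close>)
  finally show ?thesis .
qed

text \<open>Passing from \<open>hform i j\<close> to \<open>yform n i j\<close> adds the potential
  difference \<open>hform j n - hform i n\<close>, which a cycle annihilates coefficient by
  coefficient.\<close>

lemma linear_form_yform:
  assumes u: "u \<in> braid_kernel n"
  shows "linear_form u = (\<Sum>(i, j)\<in>Poly_Mapping.keys u. const_poly (Poly_Mapping.lookup u (i, j)) * yform n i j)"
proof -
  have "(\<Sum>(i, j)\<in>Poly_Mapping.keys u. const_poly (Poly_Mapping.lookup u (i, j)) * (hform i n - hform j n)) = 0"
  proof (rule poly_mapping_eqI)
    fix m
    show "Poly_Mapping.lookup (\<Sum>(i, j)\<in>Poly_Mapping.keys u. const_poly (Poly_Mapping.lookup u (i, j)) * (hform i n - hform j n)) m = Poly_Mapping.lookup 0 m"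
      using braid_kernel_sum_eq_0[OF u, of "Poly_Mapping.keys u" "\<lambda>i. Poly_Mapping.lookup (hform i n) m"]
      by (simp add: lookup_sum case_prod_beta lookup_const_poly_times lookup_minus)
  qed
  moreover have "(\<Sum>(i, j)\<in>Poly_Mapping.keys u. const_poly (Poly_Mapping.lookup u (i, j)) * yform n i j)
     = linear_form u - (\<Sum>(i, j)\<in>Poly_Mapping.keys u. const_poly (Poly_Mapping.lookup u (i, j)) * (hform i n - hform j n))"
    unfolding linear_form_hform[OF keys_subset_braid_pairs[OF u]] sum_subtractf[symmetric]
    by (rule sum.cong) (auto simp: yform_def algebra_simps)
  ultimately show ?thesis by simp
qed

definition triangle :: "nat \<Rightarrow> nat \<Rightarrow> nat \<Rightarrow> (nat \<times> nat) \<Rightarrow>\<^sub>0 complex" where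
  "triangle i j k = hvec i j + hvec j k + hvec k i"

lemma linear_form_triangle: "linear_form (triangle i j k) = hform i j + hform j k + hform k i"
  by (simp add: triangle_def linear_form_add hform_def)

lemma yform_eq_triangle: "yform n i j = linear_form (triangle i j n)"
  by (simp add: yform_def linear_form_triangle hform_antisym[of n i])

lemma keys_hvec: "Poly_Mapping.keys (hvec i j) = (if i = j then {} else {(min i j, max i j)})"
  by (auto simp: hvec_def min_def max_def in_keys_iff lookup_single when_def)

lemma keys_triangle:
  "Poly_Mapping.keys (triangle i j k) \<subseteq> Poly_Mapping.keys (hvec i j) \<union> Poly_Mapping.keys (hvec j k) \<union> Poly_Mapping.keys (hvec k i)"
  unfolding triangle_def using keys_add by (meson Un_mono order.refl order_trans)

lemma triangle_in_braid_kernel: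
  assumes "i \<in> {1..n}" "j \<in> {1..n}" "k \<in> {1..n}"
  shows "triangle i j k \<in> braid_kernel n"
proof -
  have "Poly_Mapping.keys (hvec a b) \<subseteq> braid_pairs n" if "a \<in> {1..n}" "b \<in> {1..n}" for a b
    using that by (auto simp: keys_hvec braid_pairs_def)
  then have "Poly_Mapping.keys (triangle i j k) \<subseteq> braid_pairs n" using keys_triangle[of i j k] assms by blast
  moreover have "braid_map (triangle i j k) = 0"
    by (simp add: triangle_def braid_map_add braid_map_hvec)
  ultimately show ?thesis by (simp add: braid_kernel_def)
qed

text \<open>Only an upper bound, as vertices may coincide.\<close>

lemma card_keys_triangle: "card (Poly_Mapping.keys (triangle i j k)) \<le> 3"
proof -
  have h: "card (Poly_Mapping.keys (hvec a b)) \<le> 1" for a b by (simp add: keys_hvec)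
  have "card (Poly_Mapping.keys (triangle i j k))
      \<le> card (Poly_Mapping.keys (hvec i j) \<union> Poly_Mapping.keys (hvec j k) \<union> Poly_Mapping.keys (hvec k i))"
    by (intro card_mono keys_triangle) auto
  also have "\<dots> \<le> card (Poly_Mapping.keys (hvec i j)) + card (Poly_Mapping.keys (hvec j k)) + card (Poly_Mapping.keys (hvec k i))"
    by (meson add_right_mono card_Un_le order_trans)
  finally show ?thesis using h[of i j] h[of j k] h[of k i] by linarith
qed

lemma rho_dual_hyperplane:
  assumes "u \<in> braid_kernel n"
  shows "rho (braid_pairs n) (dual_hyperplane n) u = card (Poly_Mapping.keys u)"
proof -
  have "{e \<in> braid_pairs n. u \<notin> dual_hyperplane n e} = Poly_Mapping.keys u"
    using assms keys_subset_braid_pairs[OF assms] by (auto simp: dual_hyperplane_def in_keys_iff)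
  then show ?thesis by (simp add: rho_def)
qed

section \<open>The symmetric algebra of a subspace and the internal ideal\<close>

lemma Sym_simps [simp]:
  "monoid.mult (Sym U) = (*)" "\<one>\<^bsub>Sym U\<^esub> = 1" "\<zero>\<^bsub>Sym U\<^esub> = 0" "add (Sym U) = (+)"
  by (simp_all add: Sym_def ring_of_type_algebra_def)

lemma Sym_cring: "cring (Sym U)"
proof -
  let ?R = "ring_of_type_algebra :: 'a cpoly ring"
  interpret cring ?R by (rule cring_from_type_algebra)
  let ?H = "range const_poly \<union> linear_form ` U"
  have H: "?H \<subseteq> carrier ?R" by (simp add: ring_of_type_algebra_def)
  have "subcring (generate_ring ?R ?H) ?R"
    by (rule subcringI'[OF generate_ring_is_subring[OF H]])
  then show ?thesis unfolding Sym_def using subcring_iff[OF generate_ring_incl[OF H]] by blast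
qed

lemma Sym_const: "const_poly a \<in> carrier (Sym U)"
  by (auto simp: Sym_def intro: generate_ring.incl)

lemma Sym_linear_form: "u \<in> U \<Longrightarrow> linear_form u \<in> carrier (Sym U)"
  by (auto simp: Sym_def intro: generate_ring.incl)

lemma Sym_add: "p \<in> carrier (Sym U) \<Longrightarrow> q \<in> carrier (Sym U) \<Longrightarrow> p + q \<in> carrier (Sym U)"
  using generate_ring.eng_add[of p "ring_of_type_algebra" _ q]
  by (simp add: Sym_def ring_of_type_algebra_def)

lemma Sym_mult: "p \<in> carrier (Sym U) \<Longrightarrow> q \<in> carrier (Sym U) \<Longrightarrow> p * q \<in> carrier (Sym U)"
  using generate_ring.eng_mult[of p "ring_of_type_algebra" _ q]
  by (simp add: Sym_def ring_of_type_algebra_def)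

lemma Sym_power: "p \<in> carrier (Sym U) \<Longrightarrow> p ^ k \<in> carrier (Sym U)"
  using Sym_const[of 1 U] by (induction k) (auto intro: Sym_mult)

text \<open>Rule induction on \<open>generate_ring\<close> with two cases absorbed: one is a
  constant, and a negative is a multiple by \<open>const_poly (-1)\<close>.\<close>

lemma Sym_induct [consumes 1, case_names const linear_form add mult]:
  assumes "p \<in> carrier (Sym U)"
    and const: "\<And>a. P (const_poly a)"
    and linear_form: "\<And>u. u \<in> U \<Longrightarrow> P (linear_form u)"
    and add: "\<And>p q. p \<in> carrier (Sym U) \<Longrightarrow> q \<in> carrier (Sym U) \<Longrightarrow> P p \<Longrightarrow> P q \<Longrightarrow> P (p + q)"
    and mult: "\<And>p q. p \<in> carrier (Sym U) \<Longrightarrow> q \<in> carrier (Sym U) \<Longrightarrow> P p \<Longrightarrow> P q \<Longrightarrow> P (p * q)"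
  shows "P p"
proof -
  let ?R = "ring_of_type_algebra :: 'a cpoly ring"
  let ?H = "range const_poly \<union> linear_form ` U"
  have car: "carrier (Sym U) = generate_ring ?R ?H" by (simp add: Sym_def)
  have ops: "\<one>\<^bsub>?R\<^esub> = 1" "p \<oplus>\<^bsub>?R\<^esub> q = p + q" "p \<otimes>\<^bsub>?R\<^esub> q = p * q" for p q
    by (simp_all add: ring_of_type_algebra_def)
  have uminus: "\<ominus>\<^bsub>?R\<^esub> p = const_poly (-1) * p" for p
  proof -
    interpret cring ?R by (rule cring_from_type_algebra)
    have "- p \<oplus>\<^bsub>?R\<^esub> p = \<zero>\<^bsub>?R\<^esub>" "p \<in> carrier ?R" "- p \<in> carrier ?R"
      by (simp_all add: ring_of_type_algebra_def)
    then have "\<ominus>\<^bsub>?R\<^esub> p = - p" by (rule minus_equality)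
    then show ?thesis by (simp add: const_poly_uminus)
  qed
  have "p \<in> generate_ring ?R ?H" using assms(1) car by simp
  then show ?thesis
  proof induction
    case one
    then show ?case using const[of 1] by (simp add: ops)
  next
    case (incl h)
    then show ?case using const linear_form by auto
  next
    case (a_inv h)
    then show ?case unfolding uminus using const[of "-1"] Sym_const[of "-1" U]
      by (auto intro: mult simp: car)
  next
    case (eng_add h1 h2)
    then show ?case unfolding ops by (auto intro: add simp: car)
  next
    case (eng_mult h1 h2)
    then show ?case unfolding ops by (auto intro: mult simp: car)
  qed
qed

lemma internal_generators_subset:
  "{linear_form u ^ (rho I B u - 1) |u. u \<in> U \<and> u \<noteq> 0} \<subseteq> carrier (Sym U)"
  by (auto intro: Sym_power Sym_linear_form)

lemma internal_ideal_ideal: "ideal (internal_ideal U I B) (Sym U)"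
  unfolding internal_ideal_def
  by (rule ring.genideal_ideal[OF cring.axioms(1)[OF Sym_cring] internal_generators_subset])

lemma internal_ideal_power:
  "u \<in> U \<Longrightarrow> u \<noteq> 0 \<Longrightarrow> linear_form u ^ (rho I B u - 1) \<in> internal_ideal U I B"
  unfolding internal_ideal_def
  using ring.genideal_self[OF cring.axioms(1)[OF Sym_cring] internal_generators_subset] by blast

text \<open>The polynomials satisfying \<open>P\<close> form an ideal that contains the generators.
  As \<open>P\<close> has to imply membership in the carrier, it is instantiated with that
  membership as a conjunct.\<close>

lemma internal_ideal_induct [consumes 1, case_names subset generator zero add mult]:
  assumes "p \<in> internal_ideal U I B"
    and subset: "\<And>p. P p \<Longrightarrow> p \<in> carrier (Sym U)"
    and generator: "\<And>u. u \<in> U \<Longrightarrow> u \<noteq> 0 \<Longrightarrow> P (linear_form u ^ (rho I B u - 1))"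
    and zero: "P 0"
    and add: "\<And>p q. P p \<Longrightarrow> P q \<Longrightarrow> P (p + q)"
    and mult: "\<And>s p. s \<in> carrier (Sym U) \<Longrightarrow> P p \<Longrightarrow> P (s * p)"
  shows "P p"
proof -
  interpret cring "Sym U" by (rule Sym_cring)
  have minus: "\<ominus>\<^bsub>Sym U\<^esub> p = const_poly (-1) * p" if "p \<in> carrier (Sym U)" for p
  proof (rule minus_equality)
    show "const_poly (- 1) * p \<oplus>\<^bsub>Sym U\<^esub> p = \<zero>\<^bsub>Sym U\<^esub>" by (simp add: const_poly_uminus)
  qed (use that in \<open>auto intro: Sym_mult Sym_const\<close>)
  have "ideal (Collect P) (Sym U)"
  proof (rule idealI)
    show "ring (Sym U)" by (rule ring_axioms)
    show "subgroup (Collect P) (add_monoid (Sym U))"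
    proof (rule group.subgroupI[OF a_group])
      fix p assume "p \<in> Collect P"
      then have "P (const_poly (-1) * p)" using Sym_const by (auto intro: mult)
      then show "inv\<^bsub>add_monoid (Sym U)\<^esub> p \<in> Collect P"
        using minus[of p] subset \<open>p \<in> Collect P\<close> by (simp add: a_inv_def)
    qed (use subset \<open>P 0\<close> add in auto)
    show "x \<otimes>\<^bsub>Sym U\<^esub> a \<in> Collect P" if "a \<in> Collect P" "x \<in> carrier (Sym U)" for a x
      using that mult by simp
    then show "a \<otimes>\<^bsub>Sym U\<^esub> x \<in> Collect P" if "a \<in> Collect P" "x \<in> carrier (Sym U)" for a x
      using that by (simp add: mult.commute)
  qed
  then have "internal_ideal U I B \<subseteq> Collect P"
    unfolding internal_ideal_def by (rule genideal_minimal) (use generator in blast)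
  then show ?thesis using assms(1) by blast
qed

section \<open>The Arnold relation in the braid ideal\<close>

abbreviation braid_sym :: "nat \<Rightarrow> (nat \<times> nat) cpoly ring" where
  "braid_sym n \<equiv> Sym (braid_kernel n)"

abbreviation braid_ideal :: "nat \<Rightarrow> (nat \<times> nat) cpoly set" where
  "braid_ideal n \<equiv> internal_ideal (braid_kernel n) (braid_pairs n) (dual_hyperplane n)"

lemma internal_ideal_facts:
  shows internal_ideal_subset: "internal_ideal U I B \<subseteq> carrier (Sym U)"
    and internal_ideal_zero: "0 \<in> internal_ideal U I B"
    and internal_ideal_add: "p \<in> internal_ideal U I B \<Longrightarrow> q \<in> internal_ideal U I B
      \<Longrightarrow> p + q \<in> internal_ideal U I B"
    and internal_ideal_mult: "s \<in> carrier (Sym U) \<Longrightarrow> p \<in> internal_ideal U I B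
      \<Longrightarrow> s * p \<in> internal_ideal U I B"
proof -
  interpret ideal "internal_ideal U I B" "Sym U" by (rule internal_ideal_ideal)
  show "internal_ideal U I B \<subseteq> carrier (Sym U)" by (rule a_subset)
  show "0 \<in> internal_ideal U I B" 
    using additive_subgroup.zero_closed[OF is_additive_subgroup] by simp
  show "p \<in> internal_ideal U I B \<Longrightarrow> q \<in> internal_ideal U I B \<Longrightarrow> p + q \<in> internal_ideal U I B"
    
    using additive_subgroup.a_closed[OF is_additive_subgroup, of p q] by simp
  show "s \<in> carrier (Sym U) \<Longrightarrow> p \<in> internal_ideal U I B \<Longrightarrow> s * p \<in> internal_ideal U I B"
    using I_l_closed[of p s] by simp
qed

text \<open>A triangle has at most three edges, so the generator belonging to it has exponent at
  most 2 and divides the square. The zero vector gives no generator and is treated apart.\<close>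

lemma triangle_square_in_braid_ideal:
  assumes "i \<in> {1..n}" "j \<in> {1..n}" "k \<in> {1..n}"
  shows "(hform i j + hform j k + hform k i) ^ 2 \<in> braid_ideal n"
proof (cases "triangle i j k = 0")
  case True
  then have "hform i j + hform j k + hform k i = 0"
    by (metis linear_form_triangle linear_form_zero)
  then show ?thesis by (simp add: internal_ideal_zero)
next
  case False
  let ?r = "rho (braid_pairs n) (dual_hyperplane n) (triangle i j k)"
  have K: "triangle i j k \<in> braid_kernel n" by (rule triangle_in_braid_kernel[OF assms])
  have "?r - 1 \<le> 2" using card_keys_triangle[of i j k] rho_dual_hyperplane[OF K] by simp
  then have "linear_form (triangle i j k) ^ 2
      = linear_form (triangle i j k) ^ (2 - (?r - 1)) * linear_form (triangle i j k) ^ (?r - 1)"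
    by (simp add: power_add[symmetric])
  also have "\<dots> \<in> braid_ideal n"
    by (intro internal_ideal_mult internal_ideal_power Sym_power Sym_linear_form K False)
  finally show ?thesis by (simp add: linear_form_triangle)
qed

interpretation braid: arnold_ideal "carrier (braid_sym n)" "braid_ideal n" "yform n" "{1..n-1}" for n
proof
  show "yform n i j \<in> carrier (braid_sym n)" if "i \<in> {1..n-1}" "j \<in> {1..n-1}" for i j
    unfolding yform_eq_triangle using that by (intro Sym_linear_form triangle_in_braid_kernel) auto
  show "yform n i i = 0" for i by (simp add: yform_def)
  show "yform n i j = - yform n j i" for i j by (simp add: yform_def hform_antisym[of i j])
  show "yform n i j * yform n j k + yform n j k * yform n k i + yform n k i * yform n i j \<in> braid_ideal n"
    (is "?e \<in> _") if "i \<in> {1..n-1}" "j \<in> {1..n-1}" "k \<in> {1..n-1}" for i j k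
  proof -
    have n: "n \<in> {1..n}" using that by auto
    have sq: "yform n a b ^ 2 \<in> braid_ideal n" if "a \<in> {1..n-1}" "b \<in> {1..n-1}" for a b
      unfolding yform_eq_triangle linear_form_triangle
      by (rule triangle_square_in_braid_ideal) (use that n in auto)
    \<comment> \<open>The edges at \<open>n\<close> cancel in
      \<open>yform n i j + yform n j k + yform n k i\<close>, leaving a triangle away from
      \<open>n\<close>. Subtracting the three squares from the square of this sum leaves twice the
      Arnold expression.\<close>
    have "(hform i j + hform j k + hform k i) ^ 2 \<in> braid_ideal n"
      by (rule triangle_square_in_braid_ideal) (use that in auto)
    moreover have "hform i j + hform j k + hform k i = yform n i j + yform n j k + yform n k i"
      by (simp add: yform_def)
    ultimately have "(yform n i j + yform n j k + yform n k i) ^ 2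
        + const_poly (-1) * yform n i j ^ 2 + const_poly (-1) * yform n j k ^ 2
        + const_poly (-1) * yform n k i ^ 2 \<in> braid_ideal n"
      using sq that by (intro internal_ideal_add internal_ideal_mult Sym_const) auto
    also have "(yform n i j + yform n j k + yform n k i) ^ 2
        + const_poly (-1) * yform n i j ^ 2 + const_poly (-1) * yform n j k ^ 2
        + const_poly (-1) * yform n k i ^ 2 = ?e + ?e"
      by (simp add: const_poly_uminus power2_eq_square algebra_simps)
    finally have "const_poly (1/2) * (?e + ?e) \<in> braid_ideal n"
      by (intro internal_ideal_mult Sym_const)
    also have "const_poly (1/2) * (x + x) = x" for x :: "(nat \<times> nat) cpoly"
    proof -
      have "const_poly (1/2) * (x + x) = (const_poly (1/2) + const_poly (1/2)) * x"
        by (simp only: distrib_left distrib_right)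
      also have "\<dots> = x" by (simp only: const_poly_add[symmetric]) simp
      finally show ?thesis .
    qed
    finally show ?thesis .
  qed
qed (rule Sym_const internal_ideal_subset internal_ideal_zero
    | erule (1) Sym_add Sym_mult internal_ideal_add internal_ideal_mult)+

lemma homogeneous_yform: "homogeneous 1 (yform n i j)"
  unfolding yform_eq_triangle by (rule homogeneous_linear_form)

lemma homogeneous_edge_products:
  assumes "\<And>i j. homogeneous 1 (y i j)" "p \<in> edge_products y W d"
  shows "homogeneous d p"
  using assms(2)
proof (induction d arbitrary: p)
  case (Suc d)
  from Suc.prems obtain i j q where q: "q \<in> edge_products y W d" "p = y i j * q"
    by (rule edge_products_SucE)
  then show ?case using homogeneous_mult[OF assms(1)[of i j] Suc.IH[OF q(1)]] by simp
qed (simp add: homogeneous_one)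

lemma braid_sym_subset_lspan:
  "p \<in> carrier (braid_sym n) \<Longrightarrow> p \<in> lspan (\<Union>d. edge_products (yform n) {1..n-1} d)"
    (is "_ \<Longrightarrow> _ \<in> lspan ?B")
proof (induction rule: Sym_induct)
  case (const a)
  have "1 \<in> ?B" using edge_products_0 by blast
  then show ?case using lspan.scale[OF lspan.base[of 1 ?B], of a] by simp
next
  case (linear_form u)
  have "yform n i j \<in> lspan ?B" if "(i, j) \<in> Poly_Mapping.keys u" for i j
  \<comment> \<open>Since i < j on the support, only the second end can be \<open>n\<close>, and
    then \<open>yform n i n\<close> vanishes. This is why the vertex set stops at n - 1.\<close>
  proof (cases "j = n")
    case True
    then show ?thesis by (simp add: yform_def lspan.zero)
  next
    case False
    then have "i \<in> {1..n-1}" "j \<in> {1..n-1}"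
      using keys_subset_braid_pairs[OF linear_form] that by (auto simp: braid_pairs_def)
    then have "yform n i j * 1 \<in> edge_products (yform n) {1..n-1} (Suc 0)"
      by (intro edge_products_SucI) auto
    then show ?thesis by (auto intro!: lspan.base)
  qed
  then show ?case unfolding linear_form_yform[OF linear_form]
    by (auto intro!: lspan_sum lspan.scale)
next
  case (add p q)
  then show ?case by (auto intro: lspan.add)
next
  case (mult p q)
  show ?case
    by (rule lspan_mult[OF mult(3,4)]) (blast intro: lspan.base edge_products_mult)
qed

text \<open>The algebra is spanned by products of all degrees; the projection
  \<open>hom_component d\<close> removes those of the wrong degree and fixes
  \<open>p\<close>.\<close>

lemma homogeneous_in_lspan:
  assumes "p \<in> carrier (braid_sym n)" "homogeneous d p"
  shows "p \<in> lspan (edge_products (yform n) {1..n-1} d)"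
proof -
  have "p \<in> lspan (\<Union>d. edge_products (yform n) {1..n-1} d)"
    by (rule braid_sym_subset_lspan[OF assms(1)])
  then have "hom_component d p \<in> lspan (edge_products (yform n) {1..n-1} d)"
  proof induction
    case (base b)
    then obtain d' where b: "b \<in> edge_products (yform n) {1..n-1} d'" by blast
    have "homogeneous d' b" by (rule homogeneous_edge_products[OF homogeneous_yform b])
    then show ?case using b by (auto simp: hom_component_homogeneous intro: lspan.intros)
  qed (auto simp: hom_component_add hom_component_const_poly_times intro: lspan.intros)
  then show ?thesis using assms(2) by (simp add: hom_component_homogeneous)
qed

section \<open>Nonvanishing in degree \<open>n - 2\<close>\<close>

text \<open>Membership in the ideal generated by the squares of the variables, expressed on
  monomials.\<close>

definition nonsqfree :: "'e cpoly \<Rightarrow> bool" where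
  "nonsqfree p \<longleftrightarrow> (\<forall>m\<in>Poly_Mapping.keys p. \<exists>e. 2 \<le> Poly_Mapping.lookup m e)"

lemma nonsqfree_zero: "nonsqfree 0"
  by (simp add: nonsqfree_def)

lemma nonsqfree_add: "nonsqfree p \<Longrightarrow> nonsqfree q \<Longrightarrow> nonsqfree (p + q)"
  unfolding nonsqfree_def using keys_add[of p q] by blast

lemma nonsqfree_mult: "nonsqfree p \<Longrightarrow> nonsqfree (q * p)"
  unfolding nonsqfree_def
proof
  fix m assume *: "\<forall>m\<in>Poly_Mapping.keys p. \<exists>e. 2 \<le> Poly_Mapping.lookup m e" "m \<in> Poly_Mapping.keys (q * p)"
  then obtain a b where "m = a + b" "b \<in> Poly_Mapping.keys p" using keys_mult[of q p] by blast
  then show "\<exists>e. 2 \<le> Poly_Mapping.lookup m e" using * by (metis lookup_add trans_le_add2)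
qed

text \<open>Pigeonhole: a monomial of degree d in fewer than d variables repeats one of
  them.\<close>

lemma nonsqfree_linear_power:
  fixes b :: "'k \<Rightarrow> complex" and e :: "'k \<Rightarrow> 'e"
  assumes "finite Q" "card Q < d"
  shows "nonsqfree ((\<Sum>k\<in>Q. const_poly (b k) * var_poly (e k)) ^ d)" (is "nonsqfree (?p ^ d)")
proof -
  have hom_p: "homogeneous 1 ?p"
    by (intro homogeneous_sum homogeneous_const_poly_times homogeneous_var_poly)
  have hom: "homogeneous c (?p ^ c)" for c
  proof (induction c)
    case (Suc c)
    then show ?case using homogeneous_mult[OF hom_p Suc] by simp
  qed (simp add: homogeneous_one)
  have vars_p: "Poly_Mapping.keys m \<subseteq> e ` Q" if "m \<in> Poly_Mapping.keys ?p" for m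
  proof -
    from that have "Poly_Mapping.lookup ?p m \<noteq> 0" by (simp add: in_keys_iff)
    then obtain k where "k \<in> Q" "Poly_Mapping.lookup (const_poly (b k) * var_poly (e k)) m \<noteq> 0"
      unfolding lookup_sum by (meson sum.neutral)
    then have "m = Poly_Mapping.single (e k) 1"
      by (auto simp: lookup_const_poly_times var_poly_def lookup_single when_def split: if_splits)
    then show ?thesis using \<open>k \<in> Q\<close> by simp
  qed
  have vars: "Poly_Mapping.keys m \<subseteq> e ` Q" if "m \<in> Poly_Mapping.keys (?p ^ c)" for m c
    using that
  proof (induction c arbitrary: m)
    case 0
    then show ?case by simp
  next
    case (Suc c)
    then obtain a a' where a: "m = a + a'" "a \<in> Poly_Mapping.keys ?p" "a' \<in> Poly_Mapping.keys (?p ^ c)"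
      using keys_mult[of ?p "?p ^ c"] by auto
    have "Poly_Mapping.keys m \<subseteq> Poly_Mapping.keys a \<union> Poly_Mapping.keys a'"
      unfolding a(1) by (rule keys_add)
    then show ?case using vars_p[OF a(2)] Suc.IH[OF a(3)] by blast
  qed
  show ?thesis unfolding nonsqfree_def
  proof (rule ballI, rule ccontr)
    fix m assume m: "m \<in> Poly_Mapping.keys (?p ^ d)" and nex: "\<nexists>e. 2 \<le> Poly_Mapping.lookup m e"
    have le: "Poly_Mapping.lookup m x \<le> 1" for x
    proof (rule ccontr)
      assume "\<not> Poly_Mapping.lookup m x \<le> 1"
      then have "2 \<le> Poly_Mapping.lookup m x" by simp
      then show False using nex by blast
    qed
    have "d = mdegree m" using hom[of d] m by (auto simp: homogeneous_iff in_keys_iff)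
    also have "\<dots> = (\<Sum>x\<in>e ` Q. Poly_Mapping.lookup m x)" using vars[OF m] assms(1) by (intro mdegree_superset) auto
    also have "\<dots> \<le> (\<Sum>x\<in>e ` Q. 1)" by (intro sum_mono le)
    also have "\<dots> \<le> card Q" using assms(1) by (simp add: card_image_le)
    finally show False using assms(2) by simp
  qed
qed

text \<open>The vertices are ordered as \<open>n - 1 < 1 < 2 < \<dots> < n - 2 < n\<close>.\<close>

definition vertex_rank :: "nat \<Rightarrow> nat \<Rightarrow> nat" where
  "vertex_rank n k = (if k = n - 1 then 0 else k)"

definition top_vertex :: "nat \<Rightarrow> nat \<times> nat \<Rightarrow> nat" where
  "top_vertex n = (\<lambda>(i, j). if vertex_rank n i < vertex_rank n j then j else i)"

text \<open>The variable of an edge is oriented from the smaller to the larger number, whereas the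
  homomorphism orients by rank. On braid pairs the two differ exactly for the edges
  \<open>(i, n - 1)\<close>.\<close>

definition top_sign :: "nat \<Rightarrow> nat \<times> nat \<Rightarrow> complex" where
  "top_sign n = (\<lambda>(i, j). if vertex_rank n i < vertex_rank n j then 1 else - 1)"

text \<open>Each edge is sent to the variable of its higher end. Modulo squares of the variables this
  respects the Arnold relations.\<close>

definition top_hom :: "nat \<Rightarrow> (nat \<times> nat) cpoly \<Rightarrow> (nat \<times> nat) cpoly" where
  "top_hom n = subst_poly (\<lambda>e. const_poly (top_sign n e) * var_poly (top_vertex n e, top_vertex n e))"

lemma vertex_rank_inj:
  "i \<in> {1..n} \<Longrightarrow> j \<in> {1..n} \<Longrightarrow> vertex_rank n i = vertex_rank n j \<longleftrightarrow> i = j"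
  by (auto simp: vertex_rank_def)

text \<open>A diagonal index \<open>(j, j)\<close> is not an edge, which leaves it free to serve as
  the variable of the vertex \<open>j\<close> in the same polynomial ring.\<close>

lemma top_hom_hform:
  assumes "i \<in> {1..n}" "j \<in> {1..n}" "vertex_rank n i < vertex_rank n j"
  shows "top_hom n (hform i j) = var_poly (j, j)"
proof (cases "i < j")
  case True
  then show ?thesis using assms
    by (simp add: hform_less top_hom_def top_vertex_def top_sign_def)
next
  case False
  then have "j < i" using assms(3) by (cases "i = j") auto
  then show ?thesis using assms
    by (simp add: hform_greater top_hom_def subst_poly_uminus top_vertex_def top_sign_def
        const_poly_uminus)
qed

text \<open>Since \<open>n\<close> has the highest rank, both edges at \<open>n\<close> go to the
  variable of \<open>n\<close> and cancel, so only the edge between \<open>i\<close> and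
  \<open>j\<close> counts.\<close>

lemma top_hom_yform:
  assumes "i \<in> {1..n-1}" "j \<in> {1..n-1}" "vertex_rank n i < vertex_rank n j"
  shows "top_hom n (yform n i j) = var_poly (j, j)" "top_hom n (yform n j i) = - var_poly (j, j)"
proof -
  have n: "k \<in> {1..n}" "n \<in> {1..n}" "vertex_rank n k < vertex_rank n n" if "k \<in> {1..n-1}" for k
    using that by (auto simp: vertex_rank_def)
  show *: "top_hom n (yform n i j) = var_poly (j, j)"
    using top_hom_hform[of i n j] top_hom_hform[of i n n] top_hom_hform[of j n n] assms n
    by (simp add: yform_def top_hom_def subst_poly_simps)
  show "top_hom n (yform n j i) = - var_poly (j, j)"
    using * braid.y_antisym[of n j i] by (simp add: top_hom_def subst_poly_uminus)
qed

text \<open>The highest vertex of the support of a cycle meets at least two of its edges, and its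
  coefficient vanishes. Every other vertex with nonzero coefficient is the higher end of an edge.\<close>

lemma card_keys_braid_kernel:
  fixes n u
  defines "B \<equiv> \<lambda>k. \<Sum>e | e \<in> Poly_Mapping.keys u \<and> top_vertex n e = k. top_sign n e * Poly_Mapping.lookup u e"
  assumes u: "u \<in> braid_kernel n" "u \<noteq> 0"
  shows "card {k \<in> top_vertex n ` Poly_Mapping.keys u. B k \<noteq> 0} + 2 \<le> card (Poly_Mapping.keys u)"
proof -
  let ?T = "top_vertex n ` Poly_Mapping.keys u" and ?F = "\<lambda>k. {e \<in> Poly_Mapping.keys u. top_vertex n e = k}"
  have edges: "i \<in> {1..n}" "j \<in> {1..n}" "i \<noteq> j" if "(i, j) \<in> Poly_Mapping.keys u" for i j
    using keys_subset_braid_pairs[OF u(1)] that by (auto simp: braid_pairs_def)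
  have "Poly_Mapping.keys u \<noteq> {}" using u(2) by (metis keys_zero poly_mapping_eqI in_keys_iff empty_iff lookup_zero)
  then have "Max (vertex_rank n ` ?T) \<in> vertex_rank n ` ?T" by (intro Max_in) auto
  then obtain M where M: "M \<in> ?T" "Max (vertex_rank n ` ?T) = vertex_rank n M" by blast
  have M_max: "vertex_rank n k \<le> vertex_rank n M" if "k \<in> ?T" for k
    unfolding M(2)[symmetric] using that by (intro Max_ge) auto
  \<comment> \<open>By maximality \<open>M\<close> is the higher end of every edge that meets
    it.\<close>
  have top: "i = M \<and> \<not> vertex_rank n i < vertex_rank n j \<or> j = M \<and> vertex_rank n i < vertex_rank n j"
    if "(i, j) \<in> Poly_Mapping.keys u" "i = M \<or> j = M" for i j
  proof -
    have "vertex_rank n (top_vertex n (i, j)) \<le> vertex_rank n M" using M_max that by blast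
    then show ?thesis using that(2) vertex_rank_inj[OF edges(1,2)[OF that(1)]] edges(3)[OF that(1)]
      by (auto simp: top_vertex_def split: if_splits)
  qed
  \<comment> \<open>Hence the signed sum over the edges with top \<open>M\<close> is, up to sign,
    the coordinate of \<open>braid_map u\<close> at \<open>M\<close>, which is zero.\<close>
  have "- B M = (\<Sum>(i, j)\<in>?F M. Poly_Mapping.lookup u (i, j) * (of_bool (i = M) - of_bool (j = M)))"
    unfolding B_def sum_negf[symmetric]
    by (rule sum.cong[OF refl]) (use edges(3)[of M M] in \<open>auto simp: top_vertex_def top_sign_def split: if_splits\<close>)
  also have "\<dots> = (\<Sum>(i, j)\<in>Poly_Mapping.keys u. Poly_Mapping.lookup u (i, j) * (of_bool (i = M) - of_bool (j = M)))"
  proof (rule sum.mono_neutral_left)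
    have ends: "i \<noteq> M \<and> j \<noteq> M" if "(i, j) \<in> Poly_Mapping.keys u" "top_vertex n (i, j) \<noteq> M" for i j
      using that top[of i j] by (auto simp: top_vertex_def split: if_splits)
    show "\<forall>e\<in>Poly_Mapping.keys u - ?F M. (case e of (i, j) \<Rightarrow>
        Poly_Mapping.lookup u (i, j) * (of_bool (i = M) - of_bool (j = M))) = 0"
    proof
      fix e assume e: "e \<in> Poly_Mapping.keys u - ?F M"
      obtain i j where "e = (i, j)" by (cases e)
      with e ends[of i j] show "(case e of (i, j) \<Rightarrow>
        Poly_Mapping.lookup u (i, j) * (of_bool (i = M) - of_bool (j = M))) = 0" by simp
    qed
  qed auto
  also have "\<dots> = 0" by (rule braid_kernel_sum_eq_0[OF u(1)]) auto
  finally have BM: "B M = 0" by simp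
  have "card (?F M) \<ge> 2"
  proof (rule ccontr)
    assume "\<not> card (?F M) \<ge> 2"
    moreover have "card (?F M) \<noteq> 0" using M(1) by auto
    ultimately have "card (?F M) = 1" by linarith
    then obtain e where e: "?F M = {e}" by (auto simp: card_1_singleton_iff)
    then have "e \<in> Poly_Mapping.keys u" by blast
    then have "top_sign n e * Poly_Mapping.lookup u e \<noteq> 0"
      by (auto simp: top_sign_def in_keys_iff split: prod.splits)
    then show False using BM e by (simp add: B_def)
  qed
  moreover have "card (?F k) \<ge> 1" if "k \<in> ?T" for k
    using that by (auto simp: Suc_le_eq card_gt_0_iff)
  moreover have "card (Poly_Mapping.keys u) = (\<Sum>k\<in>?T. card (?F k))"
    using sum.image_gen[of "Poly_Mapping.keys u" "\<lambda>_. 1 :: nat" "top_vertex n"] by simp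
  \<comment> \<open>The fibre over \<open>M\<close> has two edges or more but contributes nothing to
    the counted vertices; this is the surplus of 2.\<close>
  then have "card (Poly_Mapping.keys u) = card (?F M) + (\<Sum>k\<in>?T - {M}. card (?F k))"
    using M(1) by (simp add: sum.remove)
  moreover have "card (?T - {M}) \<le> (\<Sum>k\<in>?T - {M}. card (?F k))"
    using sum_mono[of "?T - {M}" "\<lambda>_. 1" "\<lambda>k. card (?F k)"] calculation(2) by simp
  moreover have "card {k \<in> ?T. B k \<noteq> 0} \<le> card (?T - {M})"
    by (rule card_mono) (use BM in auto)
  ultimately show ?thesis by linarith
qed

lemma top_hom_linear_form:
  assumes "u \<in> braid_kernel n"
  shows "top_hom n (linear_form u) = (\<Sum>k\<in>top_vertex n ` Poly_Mapping.keys u.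
    const_poly (\<Sum>e | e \<in> Poly_Mapping.keys u \<and> top_vertex n e = k. top_sign n e * Poly_Mapping.lookup u e) * var_poly (k, k))"
proof -
  have "top_hom n (linear_form u)
      = (\<Sum>e\<in>Poly_Mapping.keys u. const_poly (top_sign n e * Poly_Mapping.lookup u e) * var_poly (top_vertex n e, top_vertex n e))"
    by (simp add: linear_form_superset[of "Poly_Mapping.keys u"] top_hom_def subst_poly_simps const_poly_mult
        algebra_simps)
  also have "\<dots> = (\<Sum>k\<in>top_vertex n ` Poly_Mapping.keys u. \<Sum>e | e \<in> Poly_Mapping.keys u \<and> top_vertex n e = k.
      const_poly (top_sign n e * Poly_Mapping.lookup u e) * var_poly (top_vertex n e, top_vertex n e))"
    by (rule sum.image_gen) simp
  also have "\<dots> = (\<Sum>k\<in>top_vertex n ` Poly_Mapping.keys u.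
    const_poly (\<Sum>e | e \<in> Poly_Mapping.keys u \<and> top_vertex n e = k. top_sign n e * Poly_Mapping.lookup u e) * var_poly (k, k))"
    by (simp add: const_poly_sum sum_distrib_right)
  finally show ?thesis .
qed

text \<open>Elements whose image lies in the ideal of squares are closed under sums and multiples,
  so generators suffice. For them the exponent exceeds the number of variables with nonzero
  coefficient, and the pigeonhole lemma applies.\<close>

lemma nonsqfree_top_hom_braid_ideal:
  assumes "p \<in> braid_ideal n"
  shows "nonsqfree (top_hom n p)"
proof -
  have "p \<in> carrier (braid_sym n) \<and> nonsqfree (top_hom n p)"
    using assms
  proof (induction rule: internal_ideal_induct)
    case (generator u)
    let ?B = "\<lambda>k. \<Sum>e | e \<in> Poly_Mapping.keys u \<and> top_vertex n e = k. top_sign n e * Poly_Mapping.lookup u e"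
    let ?Q = "{k \<in> top_vertex n ` Poly_Mapping.keys u. ?B k \<noteq> 0}"
    have "top_hom n (linear_form u) = (\<Sum>k\<in>?Q. const_poly (?B k) * var_poly (k, k))"
      unfolding top_hom_linear_form[OF generator(1)] by (rule sum.mono_neutral_right) auto
    moreover have "card ?Q < card (Poly_Mapping.keys u) - 1"
      using card_keys_braid_kernel[OF generator] by linarith
    ultimately have "nonsqfree (top_hom n (linear_form u) ^ (card (Poly_Mapping.keys u) - 1))"
      using nonsqfree_linear_power[of ?Q "card (Poly_Mapping.keys u) - 1" ?B "\<lambda>k. (k, k)"] by simp
    then show ?case using generator
      by (simp add: rho_dual_hyperplane top_hom_def subst_poly_power Sym_power Sym_linear_form)
  next
    case zero
    show ?case using Sym_const[of 0] by (simp add: top_hom_def nonsqfree_zero)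
  qed (auto simp: top_hom_def subst_poly_simps intro: nonsqfree_add nonsqfree_mult Sym_add Sym_mult)
  then show ?thesis ..
qed

lemma nonsqfree_var_poly_square: "nonsqfree (var_poly e * (var_poly e * p))"
proof -
  have "nonsqfree (var_poly e * var_poly e)"
    by (auto simp: nonsqfree_def var_poly_def mult_single lookup_add intro!: exI[of _ e] dest: in_keys_lookup_in_range)
  then show ?thesis using nonsqfree_mult[of "var_poly e * var_poly e" p] by (simp add: mult_ac)
qed

lemma nonsqfree_uminus: "nonsqfree (- p) \<longleftrightarrow> nonsqfree p"
  by (simp add: nonsqfree_def in_keys_iff)

text \<open>An unsorted word that starts with an ascent has a peak, and the two edges at the peak
  both go to its variable. The induction walks along the initial ascents up to the first
  descent.\<close>

lemma top_hom_chain_unsorted: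
  assumes "distinct (r # x # ws)" "set (r # x # ws) \<subseteq> {1..n-1}" "vertex_rank n r < vertex_rank n x"
    and "\<not> sorted (map (vertex_rank n) (r # x # ws))"
  shows "nonsqfree (top_hom n (chain (yform n) (r # x # ws)))"
  using assms
proof (induction ws arbitrary: r x)
  case Nil
  then show ?case by simp
next
  case (Cons z ws)
  have hom_mult: "top_hom n (p * q) = top_hom n p * top_hom n q" for p q
    by (simp add: top_hom_def subst_poly_mult)
  show ?case
  proof (cases "vertex_rank n x < vertex_rank n z")
    case True
    have "\<not> sorted (map (vertex_rank n) (x # z # ws))"
    proof
      assume *: "sorted (map (vertex_rank n) (x # z # ws))"
      then have "sorted (map (vertex_rank n) (r # x # z # ws))" using Cons.prems(3) by fastforce
      then show False using Cons.prems(4) by simp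
    qed
    then have "nonsqfree (top_hom n (chain (yform n) (x # z # ws)))"
      using Cons.prems True by (intro Cons.IH) auto
    then show ?thesis unfolding chain.simps(1)[of _ r] hom_mult by (rule nonsqfree_mult)
  next
    case False
    moreover have "x \<in> {1..n}" "z \<in> {1..n}" "x \<noteq> z" using Cons.prems by auto
    ultimately have "vertex_rank n z < vertex_rank n x" using vertex_rank_inj[of x n z] by auto
    then have "top_hom n (chain (yform n) (r # x # z # ws))
        = - (var_poly (x, x) * (var_poly (x, x) * top_hom n (chain (yform n) (z # ws))))"
      using Cons.prems top_hom_yform(1)[of r n x] top_hom_yform(2)[of z n x]
      by (simp add: hom_mult)
    then show ?thesis by (simp only: nonsqfree_uminus nonsqfree_var_poly_square)
  qed
qed

text \<open>Along an increasing chain each edge goes to its later vertex, so every vertex except the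
  root contributes its variable once.\<close>

lemma top_hom_chain_sorted:
  assumes "distinct (r # ws)" "set (r # ws) \<subseteq> {1..n-1}" "sorted (map (vertex_rank n) (r # ws))"
  shows "top_hom n (chain (yform n) (r # ws))
       = Poly_Mapping.single (\<Sum>k\<in>set ws. Poly_Mapping.single (k, k) 1) 1"
  using assms
proof (induction ws arbitrary: r)
  case Nil
  then show ?case by (simp add: top_hom_def)
next
  case (Cons x ws)
  have "vertex_rank n r \<le> vertex_rank n x" using Cons.prems(3) by simp
  then have "vertex_rank n r < vertex_rank n x"
    using vertex_rank_inj[of r n x] Cons.prems(1,2) by force
  then have "top_hom n (yform n r x) = var_poly (x, x)"
    using Cons.prems by (intro top_hom_yform) auto
  moreover have "top_hom n (chain (yform n) (x # ws))
      = Poly_Mapping.single (\<Sum>k\<in>set ws. Poly_Mapping.single (k, k) 1) 1"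
    using Cons.prems by (intro Cons.IH) auto
  ultimately show ?case using Cons.prems(1)
    by (simp add: top_hom_def subst_poly_mult var_poly_def mult_single)
qed

text \<open>The linear functional that separates chains: its monomial involves all vertices except
  the lowest, \<open>n - 1\<close>, and the highest, \<open>n\<close>.\<close>

definition top_coeff :: "nat \<Rightarrow> (nat \<times> nat) cpoly \<Rightarrow> complex" where
  "top_coeff n p = Poly_Mapping.lookup (top_hom n p) (\<Sum>k\<in>{1..<n-1}. Poly_Mapping.single (k, k) 1)"

lemma top_coeff_linear:
  "top_coeff n (\<Sum>x\<in>A. const_poly (b x) * f x) = (\<Sum>x\<in>A. b x * top_coeff n (f x))"
  by (simp add: top_coeff_def top_hom_def subst_poly_simps lookup_sum lookup_const_poly_times)

lemma top_coeff_nonsqfree: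
  assumes "nonsqfree (top_hom n p)"
  shows "top_coeff n p = 0"
proof (rule ccontr)
  let ?m = "\<Sum>k\<in>{1..<n-1}. Poly_Mapping.single (k, k) (1 :: nat)"
  assume "top_coeff n p \<noteq> 0"
  then have "?m \<in> Poly_Mapping.keys (top_hom n p)" by (simp add: top_coeff_def in_keys_iff)
  then obtain e where "2 \<le> Poly_Mapping.lookup ?m e"
    using assms unfolding nonsqfree_def by blast
  also have "Poly_Mapping.lookup ?m e = (\<Sum>k\<in>{1..<n-1}. if (k, k) = e then 1 else 0)"
    by (auto simp: lookup_sum lookup_single when_def intro!: sum.cong)
  also have "\<dots> \<le> (\<Sum>k\<in>{1..<n-1}. if k = fst e then 1 else 0)"
    by (rule sum_mono) auto
  also have "\<dots> \<le> 1" by simp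
  finally show False by simp
qed

lemma top_coeff_braid_ideal: "p \<in> braid_ideal n \<Longrightarrow> top_coeff n p = 0"
  by (intro top_coeff_nonsqfree nonsqfree_top_hom_braid_ideal)

text \<open>The chain starts at \<open>n - 1\<close>, the vertex of rank 0, so it opens with an
  ascent and is sorted only if the remaining letters are in natural order.\<close>

lemma top_coeff_chain:
  assumes "n \<ge> 3" "x permutes {1..n-2}"
  shows "top_coeff n (chain (yform n) ((n-1) # map x [1..<n-1])) = of_bool (x = id)"
proof -
  let ?ws = "map x [1..<n-1]"
  have set_ws: "set ?ws = {1..<n-1}"
  proof -
    have "{1..<n-1} = {1..n-2}" by auto
    then show ?thesis using permutes_image[OF assms(2)] by (simp del: set_upt add: set_upt)
  qed
  have dist: "distinct ?ws" using permutes_inj_on[OF assms(2)] by (simp add: distinct_map)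
  have V: "distinct ((n-1) # ?ws)" "set ((n-1) # ?ws) \<subseteq> {1..n-1}"
    using set_ws dist assms(1) by auto
  have rank: "map (vertex_rank n) ?ws = ?ws"
    using set_ws by (intro map_idI) (auto simp: vertex_rank_def)
  have sorted_iff: "sorted (map (vertex_rank n) ((n-1) # ?ws)) \<longleftrightarrow> sorted ?ws"
  proof -
    have eq: "map (vertex_rank n) ((n-1) # ?ws) = 0 # map (vertex_rank n) ?ws"
      by (simp add: vertex_rank_def)
    show ?thesis by (simp only: eq rank) simp
  qed
  show ?thesis
  proof (cases "x = id")
    case True
    then have "top_hom n (chain (yform n) ((n-1) # ?ws))
        = Poly_Mapping.single (\<Sum>k\<in>set ?ws. Poly_Mapping.single (k, k) 1) 1"
      using V sorted_iff by (intro top_hom_chain_sorted) auto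
    then show ?thesis using True set_ws by (simp add: top_coeff_def)
  next
    case False
    have "\<not> sorted ?ws"
    proof
      assume "sorted ?ws"
      then have "?ws = [1..<n-1]" using dist set_ws by (intro sorted_distinct_set_unique) auto
      then have "x k = k" if "k \<in> {1..n-2}" for k
        using that map_eq_conv[of x "[1..<n-1]" id] by auto
      then have "x = id" using permutes_not_in[OF assms(2)] by (intro ext) (metis id_apply)
      then show False using False by simp
    qed
    moreover have "[1..<n-1] = 1 # [2..<n-1]" using assms(1) by (simp add: upt_conv_Cons numeral_2_eq_2)
    moreover have "x 1 \<in> set ?ws" using assms(1) by simp
    then have "vertex_rank n (n - 1) < vertex_rank n (x 1)"
      unfolding set_ws by (auto simp: vertex_rank_def)
    ultimately have "nonsqfree (top_hom n (chain (yform n) ((n-1) # ?ws)))"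
      using V sorted_iff top_hom_chain_unsorted[of "n-1" "x 1" "map x [2..<n-1]" n] by simp
    then show ?thesis using False top_coeff_nonsqfree by simp
  qed
qed

section \<open>The symmetric group action\<close>

lemma poly_action_hom:
  "poly_action \<pi> (p + q) = poly_action \<pi> p + poly_action \<pi> q"
  "poly_action \<pi> (p - q) = poly_action \<pi> p - poly_action \<pi> q"
  "poly_action \<pi> (p * q) = poly_action \<pi> p * poly_action \<pi> q"
  "poly_action \<pi> (p ^ k) = poly_action \<pi> p ^ k"
  "poly_action \<pi> (- p) = - poly_action \<pi> p"
  "poly_action \<pi> (sum f A) = (\<Sum>x\<in>A. poly_action \<pi> (f x))"
  "poly_action \<pi> (const_poly a) = const_poly a"
  "poly_action \<pi> 0 = 0" "poly_action \<pi> 1 = 1"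
  by (simp_all add: poly_action_def subst_poly_simps)

lemma poly_action_hform: "poly_action \<pi> (hform i j) = hform (\<pi> i) (\<pi> j)"
proof -
  have var: "poly_action \<pi> (var_poly (a, b)) = hform (\<pi> a) (\<pi> b)" for a b
    by (simp add: poly_action_def hform_def)
  consider "i < j" | "i = j" | "j < i" by linarith
  then show ?thesis
    using hform_antisym[of "\<pi> i" "\<pi> j"]
    by cases (auto simp: hform_less hform_greater var poly_action_hom)
qed

lemma poly_action_yform: "\<pi> n = n \<Longrightarrow> poly_action \<pi> (yform n i j) = yform n (\<pi> i) (\<pi> j)"
  by (simp add: yform_def poly_action_hom poly_action_hform)

lemma poly_action_chain: "\<pi> n = n \<Longrightarrow> poly_action \<pi> (chain (yform n) ws) = chain (yform n) (map \<pi> ws)"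
  by (induction "yform n" ws rule: chain.induct) (auto simp: poly_action_hom poly_action_yform)

lemma poly_action_linear_form:
  "u \<in> braid_kernel n \<Longrightarrow> poly_action \<pi> (linear_form u)
     = (\<Sum>(i, j)\<in>Poly_Mapping.keys u. const_poly (Poly_Mapping.lookup u (i, j)) * hform (\<pi> i) (\<pi> j))"
  by (simp add: linear_form_hform[OF keys_subset_braid_pairs] poly_action_hom poly_action_hform
      case_prod_beta)

lemma poly_action_comp:
  assumes "p \<in> carrier (braid_sym n)"
  shows "poly_action \<pi> (poly_action \<sigma> p) = poly_action (\<pi> \<circ> \<sigma>) p"
  using assms
  by (induction rule: Sym_induct)
    (simp_all add: poly_action_hom poly_action_linear_form poly_action_hform case_prod_beta)

text \<open>Restricted to the subalgebra: a variable with index \<open>(i, j)\<close>, i \<ge> j, is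
  sent to \<open>hform i j\<close> and not to itself.\<close>

lemma poly_action_id:
  assumes "p \<in> carrier (braid_sym n)"
  shows "poly_action id p = p"
  using assms
  by (induction rule: Sym_induct)
    (simp_all add: poly_action_hom poly_action_linear_form linear_form_hform[OF keys_subset_braid_pairs]
      poly_action_hform case_prod_beta)

text \<open>The action on cycles as vectors. The generators of the ideal are indexed by vectors and
  their exponents are read off from supports, so the action on linear forms alone is not
  enough.\<close>

definition perm_cycle :: "(nat \<Rightarrow> nat) \<Rightarrow> ((nat \<times> nat) \<Rightarrow>\<^sub>0 complex) \<Rightarrow> (nat \<times> nat) \<Rightarrow>\<^sub>0 complex" where
  "perm_cycle \<pi> u = (\<Sum>(i, j)\<in>Poly_Mapping.keys u. if \<pi> i < \<pi> j then Poly_Mapping.single (\<pi> i, \<pi> j) (Poly_Mapping.lookup u (i, j))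
     else Poly_Mapping.single (\<pi> j, \<pi> i) (- Poly_Mapping.lookup u (i, j)))"

lemma linear_form_sum: "linear_form (sum f A) = (\<Sum>x\<in>A. linear_form (f x))"
  by (induction A rule: infinite_finite_induct) (auto simp: linear_form_add)

text \<open>The bound on the support goes one way, which suffices: a smaller support means a smaller
  exponent, hence a stronger generator.\<close>

lemma perm_cycle:
  assumes u: "u \<in> braid_kernel n" and \<pi>: "\<pi> permutes {1..n}"
  shows "poly_action \<pi> (linear_form u) = linear_form (perm_cycle \<pi> u)"
    and "card (Poly_Mapping.keys (perm_cycle \<pi> u)) \<le> card (Poly_Mapping.keys u)"
    and "perm_cycle \<pi> u \<in> braid_kernel n"
proof -
  have edge: "\<pi> i \<in> {1..n}" "\<pi> j \<in> {1..n}" "\<pi> i \<noteq> \<pi> j" if "(i, j) \<in> Poly_Mapping.keys u" for i j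
  proof -
    have "i \<in> {1..n}" "j \<in> {1..n}" "i \<noteq> j"
      using keys_subset_braid_pairs[OF u] that by (auto simp: braid_pairs_def)
    then show "\<pi> i \<in> {1..n}" "\<pi> j \<in> {1..n}" "\<pi> i \<noteq> \<pi> j"
      using permutes_in_image[OF \<pi>] permutes_inj[OF \<pi>] by (auto simp: inj_eq)
  qed
  have "linear_form (perm_cycle \<pi> u) = (\<Sum>(i, j)\<in>Poly_Mapping.keys u. const_poly (Poly_Mapping.lookup u (i, j)) * hform (\<pi> i) (\<pi> j))"
    unfolding perm_cycle_def linear_form_sum
  proof (rule sum.cong[OF refl], clarify)
    fix i j assume "(i, j) \<in> Poly_Mapping.keys u"
    then have "\<pi> i < \<pi> j \<or> \<pi> j < \<pi> i" using edge by (meson nat_neq_iff)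
    then show "linear_form (if \<pi> i < \<pi> j then Poly_Mapping.single (\<pi> i, \<pi> j) (Poly_Mapping.lookup u (i, j))
        else Poly_Mapping.single (\<pi> j, \<pi> i) (- Poly_Mapping.lookup u (i, j)))
      = const_poly (Poly_Mapping.lookup u (i, j)) * hform (\<pi> i) (\<pi> j)"
      by (auto simp: linear_form_single hform_less hform_greater const_poly_uminus)
  qed
  then show "poly_action \<pi> (linear_form u) = linear_form (perm_cycle \<pi> u)"
    using poly_action_linear_form[OF u, of \<pi>] by simp
  define \<epsilon> where "\<epsilon> = (\<lambda>(i, j). if \<pi> i < \<pi> j then (\<pi> i, \<pi> j) else (\<pi> j, \<pi> i))"
  have keys_sub: "Poly_Mapping.keys (perm_cycle \<pi> u) \<subseteq> \<epsilon> ` Poly_Mapping.keys u"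
  proof
    fix e assume "e \<in> Poly_Mapping.keys (perm_cycle \<pi> u)"
    then have "(\<Sum>(i, j)\<in>Poly_Mapping.keys u. Poly_Mapping.lookup (if \<pi> i < \<pi> j then Poly_Mapping.single (\<pi> i, \<pi> j) (Poly_Mapping.lookup u (i, j))
        else Poly_Mapping.single (\<pi> j, \<pi> i) (- Poly_Mapping.lookup u (i, j))) e) \<noteq> 0"
      by (simp add: perm_cycle_def in_keys_iff lookup_sum case_prod_beta)
    then obtain x where "x \<in> Poly_Mapping.keys u" "(case x of (i, j) \<Rightarrow> Poly_Mapping.lookup (if \<pi> i < \<pi> j then Poly_Mapping.single (\<pi> i, \<pi> j) (Poly_Mapping.lookup u (i, j))
        else Poly_Mapping.single (\<pi> j, \<pi> i) (- Poly_Mapping.lookup u (i, j))) e) \<noteq> 0"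
      by (meson sum.neutral)
    moreover obtain i j where "x = (i, j)" by (cases x)
    ultimately show "e \<in> \<epsilon> ` Poly_Mapping.keys u"
      by (auto simp: \<epsilon>_def lookup_single when_def image_iff split: if_splits intro!: bexI[of _ "(i, j)"])
  qed
  then have "card (Poly_Mapping.keys (perm_cycle \<pi> u)) \<le> card (\<epsilon> ` Poly_Mapping.keys u)" by (intro card_mono) auto
  also have "\<dots> \<le> card (Poly_Mapping.keys u)" by (rule card_image_le) simp
  finally show "card (Poly_Mapping.keys (perm_cycle \<pi> u)) \<le> card (Poly_Mapping.keys u)" .
  have "\<epsilon> e \<in> braid_pairs n" if "e \<in> Poly_Mapping.keys u" for e
  proof -
    obtain i j where e: "e = (i, j)" by (cases e)
    show ?thesis using edge[of i j] that unfolding e by (auto simp: \<epsilon>_def braid_pairs_def)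
  qed
  with keys_sub have sub: "Poly_Mapping.keys (perm_cycle \<pi> u) \<subseteq> braid_pairs n" by blast
  have "braid_map (perm_cycle \<pi> u) = (\<Sum>(i, j)\<in>Poly_Mapping.keys u.
      Poly_Mapping.single (\<pi> i) (Poly_Mapping.lookup u (i, j)) - Poly_Mapping.single (\<pi> j) (Poly_Mapping.lookup u (i, j)))"
    unfolding perm_cycle_def braid_map_sum
    by (rule sum.cong[OF refl]) (auto simp: braid_map_single braid_map_uminus single_uminus)
  also have "\<dots> = 0"
  \<comment> \<open>The coordinate at \<open>v\<close> is the pairing of \<open>u\<close> with the
    potential that is 1 at the vertices mapped to \<open>v\<close>.\<close>
  proof (rule poly_mapping_eqI)
    fix v
    have "Poly_Mapping.lookup (\<Sum>(i, j)\<in>Poly_Mapping.keys u.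
      Poly_Mapping.single (\<pi> i) (Poly_Mapping.lookup u (i, j)) - Poly_Mapping.single (\<pi> j) (Poly_Mapping.lookup u (i, j))) v
      = (\<Sum>(i, j)\<in>Poly_Mapping.keys u. Poly_Mapping.lookup u (i, j) * (of_bool (\<pi> i = v) - of_bool (\<pi> j = v)))"
      by (auto simp: lookup_sum lookup_minus lookup_single when_def case_prod_beta intro!: sum.cong)
    also have "\<dots> = 0" by (rule braid_kernel_sum_eq_0[OF u]) auto
    finally show "Poly_Mapping.lookup (\<Sum>(i, j)\<in>Poly_Mapping.keys u.
      Poly_Mapping.single (\<pi> i) (Poly_Mapping.lookup u (i, j)) - Poly_Mapping.single (\<pi> j) (Poly_Mapping.lookup u (i, j))) v
      = Poly_Mapping.lookup 0 v" by simp
  qed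
  finally show "perm_cycle \<pi> u \<in> braid_kernel n" using sub by (simp add: braid_kernel_def)
qed

lemma poly_action_Sym:
  assumes "\<pi> permutes {1..n}" "p \<in> carrier (braid_sym n)"
  shows "poly_action \<pi> p \<in> carrier (braid_sym n)"
  using assms(2)
proof (induction rule: Sym_induct)
  case (linear_form u)
  then show ?case using perm_cycle[OF linear_form assms(1)] by (simp add: Sym_linear_form)
qed (auto simp: poly_action_hom intro: Sym_const Sym_add Sym_mult)

lemma poly_action_braid_ideal:
  assumes \<pi>: "\<pi> permutes {1..n}" and "p \<in> braid_ideal n"
  shows "poly_action \<pi> p \<in> braid_ideal n"
proof -
  have "p \<in> carrier (braid_sym n) \<and> poly_action \<pi> p \<in> braid_ideal n"
    using assms(2)
  proof (induction rule: internal_ideal_induct)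
    case (generator u)
    note pc = perm_cycle[OF generator(1) \<pi>]
    let ?r = "rho (braid_pairs n) (dual_hyperplane n)"
    have r: "?r u = card (Poly_Mapping.keys u)" "?r (perm_cycle \<pi> u) = card (Poly_Mapping.keys (perm_cycle \<pi> u))"
      using rho_dual_hyperplane generator(1) pc(3) by auto
    have "linear_form (perm_cycle \<pi> u) ^ (?r u - 1) \<in> braid_ideal n"
    proof (cases "perm_cycle \<pi> u = 0")
      case True
      \<comment> \<open>A nonzero cycle has at least two edges, so the exponent is positive and the
        power of zero is zero rather than one.\<close>
      have "?r u - 1 > 0" using card_keys_braid_kernel[OF generator] r by linarith
      then show ?thesis using True by (simp add: power_0_left internal_ideal_zero)
    next
      case False
      have "?r (perm_cycle \<pi> u) - 1 \<le> ?r u - 1" using pc(2) r by simp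
      then have "linear_form (perm_cycle \<pi> u) ^ (?r u - 1)
        = linear_form (perm_cycle \<pi> u) ^ (?r u - 1 - (?r (perm_cycle \<pi> u) - 1))
          * linear_form (perm_cycle \<pi> u) ^ (?r (perm_cycle \<pi> u) - 1)"
        by (simp only: power_add[symmetric] le_add_diff_inverse2)
      also have "\<dots> \<in> braid_ideal n"
        by (intro internal_ideal_mult internal_ideal_power Sym_power Sym_linear_form pc(3) False)
      finally show ?thesis .
    qed
    then show ?case using pc(1) generator by (simp add: poly_action_hom Sym_power Sym_linear_form)
  next
    case zero
    show ?case using Sym_const[of 0] by (simp add: poly_action_hom internal_ideal_zero)
  qed (auto simp: poly_action_hom
      intro: Sym_add Sym_mult internal_ideal_add internal_ideal_mult poly_action_Sym[OF \<pi>])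
  then show ?thesis ..
qed

section \<open>The top component\<close>

definition braid_class :: "nat \<Rightarrow> (nat \<times> nat) cpoly \<Rightarrow> (nat \<times> nat) cpoly set" where
  "braid_class n p = braid_ideal n +>\<^bsub>braid_sym n\<^esub> p"

lemma braid_class_iff: "q \<in> braid_class n p \<longleftrightarrow> q - p \<in> braid_ideal n"
proof -
  have "q \<in> braid_class n p \<longleftrightarrow> (\<exists>h\<in>braid_ideal n. q = h + p)"
    by (auto simp: braid_class_def a_r_coset_def r_coset_def)
  then show ?thesis by (auto intro!: bexI[of _ "q - p"])
qed

lemma braid_class_eq_iff: "braid_class n p = braid_class n q \<longleftrightarrow> p - q \<in> braid_ideal n"
proof
  assume "braid_class n p = braid_class n q"
  moreover have "p \<in> braid_class n p" by (simp add: braid_class_iff internal_ideal_zero)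
  ultimately show "p - q \<in> braid_ideal n" by (simp add: braid_class_iff)
next
  assume *: "p - q \<in> braid_ideal n"
  have "r - p \<in> braid_ideal n \<longleftrightarrow> r - q \<in> braid_ideal n" for r
    using braid.J_add[OF _ *, of "r - p"] braid.J_diff[OF _ *, of "r - q"] by auto
  then show "braid_class n p = braid_class n q" by (auto simp: braid_class_iff)
qed

lemma braid_class_zero: "braid_class n 0 = braid_ideal n"
  by (auto simp: braid_class_iff)

text \<open>The action on cosets is elementwise, so the image must be shown to fill a whole coset;
  the inverse permutation, which also preserves the ideal, gives this inclusion.\<close>

lemma class_action_braid_class:
  assumes \<pi>: "\<pi> permutes {1..n}" and p: "p \<in> carrier (braid_sym n)"
  shows "class_action \<pi> (braid_class n p) = braid_class n (poly_action \<pi> p)"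
proof -
  have inv: "inv_into UNIV \<pi> permutes {1..n}" by (rule permutes_inv[OF \<pi>])
  have "poly_action \<pi> q \<in> braid_class n (poly_action \<pi> p)" if "q \<in> braid_class n p" for q
    using poly_action_braid_ideal[OF \<pi>, of "q - p"] that by (simp add: braid_class_iff poly_action_hom)
  moreover have "q \<in> poly_action \<pi> ` braid_class n p" if "q \<in> braid_class n (poly_action \<pi> p)" for q
  proof
    have diff: "q - poly_action \<pi> p \<in> braid_ideal n" using that by (simp add: braid_class_iff)
    then have "q - poly_action \<pi> p + poly_action \<pi> p \<in> carrier (braid_sym n)"
      by (intro Sym_add poly_action_Sym \<pi> p) (use internal_ideal_subset in blast)
    then have q: "q \<in> carrier (braid_sym n)" by simp
    show "q = poly_action \<pi> (poly_action (inv_into UNIV \<pi>) q)"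
      by (simp add: poly_action_comp[OF q] permutes_inv_o[OF \<pi>] poly_action_id[OF q])
    have "poly_action (inv_into UNIV \<pi>) (poly_action \<pi> p) = p"
      by (simp add: poly_action_comp[OF p] permutes_inv_o[OF \<pi>] poly_action_id[OF p])
    then show "poly_action (inv_into UNIV \<pi>) q \<in> braid_class n p"
      using poly_action_braid_ideal[OF inv diff] by (simp add: braid_class_iff poly_action_hom)
  qed
  ultimately show ?thesis by (auto simp: class_action_def)
qed

lemma internal_component_carrier:
  "carrier (internal_component (braid_kernel n) (braid_pairs n) (dual_hyperplane n) d)
   = {braid_class n p |p. p \<in> carrier (braid_sym n) \<and> homogeneous d p}"
  by (simp add: internal_component_def Let_def braid_class_def)

lemma internal_algebra_zero:
  "\<zero>\<^bsub>internal_algebra (braid_kernel n) (braid_pairs n) (dual_hyperplane n)\<^esub> = braid_class n 0"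
  by (simp add: internal_algebra_def FactRing_def braid_class_zero)

lemma chain_in_Sym: "set ws \<subseteq> {1..n-1} \<Longrightarrow> chain (yform n) ws \<in> carrier (braid_sym n)"
  by (rule braid.chain_S)

lemma homogeneous_chain: "ws \<noteq> [] \<Longrightarrow> homogeneous (length ws - 1) (chain (yform n) ws)"
  using homogeneous_edge_products[where y = "yform n" and W = UNIV, OF homogeneous_yform]
    chain_in_edge_products[of "hd ws" "tl ws" UNIV "yform n"] by simp

lemma rooted_vertices:
  assumes "n \<ge> 3"
  shows "insert (n - 1) {1..n-2} = {1..n-1}" "card {1..n-2} = n - 2" "n - 1 \<notin> {1..n-2}"
  using assms by auto

lemma homogeneous_in_braid_ideal:
  assumes "n \<ge> 3" "p \<in> carrier (braid_sym n)" "homogeneous d p" "d > n - 2"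
  shows "p \<in> braid_ideal n"
proof -
  have "edge_products (yform n) {1..n-1} d \<subseteq> braid_ideal n"
    using braid.edge_products_reduce[where W = "{1..n-2}" and r = "n-1" and n = n] rooted_vertices[OF assms(1)] assms(4)
    by auto
  then have "p \<in> lspan (braid_ideal n)"
    using homogeneous_in_lspan[OF assms(2,3)] lspan_mono by blast
  then show ?thesis by (rule braid.lspan_J)
qed

lemma homogeneous_in_lspan_chains:
  assumes "n \<ge> 3" "p \<in> carrier (braid_sym n)" "homogeneous (n - 2) p"
  shows "p \<in> lspan (braid_ideal n \<union> {chain (yform n) ((n-1) # ws) |ws. distinct ws \<and> set ws = {1..n-2}})"
    (is "p \<in> lspan ?C")
proof -
  have "edge_products (yform n) {1..n-1} (n - 2) \<subseteq> lspan ?C"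
    using braid.edge_products_reduce[where W = "{1..n-2}" and r = "n-1" and n = n] rooted_vertices[OF assms(1)] by auto
  then show ?thesis using homogeneous_in_lspan[OF assms(2,3)] lspan_subset_lspan by blast
qed

text \<open>Degree n - 2 survives because the functional takes the value 1 on the increasing chain,
  while homogeneous elements of higher degree lie in the ideal.\<close>

lemma dual_braid_top_eq:
  assumes n: "n \<ge> 3"
  shows "dual_braid_top n = internal_component (braid_kernel n) (braid_pairs n) (dual_hyperplane n) (n - 2)"
proof -
  let ?P = "\<lambda>d. carrier (internal_component (braid_kernel n) (braid_pairs n) (dual_hyperplane n) d)
     \<noteq> {\<zero>\<^bsub>internal_algebra (braid_kernel n) (braid_pairs n) (dual_hyperplane n)\<^esub>}"
  have "(GREATEST d. ?P d) = n - 2"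
  proof (rule Greatest_equality)
    let ?c = "chain (yform n) ((n-1) # map id [1..<n-1])"
    have "?c \<in> carrier (braid_sym n)" using n by (intro chain_in_Sym) auto
    moreover have "homogeneous (n - 2) ?c" using homogeneous_chain[of "(n-1) # map id [1..<n-1]" n]
      by (simp add: numeral_2_eq_2)
    moreover have "top_coeff n ?c = 1" using top_coeff_chain[OF n permutes_id] by simp
    then have "braid_class n ?c \<noteq> braid_class n 0"
      unfolding braid_class_eq_iff using top_coeff_braid_ideal[of "?c - 0" n] by auto
    ultimately show "?P (n - 2)"
      unfolding internal_component_carrier internal_algebra_zero by blast
  next
    fix d assume P: "?P d"
    show "d \<le> n - 2"
    proof (rule ccontr)
      assume "\<not> d \<le> n - 2"
      then have "braid_class n p = braid_class n 0" if "p \<in> carrier (braid_sym n)" "homogeneous d p" for p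
        using homogeneous_in_braid_ideal[OF n that] by (simp add: braid_class_eq_iff)
      \<comment> \<open>The zero polynomial is homogeneous of every degree, so a component without
        other classes is exactly the singleton of the zero class.\<close>
      moreover have "0 \<in> carrier (braid_sym n)" using Sym_const[of 0] by simp
      ultimately show False
        using P homogeneous_zero unfolding internal_component_carrier internal_algebra_zero by blast
    qed
  qed
  then show ?thesis by (simp add: dual_braid_top_def internal_top_def)
qed

lemma dual_braid_top_simps:
  assumes "n \<ge> 3"
  shows "carrier (dual_braid_top n) = {braid_class n p |p. p \<in> carrier (braid_sym n) \<and> homogeneous (n - 2) p}"
    and "\<zero>\<^bsub>dual_braid_top n\<^esub> = braid_class n 0"
    and "p \<in> carrier (braid_sym n) \<Longrightarrow> q \<in> carrier (braid_sym n)
      \<Longrightarrow> braid_class n p \<oplus>\<^bsub>dual_braid_top n\<^esub> braid_class n q = braid_class n (p + q)"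
    and "p \<in> carrier (braid_sym n)
      \<Longrightarrow> a \<odot>\<^bsub>dual_braid_top n\<^esub> braid_class n p = braid_class n (const_poly a * p)"
proof -
  interpret ideal "braid_ideal n" "braid_sym n" by (rule internal_ideal_ideal)
  have hom: "(+>\<^bsub>braid_sym n\<^esub>) (braid_ideal n)
      \<in> ring_hom (braid_sym n) (internal_algebra (braid_kernel n) (braid_pairs n) (dual_hyperplane n))"
    unfolding internal_algebra_def by (rule rcos_ring_hom)
  show "carrier (dual_braid_top n) = {braid_class n p |p. p \<in> carrier (braid_sym n) \<and> homogeneous (n - 2) p}"
    unfolding dual_braid_top_eq[OF assms] by (rule internal_component_carrier)
  show "\<zero>\<^bsub>dual_braid_top n\<^esub> = braid_class n 0"
    unfolding dual_braid_top_eq[OF assms] by (simp add: internal_component_def Let_def internal_algebra_zero)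
  show "braid_class n p \<oplus>\<^bsub>dual_braid_top n\<^esub> braid_class n q = braid_class n (p + q)"
    if "p \<in> carrier (braid_sym n)" "q \<in> carrier (braid_sym n)"
    unfolding dual_braid_top_eq[OF assms]
    using ring_hom_add[OF hom that] by (simp add: internal_component_def Let_def braid_class_def)
  show "a \<odot>\<^bsub>dual_braid_top n\<^esub> braid_class n p = braid_class n (const_poly a * p)"
    if "p \<in> carrier (braid_sym n)"
    unfolding dual_braid_top_eq[OF assms]
    using ring_hom_mult[OF hom Sym_const that] by (simp add: internal_component_def Let_def braid_class_def)
qed

section \<open>Representations on functions\<close>

text \<open>Explicit maps run from functions to cosets, so \<Phi> goes from \<open>W\<close> to
  \<open>V\<close> and the isomorphism is its inverse. The module and representation axioms of
  \<open>V\<close> are transported along \<Phi>, which saves verifying them on cosets.\<close>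

lemma rep_isomorphic_surjection:
  assumes W: "representation G W \<sigma>"
    and bij: "bij_betw \<Phi> (carrier W) (carrier V)"
    and add: "\<And>x y. x \<in> carrier W \<Longrightarrow> y \<in> carrier W \<Longrightarrow> \<Phi> (x \<oplus>\<^bsub>W\<^esub> y) = \<Phi> x \<oplus>\<^bsub>V\<^esub> \<Phi> y"
    and smult: "\<And>a x. x \<in> carrier W \<Longrightarrow> \<Phi> (a \<odot>\<^bsub>W\<^esub> x) = a \<odot>\<^bsub>V\<^esub> \<Phi> x"
    and zero: "\<Phi> \<zero>\<^bsub>W\<^esub> = \<zero>\<^bsub>V\<^esub>"
    and equivariant: "\<And>g x. g \<in> carrier G \<Longrightarrow> x \<in> carrier W \<Longrightarrow> \<Phi> (\<sigma> g x) = \<rho> g (\<Phi> x)"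
  shows "rep_isomorphic G V \<rho> W \<sigma>"
proof -
  interpret W: module complex_ring W using W by (simp add: representation_def)
  have \<sigma>: "\<sigma> g x \<in> carrier W" if "g \<in> carrier G" "x \<in> carrier W" for g x
    using W that by (auto simp: representation_def linear_maps_def)
  have \<sigma>_add: "\<sigma> g (x \<oplus>\<^bsub>W\<^esub> y) = \<sigma> g x \<oplus>\<^bsub>W\<^esub> \<sigma> g y"
    and \<sigma>_smult: "\<sigma> g (a \<odot>\<^bsub>W\<^esub> x) = a \<odot>\<^bsub>W\<^esub> \<sigma> g x"
    if "g \<in> carrier G" "x \<in> carrier W" "y \<in> carrier W" for g x y a
    using W that by (auto simp: representation_def linear_maps_def)
  have scalars: "a \<in> carrier complex_ring" for a by (simp add: ring_of_type_algebra_def)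
  have V: "\<exists>w. w \<in> carrier W \<and> v = \<Phi> w" if "v \<in> carrier V" for v
    using bij that by (auto simp: bij_betw_def)
  have \<Phi>: "\<Phi> w \<in> carrier V" if "w \<in> carrier W" for w
    using bij that by (auto simp: bij_betw_def)
  have "abelian_group V"
  proof (rule abelian_groupI)
    fix x y z assume "x \<in> carrier V" "y \<in> carrier V" "z \<in> carrier V"
    then obtain a b c where [simp]: "x = \<Phi> a" "y = \<Phi> b" "z = \<Phi> c"
      and abc: "a \<in> carrier W" "b \<in> carrier W" "c \<in> carrier W" by (meson V)
    show "x \<oplus>\<^bsub>V\<^esub> y \<oplus>\<^bsub>V\<^esub> z = x \<oplus>\<^bsub>V\<^esub> (y \<oplus>\<^bsub>V\<^esub> z)"
      using abc by (simp add: add[symmetric] W.a_assoc)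
  next
    fix x y assume "x \<in> carrier V" "y \<in> carrier V"
    then obtain a b where [simp]: "x = \<Phi> a" "y = \<Phi> b" and ab: "a \<in> carrier W" "b \<in> carrier W"
      by (meson V)
    show "x \<oplus>\<^bsub>V\<^esub> y \<in> carrier V" using ab by (simp add: add[symmetric] \<Phi>)
    show "x \<oplus>\<^bsub>V\<^esub> y = y \<oplus>\<^bsub>V\<^esub> x" using ab by (simp add: add[symmetric] W.a_comm)
  next
    show "\<zero>\<^bsub>V\<^esub> \<in> carrier V" by (simp add: zero[symmetric] \<Phi>)
  next
    fix x assume "x \<in> carrier V"
    then obtain a where [simp]: "x = \<Phi> a" and a: "a \<in> carrier W" by (meson V)
    show "\<zero>\<^bsub>V\<^esub> \<oplus>\<^bsub>V\<^esub> x = x" using a by (simp add: zero[symmetric] add[symmetric])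
    show "\<exists>y\<in>carrier V. y \<oplus>\<^bsub>V\<^esub> x = \<zero>\<^bsub>V\<^esub>"
      using a by (intro bexI[of _ "\<Phi> (\<ominus>\<^bsub>W\<^esub> a)"]) (simp_all add: zero[symmetric] add[symmetric] \<Phi> W.l_neg)
  qed
  then have mod_V: "module complex_ring V"
  proof (intro moduleI)
    fix a b x y assume "x \<in> carrier V" "y \<in> carrier V"
    then obtain w w' where [simp]: "x = \<Phi> w" "y = \<Phi> w'" and w: "w \<in> carrier W" "w' \<in> carrier W"
      by (meson V)
    have closed: "c \<odot>\<^bsub>W\<^esub> w \<in> carrier W" "c \<odot>\<^bsub>W\<^esub> w' \<in> carrier W" for c
      using w scalars by (simp_all add: W.smult_closed)
    show "a \<odot>\<^bsub>V\<^esub> x \<in> carrier V" using w closed by (simp add: smult[symmetric] \<Phi>)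
    show "(a \<oplus>\<^bsub>complex_ring\<^esub> b) \<odot>\<^bsub>V\<^esub> x = a \<odot>\<^bsub>V\<^esub> x \<oplus>\<^bsub>V\<^esub> b \<odot>\<^bsub>V\<^esub> x"
      using w closed scalars by (simp add: smult[symmetric] add[symmetric] W.smult_l_distr)
    show "a \<odot>\<^bsub>V\<^esub> (x \<oplus>\<^bsub>V\<^esub> y) = a \<odot>\<^bsub>V\<^esub> x \<oplus>\<^bsub>V\<^esub> a \<odot>\<^bsub>V\<^esub> y"
      using w closed scalars by (simp add: smult[symmetric] add[symmetric] W.smult_r_distr)
    show "(a \<otimes>\<^bsub>complex_ring\<^esub> b) \<odot>\<^bsub>V\<^esub> x = a \<odot>\<^bsub>V\<^esub> (b \<odot>\<^bsub>V\<^esub> x)"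
      using w closed scalars by (simp add: smult[symmetric] W.smult_assoc1)
    show "\<one>\<^bsub>complex_ring\<^esub> \<odot>\<^bsub>V\<^esub> x = x"
      using w by (simp add: smult[symmetric] W.smult_one)
  qed (auto intro: cring_from_type_algebra)
  have rep_V: "representation G V \<rho>"
    unfolding representation_def linear_maps_def
  proof (intro conjI ballI CollectI allI)
    show "group G" using W by (simp add: representation_def)
    show "module complex_ring V" by (rule mod_V)
    fix g assume g: "g \<in> carrier G"
    show "\<rho> g \<in> carrier V \<rightarrow> carrier V"
    proof
      fix v assume "v \<in> carrier V"
      then obtain w where [simp]: "v = \<Phi> w" and w: "w \<in> carrier W" by (meson V)
      show "\<rho> g v \<in> carrier V" using \<Phi>[OF \<sigma>[OF g w]] equivariant[OF g w] by simp
    qed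
    fix x assume "x \<in> carrier V"
    then obtain w where [simp]: "x = \<Phi> w" and w: "w \<in> carrier W" by (meson V)
    show "\<rho> g (a \<odot>\<^bsub>V\<^esub> x) = a \<odot>\<^bsub>V\<^esub> \<rho> g x" for a
      using w g \<sigma>[OF g w] W.smult_closed[OF scalars w]
      by (simp add: smult[symmetric] equivariant[symmetric] \<sigma>_smult)
    fix y assume "y \<in> carrier V"
    then obtain w' where [simp]: "y = \<Phi> w'" and w': "w' \<in> carrier W" by (meson V)
    show "\<rho> g (x \<oplus>\<^bsub>V\<^esub> y) = \<rho> g x \<oplus>\<^bsub>V\<^esub> \<rho> g y"
      using w w' g \<sigma>[OF g] by (simp add: add[symmetric] equivariant[symmetric] \<sigma>_add)
  next
    fix v assume "v \<in> carrier V"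
    then obtain w where [simp]: "v = \<Phi> w" and w: "w \<in> carrier W" by (meson V)
    have G: "\<one>\<^bsub>G\<^esub> \<in> carrier G" using W by (simp add: representation_def group.is_monoid)
    show "\<rho> \<one>\<^bsub>G\<^esub> v = v" using W w G by (simp add: equivariant[symmetric] representation_def)
  next
    fix g h v assume gh: "g \<in> carrier G" "h \<in> carrier G" and "v \<in> carrier V"
    then obtain w where [simp]: "v = \<Phi> w" and w: "w \<in> carrier W" by (meson V)
    have "g \<otimes>\<^bsub>G\<^esub> h \<in> carrier G" using W gh by (simp add: representation_def group.is_monoid monoid.m_closed)
    then show "\<rho> (g \<otimes>\<^bsub>G\<^esub> h) v = \<rho> g (\<rho> h v)"
      using W w gh \<sigma> by (simp add: equivariant[symmetric] representation_def)
  qed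
  let ?f = "inv_into (carrier W) \<Phi>"
  have f_bij: "bij_betw ?f (carrier V) (carrier W)" by (rule bij_betw_inv_into[OF bij])
  have f: "?f (\<Phi> w) = w" if "w \<in> carrier W" for w
    by (rule bij_betw_inv_into_left[OF bij that])
  have "?f \<in> linear_maps V W"
    unfolding linear_maps_def
  proof (intro CollectI conjI ballI allI)
    show "?f \<in> carrier V \<rightarrow> carrier W" using f_bij by (auto simp: bij_betw_def)
    fix x assume "x \<in> carrier V"
    then obtain w where [simp]: "x = \<Phi> w" and w: "w \<in> carrier W" by (meson V)
    show "?f (a \<odot>\<^bsub>V\<^esub> x) = a \<odot>\<^bsub>W\<^esub> ?f x" for a
      using w W.smult_closed[OF scalars w] by (simp add: smult[symmetric] f)
    fix y assume "y \<in> carrier V"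
    then obtain w' where [simp]: "y = \<Phi> w'" and w': "w' \<in> carrier W" by (meson V)
    show "?f (x \<oplus>\<^bsub>V\<^esub> y) = ?f x \<oplus>\<^bsub>W\<^esub> ?f y" using w w' by (simp add: add[symmetric] f)
  qed
  moreover have "?f (\<rho> g v) = \<sigma> g (?f v)" if "g \<in> carrier G" "v \<in> carrier V" for g v
  proof -
    from V[OF that(2)] obtain w where [simp]: "v = \<Phi> w" and w: "w \<in> carrier W" by blast
    show ?thesis using w that \<sigma> by (simp add: equivariant[symmetric] f)
  qed
  ultimately show ?thesis using rep_V W f_bij by (auto simp: rep_isomorphic_def)
qed

text \<open>Common frame for both representations: all functions on the group for the regular one,
  the equivariant functions for the induced one. Extensionality makes equality a matter of values on
  \<open>A\<close>.\<close>

locale function_subspace =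
  fixes A :: "'a set" and E :: "('a \<Rightarrow> complex) set"
  assumes E_ext: "E \<subseteq> extensional A"
    and E_zero: "(\<lambda>x\<in>A. 0) \<in> E"
    and E_add: "b \<in> E \<Longrightarrow> b' \<in> E \<Longrightarrow> (\<lambda>x\<in>A. b x + b' x) \<in> E"
    and E_smult: "b \<in> E \<Longrightarrow> (\<lambda>x\<in>A. a * b x) \<in> E"
begin

abbreviation W :: "(complex, 'a \<Rightarrow> complex) module" where
  "W \<equiv> (function_module A complex_line)\<lparr>carrier := E\<rparr>"

lemma E_eqI: "b \<in> E \<Longrightarrow> b' \<in> E \<Longrightarrow> (\<And>x. x \<in> A \<Longrightarrow> b x = b' x) \<Longrightarrow> b = b'"
  using E_ext by (intro extensionalityI[of _ A]) auto

lemma function_module_simps [simp]: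
  "\<zero>\<^bsub>function_module A complex_line\<^esub> = (\<lambda>x\<in>A. 0)"
  "b \<oplus>\<^bsub>function_module A complex_line\<^esub> b' = (\<lambda>x\<in>A. b x + b' x)"
  "a \<odot>\<^bsub>function_module A complex_line\<^esub> b = (\<lambda>x\<in>A. a * b x)"
  by (simp_all add: function_module_def complex_line_def)

lemma E_sum:
  "(\<And>t. t \<in> T \<Longrightarrow> e t \<in> E) \<Longrightarrow> (\<lambda>x\<in>A. \<Sum>t\<in>T. c t * e t x) \<in> E"
proof (induction T rule: infinite_finite_induct)
  case (insert t T)
  have "(\<lambda>x\<in>A. (\<lambda>x\<in>A. c t * e t x) x + (\<lambda>x\<in>A. \<Sum>t\<in>T. c t * e t x) x) \<in> E"
    using insert by (intro E_add E_smult) auto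
  also have "(\<lambda>x\<in>A. (\<lambda>x\<in>A. c t * e t x) x + (\<lambda>x\<in>A. \<Sum>t\<in>T. c t * e t x) x)
      = (\<lambda>x\<in>A. \<Sum>t\<in>insert t T. c t * e t x)"
    using insert by (intro restrict_ext) auto
  finally show ?case .
qed (use E_zero in auto)

lemma module_W: "module complex_ring W"
proof (rule moduleI)
  show "cring complex_ring" by (rule cring_from_type_algebra)
  show "abelian_group W"
  proof (rule abelian_groupI)
    fix b assume "b \<in> carrier W"
    then show "\<exists>b'\<in>carrier W. b' \<oplus>\<^bsub>W\<^esub> b = \<zero>\<^bsub>W\<^esub>"
      using E_smult[of b "-1"] by (auto intro!: bexI[of _ "\<lambda>x\<in>A. - 1 * b x"])
  qed (auto intro!: E_eqI E_zero E_add E_zero[unfolded restrict_def] E_add[unfolded restrict_def]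
      simp: algebra_simps)
next
  fix a b x y assume "x \<in> carrier W" "y \<in> carrier W"
  then have xy: "x \<in> E" "y \<in> E" by simp_all
  show "a \<odot>\<^bsub>W\<^esub> x \<in> carrier W" using E_smult[OF xy(1)] by simp
  show "(a \<oplus>\<^bsub>complex_ring\<^esub> b) \<odot>\<^bsub>W\<^esub> x = a \<odot>\<^bsub>W\<^esub> x \<oplus>\<^bsub>W\<^esub> b \<odot>\<^bsub>W\<^esub> x"
    by (auto intro!: restrict_ext simp: ring_of_type_algebra_def algebra_simps)
  show "a \<odot>\<^bsub>W\<^esub> (x \<oplus>\<^bsub>W\<^esub> y) = a \<odot>\<^bsub>W\<^esub> x \<oplus>\<^bsub>W\<^esub> a \<odot>\<^bsub>W\<^esub> y"
    by (auto intro!: restrict_ext simp: algebra_simps)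
  show "(a \<otimes>\<^bsub>complex_ring\<^esub> b) \<odot>\<^bsub>W\<^esub> x = a \<odot>\<^bsub>W\<^esub> (b \<odot>\<^bsub>W\<^esub> x)"
    by (auto intro!: restrict_ext simp: ring_of_type_algebra_def algebra_simps)
  show "\<one>\<^bsub>complex_ring\<^esub> \<odot>\<^bsub>W\<^esub> x = x"
    using E_ext xy by (auto simp: ring_of_type_algebra_def extensional_restrict)
qed

lemma representation_W:
  assumes "group G"
    and "\<And>g b. g \<in> carrier G \<Longrightarrow> b \<in> E \<Longrightarrow> \<sigma> g b \<in> E"
    and "\<And>b x. b \<in> E \<Longrightarrow> x \<in> A \<Longrightarrow> \<sigma> \<one>\<^bsub>G\<^esub> b x = b x"
    and "\<And>g h b x. g \<in> carrier G \<Longrightarrow> h \<in> carrier G \<Longrightarrow> b \<in> E \<Longrightarrow> x \<in> A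
      \<Longrightarrow> \<sigma> (g \<otimes>\<^bsub>G\<^esub> h) b x = \<sigma> g (\<sigma> h b) x"
    and "\<And>g b b' x. g \<in> carrier G \<Longrightarrow> b \<in> E \<Longrightarrow> b' \<in> E \<Longrightarrow> x \<in> A
      \<Longrightarrow> \<sigma> g (\<lambda>x\<in>A. b x + b' x) x = \<sigma> g b x + \<sigma> g b' x"
    and "\<And>g a b x. g \<in> carrier G \<Longrightarrow> b \<in> E \<Longrightarrow> x \<in> A
      \<Longrightarrow> \<sigma> g (\<lambda>x\<in>A. a * b x) x = a * \<sigma> g b x"
  shows "representation G W \<sigma>"
proof -
  have G: "\<one>\<^bsub>G\<^esub> \<in> carrier G" "g \<otimes>\<^bsub>G\<^esub> h \<in> carrier G" if "g \<in> carrier G" "h \<in> carrier G" for g h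
    using assms(1) that by (simp_all add: group.is_monoid monoid.m_closed)
  show ?thesis
    unfolding representation_def linear_maps_def
    using assms(1) module_W
  proof (intro conjI ballI CollectI allI)
    fix b assume "b \<in> carrier W"
    then show "\<sigma> \<one>\<^bsub>G\<^esub> b = b"
      using assms(1) by (intro E_eqI assms(2,3)) (auto simp: group.is_monoid)
  next
    fix g h b assume *: "g \<in> carrier G" "h \<in> carrier G" "b \<in> carrier W"
    then show "\<sigma> (g \<otimes>\<^bsub>G\<^esub> h) b = \<sigma> g (\<sigma> h b)"
      using G by (intro E_eqI assms(2,4)) auto
  next
    fix g b b' assume *: "g \<in> carrier G" "b \<in> carrier W" "b' \<in> carrier W"
    then show "\<sigma> g (b \<oplus>\<^bsub>W\<^esub> b') = \<sigma> g b \<oplus>\<^bsub>W\<^esub> \<sigma> g b'"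
      by (intro E_eqI) (auto simp: assms(2,5) E_add)
  next
    fix g a b assume *: "g \<in> carrier G" "b \<in> carrier W"
    then show "\<sigma> g (a \<odot>\<^bsub>W\<^esub> b) = a \<odot>\<^bsub>W\<^esub> \<sigma> g b"
      by (intro E_eqI) (auto simp: assms(2,6) E_smult)
  qed (use assms(2) in auto)
qed

end

text \<open>The map that becomes the isomorphism once classes are taken.\<close>

definition lincomb :: "'a set \<Rightarrow> ('a \<Rightarrow> 'e cpoly) \<Rightarrow> ('a \<Rightarrow> complex) \<Rightarrow> 'e cpoly" where
  "lincomb A f b = (\<Sum>x\<in>A. const_poly (b x) * f x)"

lemma lincomb_add: "lincomb A f (\<lambda>x\<in>A. b x + b' x) = lincomb A f b + lincomb A f b'"
  by (simp add: lincomb_def const_poly_add distrib_right sum.distrib)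

lemma lincomb_smult: "lincomb A f (\<lambda>x\<in>A. a * b x) = const_poly a * lincomb A f b"
  by (simp add: lincomb_def const_poly_mult sum_distrib_left mult.assoc)

lemma lincomb_zero: "lincomb A f (\<lambda>x\<in>A. 0) = 0"
  by (simp add: lincomb_def)

lemma lincomb_cong: "(\<And>x. x \<in> A \<Longrightarrow> b x = b' x) \<Longrightarrow> lincomb A f b = lincomb A f b'"
  by (simp add: lincomb_def)

text \<open>Both isomorphisms come from a family \<open>f\<close> of polynomials indexed by the
  group; they differ in how \<open>surj\<close> and \<open>inj\<close> are obtained. Injectivity is
  asked for as triviality of the kernel, to which differences of functions reduce it.\<close>

lemma (in function_subspace) dual_braid_top_rep_isomorphic:
  assumes n: "n \<ge> 3"
    and rep: "representation G W \<sigma>"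
    and f: "\<And>x. x \<in> A \<Longrightarrow> f x \<in> carrier (braid_sym n)" "\<And>x. x \<in> A \<Longrightarrow> homogeneous (n - 2) (f x)"
    and G: "\<And>g. g \<in> carrier G \<Longrightarrow> g permutes {1..n}"
    and equivariant: "\<And>g b. g \<in> carrier G \<Longrightarrow> b \<in> E \<Longrightarrow> lincomb A f (\<sigma> g b) = poly_action g (lincomb A f b)"
    and surj: "\<And>p. p \<in> carrier (braid_sym n) \<Longrightarrow> homogeneous (n - 2) p
      \<Longrightarrow> \<exists>b\<in>E. p - lincomb A f b \<in> braid_ideal n"
    and inj: "\<And>b x. b \<in> E \<Longrightarrow> lincomb A f b \<in> braid_ideal n \<Longrightarrow> x \<in> A \<Longrightarrow> b x = 0"
  shows "rep_isomorphic G (dual_braid_top n) class_action W \<sigma>"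
proof (rule rep_isomorphic_surjection[OF rep, where \<Phi> = "\<lambda>b. braid_class n (lincomb A f b)"])
  note top = dual_braid_top_simps[OF n]
  have Sym: "lincomb A f b \<in> carrier (braid_sym n)" for b
    unfolding lincomb_def by (intro braid.S_sum Sym_mult Sym_const f(1))
  have hom: "homogeneous (n - 2) (lincomb A f b)" for b
    unfolding lincomb_def by (intro homogeneous_sum homogeneous_const_poly_times f(2))
  show "bij_betw (\<lambda>b. braid_class n (lincomb A f b)) (carrier W) (carrier (dual_braid_top n))"
    unfolding bij_betw_def
  proof
    show "inj_on (\<lambda>b. braid_class n (lincomb A f b)) (carrier W)"
    proof (rule inj_onI)
      fix b b' assume b: "b \<in> carrier W" "b' \<in> carrier W"
        and "braid_class n (lincomb A f b) = braid_class n (lincomb A f b')"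
      then have diff: "lincomb A f b - lincomb A f b' \<in> braid_ideal n" by (simp add: braid_class_eq_iff)
      let ?d = "\<lambda>x\<in>A. b x + (\<lambda>x\<in>A. - 1 * b' x) x"
      have "?d \<in> E" using b by (intro E_add E_smult) auto
      moreover have "lincomb A f ?d = lincomb A f b - lincomb A f b'"
        unfolding lincomb_add lincomb_smult by (simp add: const_poly_uminus)
      ultimately have "?d x = 0" if "x \<in> A" for x using inj that diff by metis
      then show "b = b'" using b by (intro E_eqI) auto
    qed
    show "(\<lambda>b. braid_class n (lincomb A f b)) ` carrier W = carrier (dual_braid_top n)"
    proof (intro equalityI subsetI)
      fix v assume "v \<in> carrier (dual_braid_top n)"
      then obtain p where p: "v = braid_class n p" "p \<in> carrier (braid_sym n)" "homogeneous (n - 2) p"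
        by (auto simp: top)
      then obtain b where "b \<in> E" "p - lincomb A f b \<in> braid_ideal n" using surj by blast
      then show "v \<in> (\<lambda>b. braid_class n (lincomb A f b)) ` carrier W"
        by (auto simp: p braid_class_eq_iff)
    qed (use Sym hom in \<open>auto simp: top\<close>)
  qed
  show "braid_class n (lincomb A f (x \<oplus>\<^bsub>W\<^esub> y))
      = braid_class n (lincomb A f x) \<oplus>\<^bsub>dual_braid_top n\<^esub> braid_class n (lincomb A f y)" for x y
    by (simp add: top Sym lincomb_add)
  show "braid_class n (lincomb A f (a \<odot>\<^bsub>W\<^esub> x)) = a \<odot>\<^bsub>dual_braid_top n\<^esub> braid_class n (lincomb A f x)" for a x
    by (simp add: top Sym lincomb_smult)
  show "braid_class n (lincomb A f \<zero>\<^bsub>W\<^esub>) = \<zero>\<^bsub>dual_braid_top n\<^esub>"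
    by (simp add: top lincomb_zero)
  show "braid_class n (lincomb A f (\<sigma> g x)) = class_action g (braid_class n (lincomb A f x))"
    if "g \<in> carrier G" "x \<in> carrier W" for g x
    using that by (simp add: class_action_braid_class[OF G Sym] equivariant)
qed

section \<open>The regular representation\<close>

lemma finite_sym_group: "finite (carrier (sym_group k))"
  using finite_permutations[of "{1..k}"] by (simp add: sym_group_def)

lemma permutation_of_list:
  assumes "distinct ws" "set ws = {1..k}"
  shows "\<exists>x. x permutes {1..k} \<and> map x [1..<Suc k] = ws"
proof -
  define x where "x i = (if i \<in> {1..k} then ws ! (i - 1) else i)" for i
  have len: "length ws = k" using assms by (metis card_atLeastAtMost diff_Suc_1 distinct_card)
  have map_x: "map x [1..<Suc k] = ws"
    by (rule nth_equalityI) (auto simp: len x_def nth_upt simp del: upt_Suc)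
  have "set (map x [1..<Suc k]) = {1..k}" using map_x assms(2) by simp
  then have image: "x ` {1..k} = {1..k}"
    by (metis atLeastLessThanSuc_atLeastAtMost image_set set_upt)
  then have "inj_on x {1..k}" by (intro eq_card_imp_inj_on) auto
  with image have "bij_betw x {1..k} {1..k}" by (simp add: bij_betw_def)
  then have "x permutes {1..k}" by (rule bij_imp_permutes) (auto simp: x_def)
  with map_x show ?thesis by blast
qed

lemma permutation_between_lists:
  fixes k :: nat
  assumes "distinct cs" "set cs = {1..k}" "distinct ws" "set ws = {1..k}"
  shows "\<exists>x. x permutes {1..k} \<and> map x cs = ws"
proof -
  obtain a b where a: "a permutes {1..k}" "map a [1..<Suc k] = cs"
    and b: "b permutes {1..k}" "map b [1..<Suc k] = ws"
    using permutation_of_list assms by metis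
  have "map (b \<circ> inv' a) cs = ws"
    by (simp only: a(2)[symmetric] b(2)[symmetric] map_map comp_assoc permutes_inv_o[OF a(1)] comp_id)
  then show ?thesis using permutes_compose[OF permutes_inv[OF a(1)] b(1)] by blast
qed

definition root_chain :: "nat \<Rightarrow> (nat \<Rightarrow> nat) \<Rightarrow> (nat \<times> nat) cpoly" where
  "root_chain n x = chain (yform n) ((n-1) # map x [1..<n-1])"

abbreviation root_lincomb :: "nat \<Rightarrow> ((nat \<Rightarrow> nat) \<Rightarrow> complex) \<Rightarrow> (nat \<times> nat) cpoly" where
  "root_lincomb n \<equiv> lincomb (carrier (sym_group (n - 2))) (root_chain n)"

context
  fixes n :: nat
  assumes n: "n \<ge> 3"
begin

lemma sym_group_permutes_n:
  assumes "g \<in> carrier (sym_group k)" "k < n"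
  shows "g permutes {1..n}" "g n = n"
proof -
  have g: "g permutes {1..k}" using assms(1) by (simp add: sym_group_carrier)
  show "g permutes {1..n}" by (rule permutes_subset[OF g]) (use assms(2) in auto)
  show "g n = n" by (rule permutes_not_in[OF g]) (use assms(2) in auto)
qed

lemma root_word:
  assumes "x \<in> carrier (sym_group (n - 2))"
  shows "distinct ((n-1) # map x [1..<n-1])" "set ((n-1) # map x [1..<n-1]) = {1..n-1}"
proof -
  have x: "x permutes {1..n-2}" using assms by (simp add: sym_group_carrier)
  have interval: "{1..<n-1} = {1..n-2}" using n by auto
  have set: "set (map x [1..<n-1]) = {1..n-2}"
    unfolding set_map set_upt interval by (rule permutes_image[OF x])
  have "distinct (map x [1..<n-1])" using permutes_inj_on[OF x] by (simp add: distinct_map)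
  with set show "distinct ((n-1) # map x [1..<n-1])" using n by auto
  show "set ((n-1) # map x [1..<n-1]) = {1..n-1}" using n set by auto
qed

lemma root_chain_in_Sym: "x \<in> carrier (sym_group (n - 2)) \<Longrightarrow> root_chain n x \<in> carrier (braid_sym n)"
  unfolding root_chain_def using root_word by (intro chain_in_Sym) simp

lemma homogeneous_root_chain: "homogeneous (n - 2) (root_chain n x)"
  using homogeneous_chain[of "(n-1) # map x [1..<n-1]" n]
  by (simp add: root_chain_def numeral_2_eq_2)

text \<open>The smaller group fixes the root \<open>n - 1\<close>, so acting on letters is left
  multiplication on \<open>x\<close>; this is the simply transitive action on the basis.\<close>

lemma poly_action_root_chain:
  assumes "g \<in> carrier (sym_group (n - 2))"
  shows "poly_action g (root_chain n x) = root_chain n (g \<circ> x)"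
proof -
  have "g (n - 1) = n - 1"
    using assms n by (intro permutes_not_in[of _ "{1..n-2}"]) (auto simp: sym_group_carrier)
  then show ?thesis using sym_group_permutes_n(2)[OF assms] n
    by (simp add: root_chain_def poly_action_chain)
qed

text \<open>Coefficient functions are built along the closure rules of the span; a single chain has
  the indicator of its permutation.\<close>

lemma root_lincomb_surj:
  assumes "p \<in> carrier (braid_sym n)" "homogeneous (n - 2) p"
  shows "\<exists>b\<in>extensional (carrier (sym_group (n - 2))). p - root_lincomb n b \<in> braid_ideal n"
proof -
  let ?A = "carrier (sym_group (n - 2))"
  from assms have "p \<in> lspan (braid_ideal n
      \<union> {chain (yform n) ((n-1) # ws) |ws. distinct ws \<and> set ws = {1..n-2}})"
    by (rule homogeneous_in_lspan_chains[OF n])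
  then show ?thesis
  proof induction
    case zero
    show ?case by (rule bexI[of _ "\<lambda>x\<in>?A. 0"])
      (simp_all only: lincomb_zero diff_zero internal_ideal_zero restrict_extensional)
  next
    case (base p)
    then show ?case
    proof
      assume "p \<in> braid_ideal n"
      then show ?thesis by (intro bexI[of _ "\<lambda>x\<in>?A. 0"])
        (simp_all only: lincomb_zero diff_zero restrict_extensional)
    next
      assume "p \<in> {chain (yform n) ((n-1) # ws) |ws. distinct ws \<and> set ws = {1..n-2}}"
      then obtain ws where ws: "p = chain (yform n) ((n-1) # ws)" "distinct ws" "set ws = {1..n-2}"
        by blast
      obtain x where x: "x permutes {1..n-2}" "map x [1..<Suc (n-2)] = ws"
        using permutation_of_list[OF ws(2,3)] by blast
      have "Suc (n - 2) = n - 1" using n by simp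
      then have p: "p = root_chain n x" using ws(1) x(2) by (simp add: root_chain_def)
      have "root_lincomb n (\<lambda>z\<in>?A. if z = x then 1 else 0) = (\<Sum>z\<in>?A. if z = x then p else 0)"
        unfolding lincomb_def by (rule sum.cong) (auto simp: p)
      also have "\<dots> = p" using x(1) finite_sym_group by (simp add: sym_group_carrier)
      finally have eq: "root_lincomb n (\<lambda>z\<in>?A. if z = x then 1 else 0) = p" .
      show ?thesis
        by (rule bexI[of _ "\<lambda>z\<in>?A. if z = x then 1 else 0"])
          (simp_all only: eq diff_self internal_ideal_zero restrict_extensional)
    qed
  next
    case (add p q)
    then obtain b b' where "p - root_lincomb n b \<in> braid_ideal n" "q - root_lincomb n b' \<in> braid_ideal n"
      by blast
    then have "(p - root_lincomb n b) + (q - root_lincomb n b') \<in> braid_ideal n"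
      by (rule internal_ideal_add)
    also have "(p - root_lincomb n b) + (q - root_lincomb n b')
        = p + q - root_lincomb n (\<lambda>x\<in>?A. b x + b' x)"
      unfolding lincomb_add by (simp add: algebra_simps)
    finally show ?case by (rule bexI[of _ "\<lambda>x\<in>?A. b x + b' x"]) (rule restrict_extensional)
  next
    case (scale p a)
    then obtain b where "p - root_lincomb n b \<in> braid_ideal n" by blast
    then have "const_poly a * (p - root_lincomb n b) \<in> braid_ideal n"
      by (intro internal_ideal_mult Sym_const)
    also have "const_poly a * (p - root_lincomb n b)
        = const_poly a * p - root_lincomb n (\<lambda>x\<in>?A. a * b x)"
      unfolding lincomb_smult by (simp add: algebra_simps)
    finally show ?case by (rule bexI[of _ "\<lambda>x\<in>?A. a * b x"]) (rule restrict_extensional)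
  qed
qed

text \<open>The functional sees only the coefficient at the identity. Acting by the inverse of
  \<open>x\<close>, which preserves the ideal, brings the coefficient at \<open>x\<close>
  there.\<close>

lemma root_lincomb_inj:
  assumes "root_lincomb n b \<in> braid_ideal n" "x \<in> carrier (sym_group (n - 2))"
  shows "b x = 0"
proof -
  let ?A = "carrier (sym_group (n - 2))" and ?g = "inv' x"
  have x: "x permutes {1..n-2}" using assms(2) by (simp add: sym_group_carrier)
  then have g: "?g \<in> ?A" by (simp add: sym_group_carrier permutes_inv)
  have "poly_action ?g (root_lincomb n b) \<in> braid_ideal n"
    using sym_group_permutes_n(1)[OF g] n by (intro poly_action_braid_ideal assms(1)) auto
  also have "poly_action ?g (root_lincomb n b) = (\<Sum>z\<in>?A. const_poly (b z) * root_chain n (?g \<circ> z))"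
    by (simp add: lincomb_def poly_action_hom poly_action_root_chain[OF g])
  finally have "0 = (\<Sum>z\<in>?A. b z * top_coeff n (root_chain n (?g \<circ> z)))"
    using top_coeff_braid_ideal by (simp only: top_coeff_linear[symmetric])
  also have "\<dots> = (\<Sum>z\<in>?A. if z = x then b x else 0)"
  proof (rule sum.cong[OF refl])
    fix z assume "z \<in> ?A"
    then have "?g \<circ> z permutes {1..n-2}"
      using g by (intro permutes_compose) (simp_all add: sym_group_carrier)
    moreover have "?g \<circ> z = id \<longleftrightarrow> z = x"
    proof
      assume "?g \<circ> z = id"
      then have "x \<circ> (?g \<circ> z) = x" by simp
      then show "z = x" by (simp only: o_assoc permutes_inv_o[OF x] id_comp)
    qed (simp add: permutes_inv_o[OF x])
    ultimately show "b z * top_coeff n (root_chain n (?g \<circ> z)) = (if z = x then b x else 0)"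
      unfolding root_chain_def by (subst top_coeff_chain[OF n]) auto
  qed
  also have "\<dots> = b x" using assms(2) finite_sym_group by simp
  finally show ?thesis by simp
qed

text \<open>Spanning and independence of the root chains give the bijection; equivariance is a
  reindexing of the sum by left multiplication, which accounts for the inverse in
  \<open>regular_action\<close>.\<close>

lemma dual_braid_top_regular:
  "rep_isomorphic (sym_group (n - 2)) (dual_braid_top n) class_action
     (regular_module (sym_group (n - 2))) (regular_action (sym_group (n - 2)))"
proof -
  let ?G = "sym_group (n - 2)"
  let ?A = "carrier ?G"
  interpret G: group ?G by (rule sym_group_is_group)
  interpret function_subspace ?A "extensional ?A" by unfold_locales auto
  have W: "regular_module ?G = W"
    by (simp add: regular_module_def function_module_def complex_line_def PiE_def)
  have rep: "representation ?G W (regular_action ?G)"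
    by (rule representation_W)
       (auto simp: regular_action_def G.inv_mult_group G.m_assoc intro: sym_group_is_group
         simp del: sym_group_inv_equality)
  show ?thesis unfolding W
  proof (rule dual_braid_top_rep_isomorphic[OF n rep])
    fix g b assume g: "g \<in> ?A"
    have perm: "g permutes {1..n-2}" using g by (simp add: sym_group_carrier)
    have "poly_action g (root_lincomb n b) = (\<Sum>x\<in>?A. const_poly (b x) * root_chain n (g \<circ> x))"
      by (simp add: lincomb_def poly_action_hom poly_action_root_chain[OF g])
    also have "\<dots> = (\<Sum>x\<in>?A. const_poly (b (inv\<^bsub>?G\<^esub> g \<otimes>\<^bsub>?G\<^esub> x)) * root_chain n x)"
    proof (rule sum.reindex_bij_witness[of _ "\<lambda>x. inv\<^bsub>?G\<^esub> g \<otimes>\<^bsub>?G\<^esub> x" "\<lambda>x. g \<otimes>\<^bsub>?G\<^esub> x"])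
      fix x assume x: "x \<in> ?A"
      show "inv\<^bsub>?G\<^esub> g \<otimes>\<^bsub>?G\<^esub> (g \<otimes>\<^bsub>?G\<^esub> x) = x" "g \<otimes>\<^bsub>?G\<^esub> (inv\<^bsub>?G\<^esub> g \<otimes>\<^bsub>?G\<^esub> x) = x"
        using x g by (simp_all add: G.m_assoc[symmetric] del: sym_group_inv_equality)
      then show "const_poly (b (inv\<^bsub>?G\<^esub> g \<otimes>\<^bsub>?G\<^esub> (g \<otimes>\<^bsub>?G\<^esub> x))) * root_chain n (g \<otimes>\<^bsub>?G\<^esub> x)
        = const_poly (b x) * root_chain n (g \<circ> x)" by (simp add: sym_group_mult del: sym_group_inv_equality)
    qed (use g in \<open>auto simp del: sym_group_inv_equality\<close>)
    finally show "root_lincomb n (regular_action ?G g b) = poly_action g (root_lincomb n b)"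
      by (simp add: lincomb_def regular_action_def del: sym_group_inv_equality)
  qed (use root_chain_in_Sym homogeneous_root_chain sym_group_permutes_n(1) n root_lincomb_surj
      root_lincomb_inj in auto)
qed

end

section \<open>The induced representation\<close>

text \<open>The list \<open>cs\<close> is kept along with the cycle because it serves as the
  reference word, which the powers of \<open>c\<close> rotate.\<close>

locale long_cycle =
  fixes n :: nat and cs :: "nat list" and c :: "nat \<Rightarrow> nat" and \<zeta> :: "(nat \<Rightarrow> nat) \<Rightarrow> complex"
  assumes n: "n \<ge> 3"
    and dist: "distinct cs" and set_cs: "set cs = {1..n-1}"
    and c: "c = cycle_of_list cs"
    and \<zeta>_hom: "\<zeta> \<in> hom (subgroup_generated (sym_group (n - 1)) {c}) (mult_of complex_ring)"
    and \<zeta>_c: "\<zeta> c = exp (2 * of_real pi * \<i> / of_nat (n - 1))"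
begin

abbreviation G where "G \<equiv> sym_group (n - 1)"
abbreviation A where "A \<equiv> carrier G"
abbreviation H where "H \<equiv> carrier (subgroup_generated G {c})"

definition E :: "((nat \<Rightarrow> nat) \<Rightarrow> complex) set" where
  "E = {b \<in> A \<rightarrow>\<^sub>E carrier complex_line. \<forall>h\<in>H. \<forall>x\<in>A. b (h \<otimes>\<^bsub>G\<^esub> x) = \<zeta> h * b x}"

text \<open>The inverse puts the two sides of the group in place: multiplying \<open>g\<close> by
  \<open>c\<close> on the left rotates the word, while multiplication on the right permutes its
  letters, as the induced action requires.\<close>

definition cycle_chain :: "(nat \<Rightarrow> nat) \<Rightarrow> (nat \<times> nat) cpoly" where
  "cycle_chain g = chain (yform n) (map (inv' g) cs)"

section \<open>The cyclic group and its character\<close>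

lemma length_cs: "length cs = n - 1"
  using distinct_card[OF dist] set_cs by simp

sublocale G: group G
  by (rule sym_group_is_group)

lemma c_in_A: "c \<in> A"
  using cycle_permutes[of cs] by (simp add: c set_cs sym_group_carrier)

lemma c_permutes: "c permutes {1..n-1}"
  using c_in_A by (simp add: sym_group_carrier)

lemma c_pow_in_H: "c ^^ k \<in> H"
proof (induction k)
  interpret H: group "subgroup_generated G {c}" by (rule G.group_subgroup_generated)
  case 0
  show ?case using H.one_closed by (simp add: sym_group_one id_def)
next
  interpret H: group "subgroup_generated G {c}" by (rule G.group_subgroup_generated)
  case (Suc k)
  have "c \<in> H" using c_in_A by (auto simp: carrier_subgroup_generated intro: generate.incl)
  then have "c \<otimes>\<^bsub>subgroup_generated G {c}\<^esub> c ^^ k \<in> H" using Suc by (rule H.m_closed)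
  then show ?case by (simp only: funpow.simps mult_subgroup_generated sym_group_mult)
qed

lemma c_pow_card: "c ^^ (n - 1) = id"
  using cycle_is_id_root[OF dist] by (simp add: c length_cs)

text \<open>Natural exponents suffice because the inverse of \<open>c\<close> is its power with
  exponent n - 2.\<close>

lemma H_pow:
  assumes "h \<in> H"
  obtains k where "h = c ^^ k"
proof -
  have "h \<in> generate G (A \<inter> {c})" using assms by (simp add: carrier_subgroup_generated)
  then have "\<exists>k. h = c ^^ k"
  proof induction
    case one
    then show ?case by (intro exI[of _ 0]) (simp add: sym_group_one id_def)
  next
    case (incl h)
    then show ?case by (intro exI[of _ 1]) simp
  next
    case (inv h)
    then have h: "h = c" by simp
    have "n - 1 = Suc (n - 2)" using n by simp
    then have "c ^^ (n - 2) \<circ> c = id" using c_pow_card by (simp only: funpow_Suc_right)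
    then have "c ^^ (n - 2) \<circ> (c \<circ> inv' c) = inv' c" by (simp only: o_assoc id_comp)
    then have "inv' c = c ^^ (n - 2)" by (simp only: permutes_inv_o[OF c_permutes] comp_id)
    then show ?case using c_in_A h by auto
  next
    case (eng h1 h2)
    then obtain k1 k2 where "h1 = c ^^ k1" "h2 = c ^^ k2" by blast
    then have "h1 \<otimes>\<^bsub>G\<^esub> h2 = c ^^ (k1 + k2)" by (simp only: sym_group_mult funpow_add)
    then show ?case by blast
  qed
  with that show ?thesis by blast
qed

lemma \<zeta>_pow: "\<zeta> (c ^^ k) = \<zeta> c ^ k"
proof (induction k)
  interpret H: group "subgroup_generated G {c}" by (rule G.group_subgroup_generated)
  case 0
  \<comment> \<open>The value at the identity is idempotent, and it is nonzero because the target is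
    \<open>mult_of\<close>; hence it is 1.\<close>
  have "\<zeta> (id \<otimes>\<^bsub>subgroup_generated G {c}\<^esub> id) = \<zeta> id * \<zeta> id" "\<zeta> id \<noteq> 0"
    using \<zeta>_hom c_pow_in_H[of 0]
    by (auto simp: hom_def ring_of_type_algebra_def id_def Pi_def)
  then have "\<zeta> id * \<zeta> id = \<zeta> id" by (simp add: sym_group_mult)
  then have "\<zeta> id = 1" using \<open>\<zeta> id \<noteq> 0\<close> by simp
  then show ?case by (simp add: id_def)
next
  case (Suc k)
  have "\<zeta> (c \<otimes>\<^bsub>subgroup_generated G {c}\<^esub> c ^^ k) = \<zeta> c * \<zeta> (c ^^ k)"
    using \<zeta>_hom c_pow_in_H[of 1] c_pow_in_H[of k]
    by (simp add: hom_def ring_of_type_algebra_def)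
  then show ?case using Suc
    by (simp only: funpow.simps power.simps mult_subgroup_generated sym_group_mult)
qed

lemma \<zeta>_c_pow: "\<zeta> c ^ k = cis (2 * pi * real k / real (n - 1))"
proof -
  have "\<zeta> c = cis (2 * pi / real (n - 1))"
    unfolding \<zeta>_c cis_conv_exp by (simp add: field_simps)
  then show ?thesis by (simp add: DeMoivre field_simps)
qed

lemma \<zeta>_c_nz: "\<zeta> c \<noteq> 0"
  by (simp add: \<zeta>_c)

lemma \<zeta>_c_pow_card: "\<zeta> c ^ (n - 1) = 1"
  using n unfolding \<zeta>_c_pow by simp

text \<open>Keeps the scalar by which Klyachko's element acts from vanishing; it rests on the
  distinctness of the roots of unity.\<close>

lemma \<zeta>_c_pow_neq_1:
  assumes "0 < k" "k < n - 1"
  shows "\<zeta> c ^ k \<noteq> 1"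
proof
  assume "\<zeta> c ^ k = 1"
  then have eq: "cis (2 * pi * real k / real (n - 1)) = cis (2 * pi * real 0 / real (n - 1))"
    by (simp add: \<zeta>_c_pow)
  have inj: "inj_on (\<lambda>k. cis (2 * pi * real k / real (n - 1))) {..<n-1}"
    using bij_betw_roots_unity[of "n - 1"] n by (simp add: bij_betw_def)
  have "k = 0" by (rule inj_onD[OF inj eq]) (use assms in auto)
  then show False using assms by simp
qed

lemma \<zeta>_nz: "h \<in> H \<Longrightarrow> \<zeta> h \<noteq> 0"
  by (metis H_pow \<zeta>_pow \<zeta>_c_nz power_not_zero)

lemma H_subset: "H \<subseteq> A"
  by (rule G.carrier_subgroup_generated_subset)

lemma inv_permutes: "g \<in> A \<Longrightarrow> inv' g permutes {1..n-1}"
  by (simp add: sym_group_carrier permutes_inv)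

lemma word:
  assumes "g \<in> A"
  shows "distinct (map (inv' g) cs)" "set (map (inv' g) cs) = {1..n-1}"
  using permutes_inj_on[OF inv_permutes[OF assms]] permutes_image[OF inv_permutes[OF assms]] dist set_cs
  by (simp_all add: distinct_map)

text \<open>Turns sums over the group into sums over words, the form in which Klyachko's element was
  treated.\<close>

lemma word_bij:
  "bij_betw (\<lambda>g. map (inv' g) cs) A {w. distinct w \<and> set w = set cs}"
  unfolding bij_betw_def
proof
  show "inj_on (\<lambda>g. map (inv' g) cs) A"
  proof (rule inj_onI)
    fix g h assume gh: "g \<in> A" "h \<in> A" and "map (inv' g) cs = map (inv' h) cs"
    then have "inv' g x = inv' h x" if "x \<in> {1..n-1}" for x using that set_cs by auto
    moreover have "inv' g x = inv' h x" if "x \<notin> {1..n-1}" for x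
      using permutes_not_in[OF inv_permutes that] gh by simp
    ultimately have "inv' g = inv' h" by blast
    then show "g = h" using gh by (metis permutes_inv_inv sym_group_carrier)
  qed
  show "(\<lambda>g. map (inv' g) cs) ` A = {w. distinct w \<and> set w = set cs}"
  proof (intro equalityI subsetI)
    fix w assume "w \<in> {w. distinct w \<and> set w = set cs}"
    then obtain x where x: "x permutes {1..n-1}" "map x cs = w"
      using permutation_between_lists[OF dist set_cs, of w] set_cs by auto
    then have "w = map (inv' (inv' x)) cs" "inv' x \<in> A"
      by (simp_all add: permutes_inv_inv sym_group_carrier permutes_inv)
    then show "w \<in> (\<lambda>g. map (inv' g) cs) ` A" by blast
  qed (use word set_cs in auto)
qed

definition klyachko_fun :: "(nat \<Rightarrow> nat) \<Rightarrow> complex" where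
  "klyachko_fun = (\<lambda>g\<in>A. klyachko_weight (inverse (\<zeta> c)) cs (map (inv' g) cs))"

text \<open>The word of \<open>g\<close> is the word of \<open>c \<circ> g\<close> with its first
  letter moved to the end, which multiplies the weight by q. Taking q to be the inverse of
  \<open>\<zeta> c\<close> makes the function equivariant for \<zeta> itself.\<close>

lemma klyachko_fun_c:
  assumes "g \<in> A"
  shows "klyachko_fun (c \<circ> g) = \<zeta> c * klyachko_fun g"
proof -
  have cg: "c \<circ> g \<in> A" using G.m_closed[OF c_in_A assms] by (simp add: sym_group_mult)
  have g: "g permutes {1..n-1}" using assms by (simp add: sym_group_carrier)
  let ?w = "map (inv' (c \<circ> g)) cs"
  have "?w \<noteq> []" using length_cs n by auto
  then obtain z v where w: "?w = z # v" by (meson neq_Nil_conv)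
  have "inv' (c \<circ> g) = inv' g \<circ> inv' c"
    by (rule o_inv_distrib[OF permutes_bij[OF c_permutes] permutes_bij[OF g]])
  then have "inv' (c \<circ> g) \<circ> c = inv' g"
    by (simp only: comp_assoc permutes_inv_o[OF c_permutes] comp_id)
  then have "map (inv' g) cs = map (inv' (c \<circ> g)) (map c cs)" by (simp only: map_map)
  also have "map c cs = rotate1 cs"
    using cyclic_rotation[OF dist, of 1] by (simp add: c)
  also have "map (inv' (c \<circ> g)) (rotate1 cs) = rotate1 ?w" by (simp only: rotate1_map)
  also have "\<dots> = v @ [z]" unfolding w by simp
  finally have "klyachko_fun g = klyachko_weight (inverse (\<zeta> c)) cs (v @ [z])"
    using assms by (simp add: klyachko_fun_def)
  also have "\<dots> = inverse (\<zeta> c) * klyachko_weight (inverse (\<zeta> c)) cs (z # v)"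
  proof (rule klyachko_weight_rotate[OF dist])
    show "distinct (z # v)" "set (z # v) = set cs" using word[OF cg] unfolding w set_cs .
    show "inverse (\<zeta> c) ^ length cs = 1"
      using \<zeta>_c_pow_card by (simp add: length_cs power_inverse)
  qed
  also have "klyachko_weight (inverse (\<zeta> c)) cs (z # v) = klyachko_fun (c \<circ> g)"
    using cg by (simp add: klyachko_fun_def w)
  finally show ?thesis using \<zeta>_c_nz by (simp add: field_simps)
qed

lemma klyachko_fun_in_E: "klyachko_fun \<in> E"
proof -
  have pow: "klyachko_fun (c ^^ k \<circ> x) = \<zeta> c ^ k * klyachko_fun x" if x: "x \<in> A" for k x
  proof (induction k)
    case (Suc k)
    have "c ^^ k \<circ> x \<in> A"
      using G.m_closed[OF subsetD[OF H_subset c_pow_in_H[of k]] x] by (simp add: sym_group_mult)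
    from klyachko_fun_c[OF this] show ?case unfolding funpow.simps comp_assoc Suc by (simp only: mult.assoc power.simps)
  qed (simp add: id_def[symmetric])
  have "klyachko_fun (h \<otimes>\<^bsub>G\<^esub> x) = \<zeta> h * klyachko_fun x" if h: "h \<in> H" and x: "x \<in> A" for h x
    using H_pow[OF h] pow[OF x] \<zeta>_pow by (metis sym_group_mult)
  moreover have "klyachko_fun \<in> A \<rightarrow>\<^sub>E carrier complex_line"
    by (auto simp: klyachko_fun_def complex_line_def)
  ultimately show ?thesis by (simp add: E_def)
qed

lemma E_equiv: "b \<in> E \<Longrightarrow> h \<in> H \<Longrightarrow> x \<in> A \<Longrightarrow> b (h \<circ> x) = \<zeta> h * b x"
  by (auto simp: E_def sym_group_mult)

lemma E_I:
  assumes "b \<in> extensional A" "\<And>h x. h \<in> H \<Longrightarrow> x \<in> A \<Longrightarrow> b (h \<circ> x) = \<zeta> h * b x"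
  shows "b \<in> E"
  using assms by (auto simp: E_def sym_group_mult complex_line_def PiE_def)

lemma H_comp_in_A: "h \<in> H \<Longrightarrow> x \<in> A \<Longrightarrow> h \<circ> x \<in> A"
  using G.m_closed[of h x] H_subset by (auto simp: sym_group_mult)

sublocale function_subspace A E
proof
  show "E \<subseteq> extensional A" by (auto simp: E_def PiE_def)
  show "(\<lambda>x\<in>A. 0) \<in> E" 
    by (rule E_I) (simp_all only: restrict_apply' H_comp_in_A restrict_extensional mult_zero_right)
  show "(\<lambda>x\<in>A. b x + b' x) \<in> E" if "b \<in> E" "b' \<in> E" for b b'
    by (rule E_I) (simp_all only: restrict_apply' H_comp_in_A restrict_extensional E_equiv[OF that(1)]
      E_equiv[OF that(2)] distrib_left)
  show "(\<lambda>x\<in>A. a * b x) \<in> E" if "b \<in> E" for a b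
    by (rule E_I) (simp_all only: restrict_apply' H_comp_in_A restrict_extensional E_equiv[OF that]
      mult.left_commute)
qed

lemma cycle_chain_in_Sym: "g \<in> A \<Longrightarrow> cycle_chain g \<in> carrier (braid_sym n)"
  unfolding cycle_chain_def using word(2) by (intro chain_in_Sym) simp

lemma homogeneous_cycle_chain: "homogeneous (n - 2) (cycle_chain g)"
proof -
  have "length (map (inv' g) cs) - 1 = n - 2" "map (inv' g) cs \<noteq> []" using length_cs n by auto
  then show ?thesis unfolding cycle_chain_def using homogeneous_chain by metis
qed

lemma poly_action_cycle_chain:
  assumes "h \<in> A" "g \<in> A"
  shows "poly_action h (cycle_chain g) = cycle_chain (g \<circ> inv' h)"
proof -
  have perm: "h permutes {1..n-1}" "g permutes {1..n-1}" using assms by (simp_all add: sym_group_carrier)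
  have "inv' (g \<circ> inv' h) = inv' (inv' h) \<circ> inv' g"
    by (rule o_inv_distrib[OF permutes_bij permutes_bij[OF permutes_inv]]) (rule perm)+
  then have "inv' (g \<circ> inv' h) = h \<circ> inv' g" by (simp only: permutes_inv_inv[OF perm(1)])
  moreover have "h n = n" using sym_group_permutes_n(2)[OF n assms(1)] n by simp
  ultimately show ?thesis by (simp add: cycle_chain_def poly_action_chain)
qed

lemma lincomb_induced_action:
  assumes h: "h \<in> A"
  shows "lincomb A cycle_chain (induced_action G h b) = poly_action h (lincomb A cycle_chain b)"
proof -
  have "poly_action h (lincomb A cycle_chain b) = (\<Sum>x\<in>A. const_poly (b x) * cycle_chain (x \<otimes>\<^bsub>G\<^esub> inv\<^bsub>G\<^esub> h))"
    using h by (simp add: lincomb_def poly_action_hom poly_action_cycle_chain sym_group_mult)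
  also have "\<dots> = (\<Sum>x\<in>A. const_poly (b (x \<otimes>\<^bsub>G\<^esub> h)) * cycle_chain x)"
    by (rule sum.reindex_bij_witness[of _ "\<lambda>x. x \<otimes>\<^bsub>G\<^esub> h" "\<lambda>x. x \<otimes>\<^bsub>G\<^esub> inv\<^bsub>G\<^esub> h"])
       (use h in \<open>auto simp: G.m_assoc simp del: sym_group_inv_equality One_nat_def\<close>)
  finally show ?thesis by (simp add: lincomb_def induced_action_def)
qed

lemma induced_action_E:
  assumes h: "h \<in> A" and b: "b \<in> E"
  shows "induced_action G h b \<in> E"
proof (rule E_I)
  fix k x assume "k \<in> H" "x \<in> A"
  moreover have "x \<circ> h \<in> A" using G.m_closed[OF \<open>x \<in> A\<close> h] by (simp add: sym_group_mult)
  ultimately show "induced_action G h b (k \<circ> x) = \<zeta> k * induced_action G h b x"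
    using E_equiv[OF b, of k "x \<circ> h"] 
    by (simp add: induced_action_def H_comp_in_A sym_group_mult comp_assoc del: One_nat_def)
qed (simp add: induced_action_def)

lemma representation_induced: "representation G W (induced_action G)"
proof (rule representation_W)
  show "induced_action G g b \<in> E" if "g \<in> A" "b \<in> E" for g b
    using that by (rule induced_action_E)
qed (auto simp: induced_action_def G.m_assoc simp del: One_nat_def intro: sym_group_is_group)

text \<open>Modulo the ideal, Klyachko's function is sent to a nonzero multiple of the chain along
  \<open>cs\<close>. Acting by \<open>x\<close> gives the chain along any word, and the translated
  function stays in \<open>E\<close>.\<close>

lemma chain_in_lincomb:
  assumes "x \<in> A"
  shows "\<exists>b\<in>E. chain (yform n) (map x cs) - lincomb A cycle_chain b \<in> braid_ideal n"
proof -
  let ?q = "inverse (\<zeta> c)"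
  define \<kappa> where "\<kappa> = (\<Prod>i\<in>{1..<length cs}. 1 - ?q ^ i)"
  \<comment> \<open>No power of \<open>\<zeta> c\<close> with exponent from 1 to n - 2 equals
    1.\<close>
  have \<kappa>: "\<kappa> \<noteq> 0"
    using \<zeta>_c_pow_neq_1 \<zeta>_c_nz by (auto simp: \<kappa>_def length_cs power_inverse field_simps)
  have "lincomb A cycle_chain klyachko_fun = (\<Sum>g\<in>A. const_poly (klyachko_weight ?q cs (map (inv' g) cs)) * chain (yform n) (map (inv' g) cs))"
    by (simp add: lincomb_def klyachko_fun_def cycle_chain_def)
  also have "\<dots> = (\<Sum>w | distinct w \<and> set w = set cs. const_poly (klyachko_weight ?q cs w) * chain (yform n) w)"
    by (rule sum.reindex_bij_betw[OF word_bij])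
  finally have "lincomb A cycle_chain klyachko_fun - const_poly \<kappa> * chain (yform n) cs \<in> braid_ideal n"
    using braid.sum_klyachko_weight_chain[OF dist, of n ?q] set_cs by (simp add: \<kappa>_def)
  then have "poly_action x (lincomb A cycle_chain klyachko_fun - const_poly \<kappa> * chain (yform n) cs) \<in> braid_ideal n"
    using sym_group_permutes_n(1)[OF n assms] n by (intro poly_action_braid_ideal) auto
  \<comment> \<open>The factor \<open>- inverse \<kappa>\<close> normalises the chain and at the
    same time reverses the order of the difference.\<close>
  then have "const_poly (- inverse \<kappa>) * poly_action x (lincomb A cycle_chain klyachko_fun - const_poly \<kappa> * chain (yform n) cs)
      \<in> braid_ideal n"
    by (intro internal_ideal_mult Sym_const)
  also have "poly_action x (lincomb A cycle_chain klyachko_fun - const_poly \<kappa> * chain (yform n) cs)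
      = lincomb A cycle_chain (induced_action G x klyachko_fun) - const_poly \<kappa> * chain (yform n) (map x cs)"
    using sym_group_permutes_n(2)[OF n assms] n
    
    by (simp add: lincomb_induced_action[OF assms] poly_action_hom poly_action_chain del: One_nat_def)
  also have "const_poly (- inverse \<kappa>) * (lincomb A cycle_chain (induced_action G x klyachko_fun) - const_poly \<kappa> * chain (yform n) (map x cs))
      = const_poly (inverse \<kappa> * \<kappa>) * chain (yform n) (map x cs)
        - lincomb A cycle_chain (\<lambda>g\<in>A. inverse \<kappa> * induced_action G x klyachko_fun g)"
    unfolding lincomb_smult const_poly_mult by (simp add: const_poly_uminus algebra_simps)
  also have "const_poly (inverse \<kappa> * \<kappa>) * chain (yform n) (map x cs) = chain (yform n) (map x cs)"
    using \<kappa> by simp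
  finally have "chain (yform n) (map x cs)
      - lincomb A cycle_chain (\<lambda>g\<in>A. inverse \<kappa> * induced_action G x klyachko_fun g) \<in> braid_ideal n" .
  moreover have "(\<lambda>g\<in>A. inverse \<kappa> * induced_action G x klyachko_fun g) \<in> E"
    by (intro E_smult induced_action_E klyachko_fun_in_E assms)
  ultimately show ?thesis by (rule bexI)
qed

section \<open>Bijectivity\<close>

lemma lincomb_sum:
  assumes "finite T"
  shows "lincomb A cycle_chain (\<lambda>x\<in>A. \<Sum>t\<in>T. a t * e t x) = (\<Sum>t\<in>T. const_poly (a t) * lincomb A cycle_chain (e t))"
proof -
  have "lincomb A cycle_chain (\<lambda>x\<in>A. \<Sum>t\<in>T. a t * e t x) = (\<Sum>x\<in>A. \<Sum>t\<in>T. const_poly (a t * e t x) * cycle_chain x)"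
    by (simp add: lincomb_def const_poly_sum sum_distrib_right)
  also have "\<dots> = (\<Sum>t\<in>T. \<Sum>x\<in>A. const_poly (a t * e t x) * cycle_chain x)" by (rule sum.swap)
  finally show ?thesis by (simp add: lincomb_def sum_distrib_left const_poly_mult mult.assoc)
qed

lemma root_chain_in_lincomb:
  assumes "x \<in> carrier (sym_group (n - 2))"
  shows "\<exists>b\<in>E. root_chain n x - lincomb A cycle_chain b \<in> braid_ideal n"
proof -
  obtain y where y: "y permutes {1..n-1} \<and> map y cs = (n-1) # map x [1..<n-1]"
    using permutation_between_lists[OF dist set_cs root_word[OF n assms]] ..
  then have "y \<in> A" by (simp add: sym_group_carrier)
  from chain_in_lincomb[OF this] y show ?thesis unfolding root_chain_def by metis
qed

text \<open>Root chains span and each has a preimage in \<open>E\<close>; these preimages are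
  combined with the coefficients of \<open>p\<close>.\<close>

lemma lincomb_surj:
  assumes "p \<in> carrier (braid_sym n)" "homogeneous (n - 2) p"
  shows "\<exists>b\<in>E. p - lincomb A cycle_chain b \<in> braid_ideal n"
proof -
  let ?T = "carrier (sym_group (n - 2))"
  obtain a where a: "p - root_lincomb n a \<in> braid_ideal n"
    using root_lincomb_surj[OF n assms] by blast
  have "\<forall>t\<in>?T. \<exists>b. b \<in> E \<and> root_chain n t - lincomb A cycle_chain b \<in> braid_ideal n"
    using root_chain_in_lincomb by blast
  from bchoice[OF this] obtain e where e: "\<And>t. t \<in> ?T \<Longrightarrow> e t \<in> E"
    "\<And>t. t \<in> ?T \<Longrightarrow> root_chain n t - lincomb A cycle_chain (e t) \<in> braid_ideal n" by blast
  have "(\<Sum>t\<in>?T. const_poly (a t) * (root_chain n t - lincomb A cycle_chain (e t))) \<in> braid_ideal n"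
    by (intro braid.J_sum internal_ideal_mult Sym_const e(2))
  with a have "(p - root_lincomb n a) + (\<Sum>t\<in>?T. const_poly (a t) * (root_chain n t - lincomb A cycle_chain (e t)))
      \<in> braid_ideal n" by (rule internal_ideal_add)
  also have "(p - root_lincomb n a) + (\<Sum>t\<in>?T. const_poly (a t) * (root_chain n t - lincomb A cycle_chain (e t)))
      = p - lincomb A cycle_chain (\<lambda>x\<in>A. \<Sum>t\<in>?T. a t * e t x)"
    unfolding lincomb_sum[OF finite_sym_group]
    by (simp add: lincomb_def[of ?T] right_diff_distrib sum_subtractf)
  finally show ?thesis
    by (rule bexI[of _ "\<lambda>x\<in>A. \<Sum>t\<in>?T. a t * e t x"]) (rule E_sum[OF e(1)])
qed

text \<open>Every element of the group is a product of a power of \<open>c\<close> and an element fixing \<open>n - 1\<close>.\<close>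

lemma E_vanish:
  assumes b: "b \<in> E" and vanish: "\<And>x. x \<in> carrier (sym_group (n - 2)) \<Longrightarrow> b x = 0" and g: "g \<in> A"
  shows "b g = 0"
proof -
  have "g permutes {1..n-1}" using g by (simp add: sym_group_carrier)
  then have "g (n - 1) \<in> set cs" "n - 1 \<in> set cs"
    using n permutes_in_image[of g "{1..n-1}" "n-1"] set_cs by auto
  then obtain i j where i: "i < n - 1" "cs ! i = g (n - 1)" and j: "j < n - 1" "cs ! j = n - 1"
    by (metis in_set_conv_nth length_cs)
  \<comment> \<open>Rotating by \<open>k\<close> moves position \<open>i\<close> to position
    \<open>j\<close>; the full turn n - 1 is added so that the subtraction is not truncated.\<close>
  define k where "k = n - 1 - i + j"
  have "(c ^^ k) (cs ! i) = map (c ^^ k) cs ! i" using i by (simp add: length_cs)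
  also have "\<dots> = cs ! ((i + k) mod (n - 1))"
    using i by (simp add: c cyclic_rotation[OF dist] nth_rotate length_cs add.commute)
  also have "(i + k) mod (n - 1) = j"
  proof -
    have eq: "i + k = (n - 1) + j" using i by (simp add: k_def)
    show ?thesis unfolding eq mod_add_self1 by (rule mod_less[OF j(1)])
  qed
  finally have fix_n: "(c ^^ k \<circ> g) (n - 1) = n - 1" using i j by simp
  moreover have "c ^^ k \<circ> g \<in> A" by (rule H_comp_in_A[OF c_pow_in_H g])
  moreover have "n - 2 = n - 1 - 1" using n by simp
  ultimately have "c ^^ k \<circ> g \<in> carrier (sym_group (n - 2))"
    using sym_group_stabilizer[of "n - 1"] n by simp
  then have "\<zeta> (c ^^ k) * b g = 0"
    using vanish E_equiv[OF b c_pow_in_H g] by metis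
  then show ?thesis using \<zeta>_nz[OF c_pow_in_H] by simp
qed

text \<open>By the previous lemma \<open>E\<close> has dimension at most \<open>(n - 2)!\<close>, which is the dimension of the
  top component by \<open>root_lincomb_inj\<close>, so that surjectivity forces injectivity.\<close>

lemma lincomb_inj:
  assumes b: "b \<in> E" "lincomb A cycle_chain b \<in> braid_ideal n" and x: "x \<in> A"
  shows "b x = 0"
proof -
  let ?T = "carrier (sym_group (n - 2))"
  have "\<forall>t\<in>?T. \<exists>b. b \<in> E \<and> root_chain n t - lincomb A cycle_chain b \<in> braid_ideal n"
    using root_chain_in_lincomb by blast
  from bchoice[OF this] obtain e where e: "\<And>t. t \<in> ?T \<Longrightarrow> e t \<in> E"
    "\<And>t. t \<in> ?T \<Longrightarrow> root_chain n t - lincomb A cycle_chain (e t) \<in> braid_ideal n" by blast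
  \<comment> \<open>The given \<open>b\<close> together with the chosen preimages makes one function
    more than \<open>?T\<close> has elements, so some nontrivial combination vanishes on
    \<open>?T\<close>, hence on all of \<open>A\<close> by \<open>E_vanish\<close>.\<close>
  define B where "B = insert None (Some ` ?T)"
  define e' where "e' t = (case t of None \<Rightarrow> b | Some t \<Rightarrow> e t)" for t
  have finB: "finite B" by (simp add: B_def finite_sym_group)
  have "card ?T < card B" by (simp add: B_def finite_sym_group card_image)
  then obtain a where a: "\<exists>t\<in>B. a t \<noteq> 0" "\<And>y. y \<in> ?T \<Longrightarrow> (\<Sum>t\<in>B. a t * e' t y) = 0"
    using homogeneous_linear_system[OF finite_sym_group finB, of "n - 2" "\<lambda>y t. e' t y"] by blast
  let ?s = "\<lambda>y\<in>A. \<Sum>t\<in>B. a t * e' t y"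
  have sE: "?s \<in> E" by (rule E_sum) (use b e in \<open>auto simp: B_def e'_def\<close>)
  have "?T \<subseteq> A"
  proof -
    have "n - 2 = n - 1 - 1" using n by simp
    then show ?thesis using sym_group_stabilizer[of "n - 1"] n by auto
  qed
  then have s_T: "?s y = 0" if "y \<in> ?T" for y using a(2)[OF that] that by auto
  have s0: "(\<Sum>t\<in>B. a t * e' t y) = 0" if "y \<in> A" for y
    using E_vanish[OF sE s_T that] that by simp
  have sum_B: "sum F B = F None + (\<Sum>t\<in>?T. F (Some t))" for F :: "_ \<Rightarrow> 'z::comm_monoid_add"
    by (simp add: B_def finite_sym_group sum.reindex)
  have "lincomb A cycle_chain ?s = 0"
    unfolding lincomb_zero[of A cycle_chain, symmetric] by (rule lincomb_cong) (simp add: s0)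
  moreover have "lincomb A cycle_chain ?s = (\<Sum>t\<in>B. const_poly (a t) * lincomb A cycle_chain (e' t))"
    by (rule lincomb_sum[OF finB])
  ultimately have "const_poly (a None) * lincomb A cycle_chain b + (\<Sum>t\<in>?T. const_poly (a (Some t)) * lincomb A cycle_chain (e t)) = 0"
    by (simp only: sum_B e'_def option.case)
  \<comment> \<open>The image of this relation places a combination of root chains in the ideal, so
    their independence kills every coefficient except that of \<open>b\<close>.\<close>
  then have "root_lincomb n (\<lambda>t. a (Some t))
      = (\<Sum>t\<in>?T. const_poly (a (Some t)) * (root_chain n t - lincomb A cycle_chain (e t)))
        - const_poly (a None) * lincomb A cycle_chain b"
    by (simp add: lincomb_def[of ?T] right_diff_distrib sum_subtractf add_eq_0_iff)
  also have "\<dots> \<in> braid_ideal n"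
    by (intro braid.J_diff braid.J_sum internal_ideal_mult Sym_const e(2) b(2))
  finally have a_Some: "a (Some t) = 0" if "t \<in> ?T" for t
    using root_lincomb_inj[OF n _ that] by blast
  then have "a None \<noteq> 0" using a(1) by (auto simp: B_def)
  moreover have "a None * b x = 0" using s0[OF x] a_Some unfolding sum_B by (simp add: e'_def)
  ultimately show ?thesis by simp
qed

lemma dual_braid_top_induced:
  "rep_isomorphic G (dual_braid_top n) class_action
     (induced_module G H complex_line (\<lambda>h z. \<zeta> h * z)) (induced_action G)"
proof -
  have W: "induced_module G H complex_line (\<lambda>h z. \<zeta> h * z) = W"
    by (simp add: induced_module_def E_def)
  show ?thesis unfolding W
    by (rule dual_braid_top_rep_isomorphic[OF n representation_induced])
      (use cycle_chain_in_Sym homogeneous_cycle_chain sym_group_permutes_n(1)[OF n] n lincomb_induced_action lincomb_surj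
        lincomb_inj in auto)
qed

end

theorem theorem8p1:
  fixes n :: nat and c :: "nat \<Rightarrow> nat" and \<zeta> :: "(nat \<Rightarrow> nat) \<Rightarrow> complex"
  assumes "n \<ge> 3"
    and "c \<in> carrier (sym_group (n - 1))"
    and "\<exists>cs. cycle cs \<and> length cs = n - 1 \<and> c = cycle_of_list cs"
    and "\<zeta> \<in> hom (subgroup_generated (sym_group (n - 1)) {c}) (mult_of complex_ring)"
    and "\<zeta> c = exp (2 * of_real pi * \<i> / of_nat (n - 1))"
  shows "rep_isomorphic (sym_group (n - 1))
           (dual_braid_top n) class_action
           (induced_module (sym_group (n - 1)) (carrier (subgroup_generated (sym_group (n - 1)) {c}))
              complex_line (\<lambda>h z. \<zeta> h * z))
           (induced_action (sym_group (n - 1)))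
       \<and> rep_isomorphic (sym_group (n - 2))
           (dual_braid_top n) class_action
           (regular_module (sym_group (n - 2))) (regular_action (sym_group (n - 2)))"
proof -
  from assms(3) obtain cs where cs: "distinct cs" "length cs = n - 1" "c = cycle_of_list cs" by blast
  \<comment> \<open>With n \<ge> 3 the list has at least two letters, so \<open>c\<close> moves each
    of them; since \<open>c\<close> permutes \<open>{1..n-1}\<close>, all letters lie there.\<close>
  have moved: "c (cs ! i) \<noteq> cs ! i" if "i < length cs" for i
  proof -
    have "c (cs ! i) = map c cs ! i" using that by simp
    also have "map c cs = rotate1 cs" using cyclic_rotation[OF cs(1), of 1] by (simp add: cs(3))
    also have "rotate1 cs ! i = cs ! (Suc i mod length cs)" by (rule nth_rotate1[OF that])
    also have "\<dots> \<noteq> cs ! i"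
    proof -
      have "Suc i mod length cs < length cs" by (rule mod_less_divisor) (use that in auto)
      moreover have "Suc i mod length cs \<noteq> i" using that cs(2) assms(1) by (auto simp: mod_Suc)
      ultimately show ?thesis using that cs(1) by (simp add: nth_eq_iff_index_eq)
    qed
    finally show ?thesis .
  qed
  have "set cs = {1..n-1}"
  proof (rule card_subset_eq)
    have c: "c permutes {1..n-1}" using assms(2) by (simp add: sym_group_carrier)
    show "set cs \<subseteq> {1..n-1}"
      using moved permutes_not_in[OF c] by (metis in_set_conv_nth subsetI)
    show "card (set cs) = card {1..n-1}" using distinct_card[OF cs(1)] cs(2) by simp
  qed simp
  then interpret long_cycle n cs c \<zeta>
    using assms cs by unfold_locales auto
  show ?thesis using dual_braid_top_induced dual_braid_top_regular[OF assms(1)] by blast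
qed

end
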